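(* Let $n\in\mathbb N=\{1,2,3,\ldots\}$. The Poincaré return map of $\mathcal F_n$ on the disc $\{\theta_1=\mathrm{const.},\,r_2<1\}\subset S^3$ near the central fixed point has a Leau–Fatou flower with $n$ attracting petals.
   Context: $S^3\subset\mathbb C^2$ is the unit sphere, and $z_j=r_j\mathrm e^{\mathrm i\theta_j}$. $\mathcal F_n$ is the oriented, cooriented $1$-dimensional foliation of $S^3$ tangent to the common kernel of the real and imaginary parts of the restriction to $TS^3$ of $\omega_n=nz_1\,\mathrm dz_2-z_2\,\mathrm dz_1+z_2^n\,\mathrm dz_2$; the coorientation is given by (real part)$\wedge$(imaginary part), and the leaves are oriented so that leaf orientation together with coorientation gives the standard orientation of $S^3$. The Hopf circle $S^1\times\{0\}$ is a closed leaf, and near its centre $r_2=0$ the disc $\{\theta_1=\mathrm{const.},\,r_2<1\}$ is transverse to $\mathcal F_n$; the centre of the disc is the intersection point with this closed leaf. The Poincaré return map is the germ at the centre of the first return map along the leaves; with respect to the complex structure on the disc near its centre induced by the transverse holomorphic structure defined by $\omega_n$, it is a holomorphic germ $f$ fixing the centre. Terminology (Milnor): let $f$ be a holomorphic germ at a fixed point $0$ whose multiplier $f'(0)$ is a primitive $q$-th root of unity, no iterate of $f$ being the identity, and write $F=f^{\circ q}$, $F(z)=z+cz^{N+1}+\cdots$ with $c\ne0$. There are $N$ attracting and $N$ repelling directions at $0$, alternating: $v$ is attracting if $Ncv^N$ is a negative real number and repelling if it is a positive real number. An open set $P$ is an attracting petal for an attracting direction if $F(P)\subset P$ and an orbit of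 $F$ is eventually absorbed by $P$ if and only if it converges to $0$ (without reaching $0$) along this direction; repelling petals are attracting petals for $F^{-1}$. To say that $f$ has a Leau–Fatou flower with $N$ attracting petals means that (in this situation) in any neighbourhood of $0$ there are $2N$ simply connected petals $P_0,\dots,P_{2N-1}$, alternately attracting and repelling and in cyclic order around $0$, whose union together with $0$ is an open neighbourhood of $0$; for $N>1$ each petal meets each of its two immediate neighbours in a simply connected region and is disjoint from the remaining ones. *)

theory Defs
  imports "HOL-Complex_Analysis.Complex_Analysis"
begin

section \<open>The foliation of the three-sphere\<close>

abbreviation S3 :: "(complex \<times> complex) set" where
  "S3 \<equiv> sphere 0 1"

definition tangent_S3 :: "complex \<times> complex \<Rightarrow> (complex \<times> complex) set" where
  "tangent_S3 z = {v. inner z v = 0}"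

text \<open>The value at the point \<open>z\<close>, on the vector \<open>v\<close>, of the 1-form
  \<open>n z\<^sub>1 dz\<^sub>2 - z\<^sub>2 dz\<^sub>1 + z\<^sub>2\<^sup>n dz\<^sub>2\<close>.\<close>

definition omega :: "nat \<Rightarrow> complex \<times> complex \<Rightarrow> complex \<times> complex \<Rightarrow> complex" where
  "omega n z v = of_nat n * fst z * snd v - snd z * fst v + snd z ^ n * snd v"

text \<open>The value on \<open>(u, w)\<close> of the 2-form (real part of \<open>\<omega>\<^sub>n\<close>) \<open>\<and>\<close> (imaginary part of \<open>\<omega>\<^sub>n\<close>).\<close>

definition coorientation ::
    "nat \<Rightarrow> complex \<times> complex \<Rightarrow> complex \<times> complex \<Rightarrow> complex \<times> complex \<Rightarrow> real" where
  "coorientation n z u w =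
     Re (omega n z u) * Im (omega n z w) - Re (omega n z w) * Im (omega n z u)"

definition to_R4 :: "complex \<times> complex \<Rightarrow> real ^ 4" where
  "to_R4 z = vector [Re (fst z), Im (fst z), Re (snd z), Im (snd z)]"

text \<open>The standard orientation of the sphere as the boundary of the unit ball (outward normal
  first): a triple of tangent vectors is positive iff the normal \<open>z\<close> followed by the triple is a
  positive basis of \<open>\<real>\<^sup>4\<close>, where \<open>\<complex>\<^sup>2\<close> has the coordinates \<open>x\<^sub>1, y\<^sub>1, x\<^sub>2, y\<^sub>2\<close>.\<close>

definition positive_triple ::
    "complex \<times> complex \<Rightarrow> complex \<times> complex \<Rightarrow> complex \<times> complex \<Rightarrow> complex \<times> complex \<Rightarrow> bool" where
  "positive_triple z v u w \<longleftrightarrow>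
     det (vector [to_R4 z, to_R4 v, to_R4 u, to_R4 w] :: real ^ 4 ^ 4) > 0"

definition positive_leaf_vector :: "nat \<Rightarrow> complex \<times> complex \<Rightarrow> complex \<times> complex \<Rightarrow> bool" where
  "positive_leaf_vector n z v \<longleftrightarrow>
     v \<in> tangent_S3 z \<and> v \<noteq> 0 \<and> omega n z v = 0 \<and>
     (\<forall>u\<in>tangent_S3 z. \<forall>w\<in>tangent_S3 z. coorientation n z u w > 0 \<longrightarrow> positive_triple z v u w)"

definition leaf_curve :: "nat \<Rightarrow> real \<Rightarrow> (real \<Rightarrow> complex \<times> complex) \<Rightarrow> bool" where
  "leaf_curve n T \<gamma> \<longleftrightarrow>
     (\<forall>t\<in>{0..T}. \<gamma> t \<in> S3 \<and>
        (\<exists>v. (\<gamma> has_vector_derivative v) (at t within {0..T}) \<and> positive_leaf_vector n (\<gamma> t) v))"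


section \<open>The return map on the disc\<close>

text \<open>The disc \<open>{\<theta>\<^sub>1 = \<theta>, r\<^sub>2 < 1}\<close>; on the sphere, \<open>r\<^sub>2 < 1\<close> means that \<open>z\<^sub>1 \<noteq> 0\<close>,
  so that \<open>\<theta>\<^sub>1\<close> is defined.\<close>

definition disc :: "real \<Rightarrow> (complex \<times> complex) set" where
  "disc \<theta> = {z \<in> S3. norm (snd z) < 1 \<and> fst z = of_real (norm (fst z)) * cis \<theta>}"

definition centre :: "real \<Rightarrow> complex \<times> complex" where
  "centre \<theta> = (cis \<theta>, 0)"

definition first_return ::
    "nat \<Rightarrow> real \<Rightarrow> complex \<times> complex \<Rightarrow> complex \<times> complex \<Rightarrow> bool" where
  "first_return n \<theta> p q \<longleftrightarrow> p \<in> disc \<theta> \<and> q \<in> disc \<theta> \<and>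
     (\<exists>T \<gamma>. T > 0 \<and> leaf_curve n T \<gamma> \<and> \<gamma> 0 = p \<and> \<gamma> T = q \<and> (\<forall>t\<in>{0<..<T}. \<gamma> t \<notin> disc \<theta>))"

text \<open>Only meaningful at those \<open>p\<close> whose first return point exists and is unique.\<close>

definition return_map :: "nat \<Rightarrow> real \<Rightarrow> complex \<times> complex \<Rightarrow> complex \<times> complex" where
  "return_map n \<theta> p = (THE q. first_return n \<theta> p q)"

text \<open>The transverse holomorphic structure is given by the complex-valued submersions \<open>\<Phi>\<close> on open
  subsets of the sphere whose differential on the sphere is a nowhere vanishing multiple of
  \<open>\<omega>\<^sub>n\<close>. Since the derivative is taken within the sphere, it constrains the
  differential of \<open>\<Phi>\<close> on tangent vectors of the sphere only.\<close>

definition transverse_chart ::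
    "nat \<Rightarrow> (complex \<times> complex) set \<Rightarrow> (complex \<times> complex \<Rightarrow> complex) \<Rightarrow> bool" where
  "transverse_chart n W \<Phi> \<longleftrightarrow> openin (top_of_set S3) W \<and>
     (\<forall>p\<in>W. \<exists>g. g \<noteq> 0 \<and> (\<Phi> has_derivative (\<lambda>v. g * omega n p v)) (at p within S3))"

text \<open>The restriction of \<open>\<Phi>\<close> to \<open>W \<inter> disc \<theta>\<close> is a holomorphic chart of the disc around its
  centre, for the complex structure induced by the transverse one.\<close>

definition disc_chart ::
    "nat \<Rightarrow> real \<Rightarrow> (complex \<times> complex) set \<Rightarrow> (complex \<times> complex \<Rightarrow> complex) \<Rightarrow> bool" where
  "disc_chart n \<theta> W \<Phi> \<longleftrightarrow> transverse_chart n W \<Phi> \<and>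
     centre \<theta> \<in> W \<and> \<Phi> (centre \<theta>) = 0 \<and> inj_on \<Phi> (W \<inter> disc \<theta>)"

text \<open>Only the germ at \<open>0\<close> is meaningful.\<close>

definition return_germ ::
    "nat \<Rightarrow> real \<Rightarrow> (complex \<times> complex) set \<Rightarrow> (complex \<times> complex \<Rightarrow> complex) \<Rightarrow> complex \<Rightarrow> complex" where
  "return_germ n \<theta> W \<Phi> z = \<Phi> (return_map n \<theta> (inv_into (W \<inter> disc \<theta>) \<Phi> z))"


section \<open>Leau--Fatou flowers\<close>

definition primitive_root :: "nat \<Rightarrow> complex \<Rightarrow> bool" where
  "primitive_root q \<mu> \<longleftrightarrow> q > 0 \<and> \<mu> ^ q = 1 \<and> (\<forall>k. 0 < k \<and> k < q \<longrightarrow> \<mu> ^ k \<noteq> 1)"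

text \<open>\<open>F(z) = z + c z\<^sup>N\<^sup>+\<^sup>1 + \<dots>\<close> with \<open>c \<noteq> 0\<close>.\<close>

definition parabolic_expansion :: "(complex \<Rightarrow> complex) \<Rightarrow> nat \<Rightarrow> complex \<Rightarrow> bool" where
  "parabolic_expansion F N c \<longleftrightarrow> N > 0 \<and> c \<noteq> 0 \<and>
     (\<exists>H. F has_fps_expansion (fps_X + fps_const c * fps_X ^ (N + 1) + fps_X ^ (N + 2) * H))"

definition attracting_direction :: "nat \<Rightarrow> complex \<Rightarrow> complex \<Rightarrow> bool" where
  "attracting_direction N c v \<longleftrightarrow> of_nat N * c * v ^ N \<in> \<real> \<and> Re (of_nat N * c * v ^ N) < 0"

definition repelling_direction :: "nat \<Rightarrow> complex \<Rightarrow> complex \<Rightarrow> bool" where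
  "repelling_direction N c v \<longleftrightarrow> of_nat N * c * v ^ N \<in> \<real> \<and> Re (of_nat N * c * v ^ N) > 0"

definition orbit_in :: "complex set \<Rightarrow> (complex \<Rightarrow> complex) \<Rightarrow> (nat \<Rightarrow> complex) \<Rightarrow> bool" where
  "orbit_in U F w \<longleftrightarrow> (\<forall>k. w k \<in> U \<and> w (Suc k) = F (w k))"

definition converges_along :: "(nat \<Rightarrow> complex) \<Rightarrow> complex \<Rightarrow> bool" where
  "converges_along w v \<longleftrightarrow>
     w \<longlonglongrightarrow> 0 \<and> (\<forall>k. w k \<noteq> 0) \<and> (\<lambda>k. sgn (w k)) \<longlonglongrightarrow> sgn v"

text \<open>\<open>U\<close> is the domain on which the germ \<open>F\<close> is represented.\<close>

definition petal :: "complex set \<Rightarrow> (complex \<Rightarrow> complex) \<Rightarrow> complex \<Rightarrow> complex set \<Rightarrow> bool" where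
  "petal U F v P \<longleftrightarrow> open P \<and> P \<subseteq> U \<and> F ` P \<subseteq> P \<and>
     (\<forall>w. orbit_in U F w \<longrightarrow>
        (eventually (\<lambda>k. w k \<in> P) sequentially \<longleftrightarrow> converges_along w v))"

definition attracting_petal ::
    "complex set \<Rightarrow> (complex \<Rightarrow> complex) \<Rightarrow> nat \<Rightarrow> complex \<Rightarrow> complex \<Rightarrow> complex set \<Rightarrow> bool" where
  "attracting_petal U F N c v P \<longleftrightarrow> attracting_direction N c v \<and> petal U F v P"

definition repelling_petal ::
    "complex set \<Rightarrow> (complex \<Rightarrow> complex) \<Rightarrow> nat \<Rightarrow> complex \<Rightarrow> complex \<Rightarrow> complex set \<Rightarrow> bool" where
  "repelling_petal U F N c v P \<longleftrightarrow>
     repelling_direction N c v \<and> petal (F ` U) (inv_into U F) v P"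

definition cyclic_neighbours :: "nat \<Rightarrow> nat \<Rightarrow> nat \<Rightarrow> bool" where
  "cyclic_neighbours m i j \<longleftrightarrow> j = (i + 1) mod m \<or> i = (j + 1) mod m"

text \<open>Petals inside the neighbourhood \<open>V\<close>. The directions \<open>v\<^sub>0 e\<^sup>i\<^sup>\<pi>\<^sup>j\<^sup>/\<^sup>N\<close>, \<open>j < 2N\<close>, of the
  petals are the attracting (\<open>j\<close> even) and repelling (\<open>j\<close> odd) directions in their cyclic
  order around \<open>0\<close>.\<close>

definition petals_in ::
    "complex set \<Rightarrow> (complex \<Rightarrow> complex) \<Rightarrow> nat \<Rightarrow> complex \<Rightarrow> complex set \<Rightarrow> (nat \<Rightarrow> complex set) \<Rightarrow> bool" where
  "petals_in U F N c V P \<longleftrightarrow>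
     (\<exists>v0. \<forall>j<2 * N.
        (if even j then attracting_petal U F N c (v0 * cis (pi * real j / real N)) (P j)
         else repelling_petal U F N c (v0 * cis (pi * real j / real N)) (P j))) \<and>
     (\<forall>j<2 * N. P j \<subseteq> V \<and> simply_connected (P j)) \<and>
     open (insert 0 (\<Union>j<2 * N. P j)) \<and>
     (N > 1 \<longrightarrow> (\<forall>i<2 * N. \<forall>j<2 * N. i \<noteq> j \<longrightarrow>
        (if cyclic_neighbours (2 * N) i j
         then P i \<inter> P j \<noteq> {} \<and> simply_connected (P i \<inter> P j)
         else P i \<inter> P j = {})))"

text \<open>Being a petal depends only on the tails of orbits, hence the choice of the
  domain \<open>U\<close> on which the germ is univalent is immaterial.\<close>

definition leau_fatou_flower :: "(complex \<Rightarrow> complex) \<Rightarrow> nat \<Rightarrow> bool" where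
  "leau_fatou_flower f N \<longleftrightarrow>
     f analytic_on {0} \<and> f 0 = 0 \<and>
     (\<forall>m>0. \<not> eventually (\<lambda>z. (f ^^ m) z = z) (nhds 0)) \<and>
     (\<exists>q c. primitive_root q (deriv f 0) \<and> parabolic_expansion (f ^^ q) N c \<and>
        (\<exists>U. open U \<and> 0 \<in> U \<and> (f ^^ q) holomorphic_on U \<and> inj_on (f ^^ q) U \<and>
           (\<forall>V. open V \<and> 0 \<in> V \<longrightarrow> (\<exists>P. petals_in U (f ^^ q) N c V P))))"

end

theory Submission
  imports Defs
begin

text \<open>Write \<open>X(z) = (n z\<^sub>1 + z\<^sub>2\<^sup>n, z\<^sub>2)\<close>. Since \<open>\<omega>\<^sub>n(v) = det (X, v)\<close>, the leaves are the curves in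
  which the sphere meets the complex orbits of the holomorphic vector field \<open>X\<close>. The flow of \<open>X\<close> in
  complex time \<open>\<tau>\<close> is elementary,
  \<open>(z\<^sub>1, z\<^sub>2) \<mapsto> (e\<^sup>n\<^sup>\<tau> (z\<^sub>1 + z\<^sub>2\<^sup>n \<tau>), e\<^sup>\<tau> z\<^sub>2)\<close>,
  and so is the holonomy that it induces. On the complex transversal \<open>z\<^sub>1 = e\<^sup>i\<^sup>\<theta>\<close>, with coordinate
  \<open>\<zeta> = z\<^sub>2\<close>, coming back after time \<open>T\<close> means \<open>e\<^sup>n\<^sup>T (e\<^sup>i\<^sup>\<theta> + \<zeta>\<^sup>n T) = e\<^sup>i\<^sup>\<theta>\<close>. Going once round the Hopf circle
  selects the solution \<open>T\<close> near \<open>2\<pi>i/n\<close>, a holomorphic function of \<open>\<zeta>\<^sup>n\<close>, and gives the germ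
  \<open>f(\<zeta>) = \<zeta> e\<^sup>T = \<lambda> \<zeta> (1 + b \<zeta>\<^sup>n + \<dots>)\<close> with \<open>\<lambda> = e\<^sup>2\<^sup>\<pi>\<^sup>i\<^sup>/\<^sup>n\<close> and \<open>b = - (2\<pi>i/n\<^sup>2) e\<^sup>-\<^sup>i\<^sup>\<theta> \<noteq> 0\<close>
  (\<open>model_germ\<close>). Hence \<open>\<lambda>\<close> is a primitive \<open>n\<close>-th root of unity and the \<open>n\<close>-th iterate is
  \<open>\<zeta> + n b \<zeta>\<^sup>n\<^sup>+\<^sup>1 + \<dots>\<close>. A germ \<open>z + c z\<^sup>N\<^sup>+\<^sup>1 + \<dots>\<close> with \<open>c \<noteq> 0\<close> has a flower with \<open>N\<close> attracting petals
  (\<open>leau_fatou_flowerI\<close>): in the coordinate \<open>w = - 1 / (N c z\<^sup>N)\<close> it is close to \<open>w \<mapsto> w + 1\<close> near infinity,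
  so that sectors around the positive and the negative real axis serve as petals.

  Three points connect this computation with the return map of the real foliation. The first
  return has to exist and to be unique among all parametrised leaf curves; both follow from
  straightening the leaf through a point \<open>s\<close> of the disc by \<open>log_polar\<close>, which differs from complex time
  by a map with small Lipschitz constant when \<open>s\<close> is small (\<open>eventually_tame\<close>,
  \<open>first_return_near_centre\<close>). The disc is not the complex transversal, but sliding along the flow for a
  small complex time identifies the two and yields one particular chart of the disc
  (\<open>standard_chart\<close>), in which the return map is \<open>f\<close> (\<open>return_map_conjugate_to_model\<close>). Finally, two
  charts of the disc differ by a biholomorphic germ, because both have differentials proportional
  to \<open>\<omega>\<^sub>n\<close> (\<open>chart_transition\<close>), and the order of tangency and the multiplier are invariant under such
  a change of coordinate (\<open>conjugate_of_rotation_flower\<close>).\<close>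

section \<open>Germs tangent to the identity\<close>

lemma eventually_at_0_nonzero: "\<forall>\<^sub>F z in at (0::complex). z \<noteq> 0"
  by (simp add: eventually_at_filter)

text \<open>The hypothesis says \<open>F(z) = z + c z\<^sup>N\<^sup>+\<^sup>1 + o(z\<^sup>N\<^sup>+\<^sup>1)\<close>. This limit form of a parabolic
  expansion passes to iterates, inverses and conjugates by computing a limit, instead of manipulating
  power series.\<close>

lemma tangent_to_identity:
  fixes F :: "complex \<Rightarrow> complex"
  assumes lim: "(\<lambda>z. (F z - z) / z ^ (N + 1)) \<midarrow>0\<rightarrow> c" and N: "N > 0"
  shows "(\<lambda>z. F z / z) \<midarrow>0\<rightarrow> 1" and "filterlim F (at 0) (at 0)"
proof -
  have "(\<lambda>z. 1 + z ^ N * ((F z - z) / z ^ (N + 1))) \<midarrow>0\<rightarrow> 1 + 0 ^ N * c"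
    by (intro tendsto_intros lim)
  then have "(\<lambda>z. 1 + z ^ N * ((F z - z) / z ^ (N + 1))) \<midarrow>0\<rightarrow> 1"
    using N by (simp add: power_0_left)
  then show u: "(\<lambda>z. F z / z) \<midarrow>0\<rightarrow> 1"
    by (rule Lim_transform_eventually)
       (intro eventually_mono[OF eventually_at_0_nonzero], simp add: field_simps)
  have "(\<lambda>z. z * (F z / z)) \<midarrow>0\<rightarrow> 0 * 1" by (intro tendsto_intros u)
  then have "(\<lambda>z. z * (F z / z)) \<midarrow>0\<rightarrow> 0" by simp
  then have "F \<midarrow>0\<rightarrow> 0"
    by (rule Lim_transform_eventually) (intro eventually_mono[OF eventually_at_0_nonzero], simp)
  moreover have "\<forall>\<^sub>F z in at 0. F z \<noteq> 0"
    using tendsto_imp_eventually_ne[OF u zero_neq_one[symmetric]] by eventually_elim auto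
  ultimately show "filterlim F (at 0) (at 0)" by (rule filterlim_atI)
qed

lemma funpow_analytic:
  fixes f :: "complex \<Rightarrow> complex"
  assumes "f analytic_on {0}" "f 0 = 0"
  shows "(f ^^ m) analytic_on {0} \<and> (f ^^ m) 0 = 0"
proof (induction m)
  case (Suc m)
  then have "(f \<circ> (f ^^ m)) analytic_on {0}"
    using assms by (intro analytic_on_compose) auto
  then show ?case using Suc assms by (simp add: o_def)
qed (auto intro!: analytic_intros simp: id_def)

text \<open>Each further application of \<open>F\<close> adds \<open>c z\<^sup>N\<^sup>+\<^sup>1\<close> up to higher order; in particular no iterate of a
  germ with \<open>c \<noteq> 0\<close> is the identity.\<close>

lemma iterate_tangent_to_identity:
  fixes F :: "complex \<Rightarrow> complex"
  assumes lim: "(\<lambda>z. (F z - z) / z ^ (N + 1)) \<midarrow>0\<rightarrow> c" and N: "N > 0"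
  shows "(\<lambda>z. ((F ^^ m) z - z) / z ^ (N + 1)) \<midarrow>0\<rightarrow> of_nat m * c"
proof (induction m)
  case (Suc m)
  define G where "G = F ^^ m"
  have IH: "(\<lambda>z. (G z - z) / z ^ (N + 1)) \<midarrow>0\<rightarrow> of_nat m * c"
    using Suc by (simp add: G_def)
  have G1: "(\<lambda>z. G z / z) \<midarrow>0\<rightarrow> 1" and Gat: "filterlim G (at 0) (at 0)"
    using tangent_to_identity[OF IH N] .
  have G0: "\<forall>\<^sub>F z in at 0. G z \<noteq> 0"
    using tendsto_imp_eventually_ne[OF G1 zero_neq_one[symmetric]] by eventually_elim auto
  from filterlim_compose[OF lim Gat]
  have "(\<lambda>z. (F (G z) - G z) / G z ^ (N + 1) * (G z / z) ^ (N + 1) + (G z - z) / z ^ (N + 1)) \<midarrow>0\<rightarrow> c * 1 ^ (N + 1) + of_nat m * c"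
    by (intro tendsto_intros IH G1)
  moreover have "\<forall>\<^sub>F z in at 0. (F (G z) - G z) / G z ^ (N + 1) * (G z / z) ^ (N + 1) + (G z - z) / z ^ (N + 1)
      = ((F ^^ Suc m) z - z) / z ^ (N + 1)"
    using eventually_at_0_nonzero G0
  proof eventually_elim
    case (elim z)
    have "(F (G z) - G z) / G z ^ (N + 1) * (G z / z) ^ (N + 1) = (F (G z) - G z) / z ^ (N + 1)"
      using elim by (simp add: power_divide)
    then show ?case by (simp add: G_def diff_divide_distrib)
  qed
  ultimately have "(\<lambda>z. ((F ^^ Suc m) z - z) / z ^ (N + 1)) \<midarrow>0\<rightarrow> c * 1 ^ (N + 1) + of_nat m * c"
    using Lim_transform_eventually by fastforce
  then show ?case by (simp add: algebra_simps)
qed simp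

text \<open>With \<open>z = F(x)\<close>, the quotient for the inverse is \<open>- (F(x) - x) / x\<^sup>N\<^sup>+\<^sup>1\<close> times \<open>(x / F(x))\<^sup>N\<^sup>+\<^sup>1\<close>, and the
  last factor tends to 1.\<close>

lemma inverse_germ_limit:
  fixes F :: "complex \<Rightarrow> complex"
  assumes lim: "(\<lambda>z. (F z - z) / z ^ (N + 1)) \<midarrow>0\<rightarrow> c" and N: "N > 0"
    and U: "open U" "0 \<in> U" "F holomorphic_on U" "inj_on F U" and F0: "F 0 = 0"
  shows "(\<lambda>z. (inv_into U F z - z) / z ^ (N + 1)) \<midarrow>0\<rightarrow> - c"
    and "open (F ` U)" "0 \<in> F ` U" "inv_into U F 0 = 0"
proof -
  define G where "G = inv_into U F"
  show op: "open (F ` U)" using open_mapping_thm3 U by blast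
  show im: "0 \<in> F ` U" using U F0 by force
  have GF: "G (F z) = z" if "z \<in> U" for z using that U by (simp add: G_def)
  show G0: "inv_into U F 0 = 0" using GF[OF U(2)] F0 by (simp add: G_def)
  have contG: "continuous_on (F ` U) G"
    using continuous_on_inverse_open[OF U(1) holomorphic_on_imp_continuous_on[OF U(3)], of G] GF by auto
  have "isCont G 0" using contG op im continuous_on_eq_continuous_at by blast
  then have "G \<midarrow>0\<rightarrow> 0" using G0 by (simp add: isCont_def G_def)
  moreover have evU: "\<forall>\<^sub>F z in at 0. z \<in> F ` U - {0}"
    using eventually_at_in_open[OF op im] .
  then have "\<forall>\<^sub>F z in at 0. G z \<noteq> 0"
    by eventually_elim (use GF F0 in auto)
  ultimately have Gat: "filterlim G (at 0) (at 0)" by (rule filterlim_atI)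
  have F1: "(\<lambda>x. x / F x) \<midarrow>0\<rightarrow> 1"
    using tendsto_inverse[OF tangent_to_identity(1)[OF lim N]] by simp
  have "(\<lambda>x. - ((F x - x) / x ^ (N + 1)) * (x / F x) ^ (N + 1)) \<midarrow>0\<rightarrow> - c * 1 ^ (N + 1)"
    by (intro tendsto_mult tendsto_minus tendsto_power lim F1)
  then have "(\<lambda>x. - ((F x - x) / x ^ (N + 1)) * (x / F x) ^ (N + 1)) \<midarrow>0\<rightarrow> - c"
    by simp
  from filterlim_compose[OF this Gat]
  show "(\<lambda>z. (inv_into U F z - z) / z ^ (N + 1)) \<midarrow>0\<rightarrow> - c"
  proof (rule Lim_transform_eventually)
    show "\<forall>\<^sub>F z in at 0. - ((F (G z) - G z) / G z ^ (N + 1)) * (G z / F (G z)) ^ (N + 1)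
       = (inv_into U F z - z) / z ^ (N + 1)"
      using evU
    proof eventually_elim
      case (elim z)
      have z: "F (G z) = z" using elim by (simp add: G_def f_inv_into_f)
      have "z \<noteq> 0" "G z \<noteq> 0" using elim z F0 by auto
      then show ?case unfolding z G_def[symmetric]
        by (simp add: power_divide field_simps)
    qed
  qed
qed

text \<open>The quotient \<open>(F(z) - z) / z\<^sup>N\<^sup>+\<^sup>1\<close> has a removable singularity at 0; its power series, multiplied by
  \<open>z\<^sup>N\<^sup>+\<^sup>1\<close>, is the tail of the expansion of \<open>F\<close>.\<close>

lemma parabolic_expansionI:
  fixes F :: "complex \<Rightarrow> complex"
  assumes lim: "(\<lambda>z. (F z - z) / z ^ (N + 1)) \<midarrow>0\<rightarrow> c" and N: "N > 0" and c: "c \<noteq> 0"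
    and F: "F analytic_on {0}" "F 0 = 0"
  shows "parabolic_expansion F N c"
proof -
  obtain A where A: "open A" "0 \<in> A" "F holomorphic_on A"
    using F(1) unfolding analytic_at by auto
  define H where "H = (\<lambda>z. if z = 0 then c else (F z - z) / z ^ (N + 1))"
  have "H holomorphic_on A"
    unfolding H_def by (rule removable_singularity[OF _ A(1) lim]) (auto intro!: holomorphic_intros holomorphic_on_subset[OF A(3)])
  then have H: "H has_fps_expansion fps_expansion H 0" using A by blast
  define K where "K = fps_expansion H 0"
  have K0: "fps_nth K 0 = c" using has_fps_expansion_imp_0_eq_fps_nth_0[OF H] by (simp add: K_def H_def)
  have "(\<lambda>z. z + z ^ (N + 1) * H z) has_fps_expansion (fps_X + fps_X ^ (N + 1) * K)"
    using H unfolding K_def by (intro fps_expansion_intros)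
  moreover have "z + z ^ (N + 1) * H z = F z" for z
    by (cases "z = 0") (auto simp: H_def F(2))
  ultimately have hF: "F has_fps_expansion (fps_X + fps_X ^ (N + 1) * K)" by simp
  have "K = fps_const c + fps_X * fps_shift 1 K"
    using K0 fps_shift_times_fps_X'[of 1] by (intro fps_ext) (auto simp: fps_X_mult_nth) 
  then have "fps_X + fps_X ^ (N + 1) * K = fps_X + fps_X ^ (N + 1) * (fps_const c + fps_X * fps_shift 1 K)"
    by simp
  then have e: "fps_X + fps_X ^ (N + 1) * K = fps_X + fps_const c * fps_X ^ (N + 1) + fps_X ^ (N + 2) * fps_shift 1 K"
    by (simp add: algebra_simps)
  have "F has_fps_expansion (fps_X + fps_const c * fps_X ^ (N + 1) + fps_X ^ (N + 2) * fps_shift 1 K)"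
    using hF unfolding e .
  then show ?thesis unfolding parabolic_expansion_def using N c by blast
qed

text \<open>A Cesaro argument. It is what turns the convergence of orbits to 0 into convergence along a
  direction.\<close>

lemma increments_tendsto_imp_average_tendsto:
  fixes w :: "nat \<Rightarrow> complex"
  assumes "(\<lambda>k. w (Suc k) - w k) \<longlonglongrightarrow> 1"
  shows "(\<lambda>k. w k / of_nat k) \<longlonglongrightarrow> 1"
proof (rule LIMSEQ_I)
  fix e :: real assume e: "e > 0"
  obtain K where K: "\<And>k. k \<ge> K \<Longrightarrow> norm (w (Suc k) - w k - 1) < e / 2"
    using LIMSEQ_D[OF assms, of "e/2"] e by auto
  have drift: "norm (w (K + j) - w K - of_nat j) \<le> e / 2 * of_nat j" for j
  proof (induction j)
    case (Suc j)
    have "w (K + Suc j) - w K - of_nat (Suc j) = (w (K + j) - w K - of_nat j) + (w (Suc (K + j)) - w (K + j) - 1)"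
      by simp
    then have "norm (w (K + Suc j) - w K - of_nat (Suc j)) \<le> e / 2 * of_nat j + e / 2"
      using Suc K[of "K + j"] norm_triangle_ineq by (smt (verit) le_add1)
    then show ?case by (simp add: algebra_simps add_divide_distrib)
  qed simp
  obtain M :: nat where M: "M > (norm (w K - of_nat K)) * 2 / e" using reals_Archimedean2 by blast
  show "\<exists>no. \<forall>k\<ge>no. norm (w k / of_nat k - 1) < e"
  proof (intro exI[of _ "max (Suc K) M"] allI impI)
    fix k assume k: "max (Suc K) M \<le> k"
    then obtain j where j: "k = K + j" using le_Suc_ex[of K k] by auto
    have kp: "real k > 0" using k by auto
    have "w k - of_nat k = (w (K + j) - w K - of_nat j) + (w K - of_nat K)"
      by (simp add: j)
    then have "norm (w k - of_nat k) \<le> e / 2 * of_nat j + norm (w K - of_nat K)"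
      using drift[of j] norm_triangle_ineq by (smt (verit))
    also have "\<dots> < e / 2 * of_nat k + e / 2 * of_nat k"
    proof -
      have "norm (w K - of_nat K) < e / 2 * M" using M e by (simp add: field_simps)
      also have "\<dots> \<le> e / 2 * k" using k e by simp
      finally have "norm (w K - of_nat K) < e / 2 * k" .
      moreover have "e / 2 * j \<le> e / 2 * k" using j e by (intro mult_left_mono) auto
      ultimately show ?thesis by linarith
    qed
    finally have "norm (w k - of_nat k) < e * k" by simp
    moreover have "norm (w k / of_nat k - 1) = norm (w k - of_nat k) / k"
    proof -
      have "w k / of_nat k - 1 = (w k - of_nat k) / of_nat k" using kp by (simp add: diff_divide_distrib)
      then show ?thesis by (simp add: norm_divide)
    qed
    ultimately show "norm (w k / of_nat k - 1) < e" by (simp only: pos_divide_less_eq[OF kp])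
  qed
qed

section \<open>Sectors and petals\<close>

text \<open>In the coordinate \<open>w = (v / z)\<^sup>N\<close> a petal around the direction \<open>v\<close> is the complement of a closed sector
  of opening \<open>\<pi>/2\<close> about the negative real axis. The sector is bounded by the lines \<open>Re w + \<bar>Im w\<bar> = R\<close>
  because a step close to \<open>w \<mapsto> w + 1\<close> increases \<open>Re w + \<bar>Im w\<bar>\<close>, and because the regions for \<open>w\<close> and \<open>- w\<close>
  then overlap in two convex sets and together exhaust a neighbourhood of infinity.\<close>

definition far_right :: "real \<Rightarrow> complex set" where
  "far_right R = {w. Re w + \<bar>Im w\<bar> > R}"

text \<open>The branch of \<open>z = v w\<^sup>-\<^sup>1\<^sup>/\<^sup>N\<close>, inverse to \<open>w = (v / z)\<^sup>N\<close>, that sends positive reals to the ray through \<open>v\<close>.\<close>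

abbreviation petal_map :: "nat \<Rightarrow> complex \<Rightarrow> complex \<Rightarrow> complex" where
  "petal_map N v \<equiv> \<lambda>w. v * exp (- Ln w / of_nat N)"

definition petal_set :: "nat \<Rightarrow> complex \<Rightarrow> real \<Rightarrow> complex set" where
  "petal_set N v R = petal_map N v ` far_right R"

lemma open_far_right: "open (far_right R)"
  unfolding far_right_def by (intro open_Collect_less continuous_intros)

lemma far_right_not_nonpos_Reals:
  assumes "w \<in> far_right R" "R \<ge> 0"
  shows "w \<notin> \<real>\<^sub>\<le>\<^sub>0" "w \<noteq> 0"
  using assms by (auto simp: far_right_def complex_nonpos_Reals_iff)

lemma norm_far_right: "w \<in> far_right R \<Longrightarrow> norm w > R / 2"
  using abs_Re_le_cmod[of w] abs_Im_le_cmod[of w] by (auto simp: far_right_def)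

lemma far_rightI:
  assumes "Re w \<ge> 0" "norm w > R"
  shows "w \<in> far_right R"
  using assms cmod_le[of w] by (auto simp: far_right_def)

text \<open>The argument \<open>x\<close> satisfies \<open>cos x + \<bar>sin x\<bar> > 0\<close>. The bound \<open>3\<pi>/4\<close> leaves a margin of \<open>\<pi>/4\<close> before the cut of
  the logarithm, and it makes petals whose directions are two steps apart disjoint.\<close>

lemma Im_Ln_far_right:
  assumes "w \<in> far_right R" "R \<ge> 0"
  shows "\<bar>Im (Ln w)\<bar> < 3 * pi / 4"
proof (rule ccontr)
  assume *: "\<not> ?thesis"
  define x where "x = \<bar>Im (Ln w)\<bar>"
  have w0: "w \<noteq> 0" using far_right_not_nonpos_Reals assms by blast
  have x: "3 * pi / 4 \<le> x" "x \<le> pi"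
    using * mpi_less_Im_Ln[OF w0] Im_Ln_le_pi[OF w0] by (auto simp: x_def)
  have "w = exp (Ln w)" using w0 by simp
  then have e: "Re w = norm w * cos x" "Im w = norm w * sin (Im (Ln w))"
    using w0 by (auto simp: Re_exp Im_exp x_def) (metis Re_exp exp_Ln norm_exp_eq_Re, metis Im_exp exp_Ln norm_exp_eq_Re)
  have "sin x \<ge> 0" using x sin_ge_zero[of x] by simp
  then have s: "\<bar>sin (Im (Ln w))\<bar> = sin x"
    by (cases "Im (Ln w) \<ge> 0") (auto simp: x_def)
  \<comment> \<open>\<open>cos x + sin x\<close> is \<open>\<surd>2\<close> times \<open>sin (x + \<pi>/4)\<close>.\<close>
  have "sin (x + pi/4) \<le> 0"
    using x pi_gt_zero by (intro sin_le_zero; linarith)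
  then have "sqrt 2 / 2 * (cos x + sin x) \<le> 0"
    by (simp add: sin_add sin_45 cos_45 algebra_simps)
  then have "cos x + sin x \<le> 0"
    by (simp add: mult_le_0_iff)
  moreover have "Re w + \<bar>Im w\<bar> = norm w * (cos x + sin x)"
    unfolding e by (simp add: abs_mult s algebra_simps)
  ultimately have "Re w + \<bar>Im w\<bar> \<le> 0"
    by (simp add: mult_nonneg_nonpos)
  then show False using assms by (auto simp: far_right_def)
qed

text \<open>The complement is a convex cone with apex \<open>R\<close> that opens to the left, so a segment from a point of
  the real axis beyond \<open>R\<close> cannot leave the region and come back.\<close>

lemma starlike_far_right:
  assumes "R \<ge> 0" shows "starlike (far_right R)"
  unfolding starlike_def
proof (intro bexI ballI)
  show "of_real (R + 1) \<in> far_right R" by (simp add: far_right_def)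
  fix p assume p: "p \<in> far_right R"
  show "closed_segment (complex_of_real (R + 1)) p \<subseteq> far_right R"
  proof
    fix x assume "x \<in> closed_segment (complex_of_real (R + 1)) p"
    then obtain u where u: "0 \<le> u" "u \<le> 1" and x: "x = (1 - u) *\<^sub>R complex_of_real (R + 1) + u *\<^sub>R p"
      by (auto simp: in_segment)
    have "Re x + \<bar>Im x\<bar> = (1 - u) * (R + 1) + u * (Re p + \<bar>Im p\<bar>)"
      using u by (simp add: x abs_mult algebra_simps)
    also have "\<dots> > R"
    proof (cases "u = 0")
      case False
      have "u * (Re p + \<bar>Im p\<bar>) > u * R" using p False u by (simp add: far_right_def)
      moreover have "(1 - u) * (R + 1) \<ge> (1 - u) * R" using u by (intro mult_left_mono) auto
      ultimately show ?thesis by (simp add: algebra_simps)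
    qed simp
    finally show "x \<in> far_right R" by (simp add: far_right_def)
  qed
qed

context
  fixes N :: nat and v :: complex
  assumes N: "N > 0" and v: "v \<noteq> 0"
begin

lemma petal_coordinate:
  assumes "w \<noteq> 0"
  shows "(v / (petal_map N v w)) ^ N = w"
proof -
  have "v / (petal_map N v w) = exp (Ln w / of_nat N)"
    using v by (simp add: exp_minus field_simps)
  then have "(v / (petal_map N v w)) ^ N = exp (of_nat N * (Ln w / of_nat N))"
    by (simp only: exp_of_nat_mult)
  then show ?thesis using N assms by simp
qed

lemma petal_setI:
  assumes "z = v * exp (- l / of_nat N)" "\<bar>Im l\<bar> < pi" "exp l \<in> far_right R"
  shows "z \<in> petal_set N v R"
proof -
  have "Ln (exp l) = l" using assms by (intro Ln_exp) auto
  then show ?thesis using assms unfolding petal_set_def by (auto intro!: image_eqI[of _ _ "exp l"])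
qed

text \<open>Logarithmic form of membership. Adding imaginary numbers to \<open>l\<close> moves between branches, which is how
  different petals are compared below.\<close>

lemma petal_setE:
  assumes "z \<in> petal_set N v R" "R \<ge> 0"
  obtains l where "z = v * exp (- l / of_nat N)" "\<bar>Im l\<bar> < 3 * pi / 4" "exp l \<in> far_right R"
    "l = Ln (exp l)"
proof -
  obtain w where w: "w \<in> far_right R" "z = petal_map N v w"
    using assms by (auto simp: petal_set_def)
  show ?thesis
    using that[of "Ln w"] w Im_Ln_far_right[OF w(1) assms(2)] far_right_not_nonpos_Reals[OF w(1) assms(2)]
    by auto
qed

lemma inj_on_petal_map: "inj_on (petal_map N v) (- {0})"
  by (rule inj_on_inverseI[of _ "\<lambda>z. (v / z) ^ N"]) (rule petal_coordinate, simp)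

lemma holomorphic_petal_map: "R \<ge> 0 \<Longrightarrow> (petal_map N v) holomorphic_on far_right R"
  using far_right_not_nonpos_Reals N by (intro holomorphic_intros) auto

lemma open_petal_set: "R \<ge> 0 \<Longrightarrow> open (petal_set N v R)"
  unfolding petal_set_def
  by (rule open_mapping_thm3[OF holomorphic_petal_map open_far_right inj_on_subset[OF inj_on_petal_map]])
     (use far_right_not_nonpos_Reals(2) in auto)

lemma simply_connected_petal_image:
  assumes "simply_connected S" "S \<subseteq> far_right R" "R \<ge> 0"
  shows "simply_connected (petal_map N v ` S)"
proof (rule simply_connected_retraction_gen)
  show "continuous_on S (petal_map N v)"
    using holomorphic_on_imp_continuous_on[OF holomorphic_petal_map] assms continuous_on_subset by blast
  have nz: "w \<in> S \<Longrightarrow> w \<noteq> 0" for w using assms far_right_not_nonpos_Reals by blast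
  show "continuous_on (petal_map N v ` S) (\<lambda>z. (v / z) ^ N)"
    using v by (intro continuous_intros) auto
  show "(\<lambda>z. (v / z) ^ N) \<in> petal_map N v ` S \<rightarrow> S"
    by (intro Pi_I, elim imageE, hypsubst, subst petal_coordinate) (use nz in auto)
  show "petal_map N v ((v / y) ^ N) = y"
    if "y \<in> petal_map N v ` S" for y
    using that by (elim imageE, hypsubst, subst petal_coordinate) (use nz in auto)
qed (use assms in auto)

lemma norm_petal_set_less:
  assumes "z \<in> petal_set N v R" "R > 0" "2 * (norm v / d) ^ N < R" "d > 0"
  shows "norm z < d"
proof -
  obtain w where w: "w \<in> far_right R" "z = petal_map N v w"
    using assms by (auto simp: petal_set_def)
  have w0: "w \<noteq> 0" using far_right_not_nonpos_Reals[OF w(1)] assms by auto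
  have "(norm v / norm z) ^ N = norm w"
    using petal_coordinate[OF w0] unfolding w(2) by (metis norm_divide norm_power)
  also have "\<dots> > (norm v / d) ^ N"
    using norm_far_right[OF w(1)] assms by auto
  finally have "norm v / d < norm v / norm z"
    by (rule power_less_imp_less_base) auto
  then show ?thesis
    using assms v w(2) by (auto simp: field_simps)
qed

end


section \<open>Dynamics in a petal\<close>

text \<open>With \<open>u = F(z) / z\<close>, the difference is \<open>(v / z)\<^sup>N (u\<^sup>-\<^sup>N - 1)\<close>. Here \<open>u\<^sup>-\<^sup>N - 1\<close> behaves like \<open>- N (u - 1)\<close>,
  that is, like \<open>- N c z\<^sup>N\<close>; the normalisation of \<open>v\<close> makes the product tend to 1.\<close>

lemma coordinate_shift_limit:
  fixes F :: "complex \<Rightarrow> complex"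
  assumes lim: "(\<lambda>z. (F z - z) / z ^ (N + 1)) \<midarrow>0\<rightarrow> c" and N: "N > 0"
    and v: "of_nat N * c * v ^ N = -1"
  shows "(\<lambda>z. (v / F z) ^ N - (v / z) ^ N) \<midarrow>0\<rightarrow> 1"
proof -
  have c: "c \<noteq> 0" using v by auto
  have q: "(\<lambda>z. (F z / z - 1) / z ^ N) \<midarrow>0\<rightarrow> c"
    by (rule Lim_transform_eventually[OF lim], rule eventually_mono[OF eventually_at_0_nonzero])
       (simp add: field_simps)
  note u = tangent_to_identity(1)[OF lim N]
  have "\<forall>\<^sub>F z in at 0. (F z / z - 1) / z ^ N \<noteq> 0"
    using tendsto_imp_eventually_ne[OF q c] .
  then have u1: "\<forall>\<^sub>F z in at 0. F z / z \<noteq> 1" by eventually_elim auto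
  have "((\<lambda>x::complex. inverse (x ^ N)) has_field_derivative - of_nat N) (at 1)"
    by (auto intro!: derivative_eq_intros)
  then have d: "((\<lambda>x::complex. (inverse (x ^ N) - 1) / (x - 1)) \<longlongrightarrow> - of_nat N) (at 1)"
    by (simp add: has_field_derivative_iff)
  have d': "(\<lambda>z. (inverse ((F z / z) ^ N) - 1) / (F z / z - 1)) \<midarrow>0\<rightarrow> - of_nat N"
    by (rule filterlim_compose[OF d]) (rule filterlim_atI[OF u u1])
  have "(\<lambda>z. v ^ N * ((inverse ((F z / z) ^ N) - 1) / (F z / z - 1)) * ((F z / z - 1) / z ^ N)) \<midarrow>0\<rightarrow> v ^ N * (- of_nat N) * c"
    by (intro tendsto_intros d' q)
  moreover have "v ^ N * (- of_nat N) * c = 1" using v by (simp add: algebra_simps)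
  moreover have "\<forall>\<^sub>F z in at 0. v ^ N * ((inverse ((F z / z) ^ N) - 1) / (F z / z - 1)) * ((F z / z - 1) / z ^ N)
      = (v / F z) ^ N - (v / z) ^ N"
    using eventually_at_0_nonzero u1 tendsto_imp_eventually_ne[OF u zero_neq_one[symmetric]]
  proof eventually_elim
    case (elim z)
    define y where "y = F z / z"
    have F: "F z = y * z" and y: "y \<noteq> 1" "y \<noteq> 0" using elim by (auto simp: y_def)
    show ?case using elim(1) y unfolding F by (simp add: field_simps)
  qed
  ultimately show "(\<lambda>z. (v / F z) ^ N - (v / z) ^ N) \<midarrow>0\<rightarrow> 1"
    using Lim_transform_eventually by fastforce
qed

text \<open>The translation by roughly 1 stays in the region, since a perturbation below \<open>1/4\<close> costs at most \<open>1/2\<close>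
  of \<open>Re w + \<bar>Im w\<bar>\<close>. The condition on the argument of \<open>F(z) / z\<close> guarantees that \<open>F(z)\<close> lies on the same branch
  of the \<open>N\<close>-th root: the argument of \<open>w\<close> is below \<open>3\<pi>/4\<close> and changes by less than \<open>\<pi>/4\<close>.\<close>

lemma petal_step:
  fixes F :: "complex \<Rightarrow> complex"
  assumes N: "N > 0" and v: "v \<noteq> 0" and R: "R \<ge> 0" and z: "z \<in> petal_set N v R"
    and F: "F z \<noteq> 0" "norm ((v / F z) ^ N - (v / z) ^ N - 1) < 1/4" "of_nat N * \<bar>Im (Ln (F z / z))\<bar> < pi / 4"
  shows "F z \<in> petal_set N v R"
    "Re ((v / F z) ^ N) + \<bar>Im ((v / F z) ^ N)\<bar> \<ge> Re ((v / z) ^ N) + \<bar>Im ((v / z) ^ N)\<bar> + 1/2"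
proof -
  obtain l where l: "z = v * exp (- l / of_nat N)" "\<bar>Im l\<bar> < 3 * pi / 4" "exp l \<in> far_right R" "l = Ln (exp l)"
    using petal_setE[OF N v z R] by metis
  have z0: "z \<noteq> 0" using l v by simp
  have lz: "(v / z) ^ N = exp l"
    using petal_coordinate[OF N v, of "exp l"] l(1,4) by simp
  define l' where "l' = l - of_nat N * Ln (F z / z)"
  have e: "F z = v * exp (- l' / of_nat N)"
  proof -
    have "- l' / of_nat N = - l / of_nat N + Ln (F z / z)" using N by (simp add: l'_def field_simps)
    then have "v * exp (- l' / of_nat N) = z * (F z / z)"
      using F z0 by (simp only: exp_add l(1)[symmetric] mult.assoc[symmetric] exp_Ln) simp
    then show ?thesis using z0 by simp
  qed
  have im: "\<bar>Im l'\<bar> < pi"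
  proof -
    have "\<bar>Im l'\<bar> \<le> \<bar>Im l\<bar> + of_nat N * \<bar>Im (Ln (F z / z))\<bar>"
      by (simp add: l'_def) (metis abs_mult abs_of_nat abs_triangle_ineq4)
    then show ?thesis using l F by linarith
  qed
  have "Ln (exp l') = l'" using im by (intro Ln_exp) auto
  then have lF: "(v / F z) ^ N = exp l'"
    using petal_coordinate[OF N v, of "exp l'"] unfolding e by simp
  define d where "d = exp l' - exp l - 1"
  have "norm d < 1/4" using F(2) unfolding lF lz d_def .
  then have dd: "\<bar>Re d\<bar> < 1/4" "\<bar>Im d\<bar> < 1/4"
    using abs_Re_le_cmod[of d] abs_Im_le_cmod[of d] by linarith+
  have el: "exp l' = exp l + 1 + d" by (simp add: d_def)
  have r: "Re (exp l') = Re (exp l) + 1 + Re d" "Im (exp l') = Im (exp l) + Im d" unfolding el by simp_all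
  show *: "Re ((v / F z) ^ N) + \<bar>Im ((v / F z) ^ N)\<bar> \<ge> Re ((v / z) ^ N) + \<bar>Im ((v / z) ^ N)\<bar> + 1/2"
    unfolding lF lz r using dd by linarith
  have "exp l' \<in> far_right R"
    using * l(3) unfolding lF lz far_right_def by simp
  then show "F z \<in> petal_set N v R"
    by (rule petal_setI[OF N v e im])
qed

text \<open>Along such a sequence the argument of \<open>w = (v / z)\<^sup>N\<close> tends to 0 and its modulus to infinity.\<close>

lemma converges_along_imp_eventually_petal:
  assumes N: "N > 0" and v: "v \<noteq> 0" and R: "R > 0" and w: "converges_along w v"
  shows "\<forall>\<^sub>F k in sequentially. w k \<in> petal_set N v R"
proof -
  define y where "y = (\<lambda>k. w k / v)"
  have w0: "w \<longlonglongrightarrow> 0" "\<And>k. w k \<noteq> 0" "(\<lambda>k. sgn (w k)) \<longlonglongrightarrow> sgn v"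
    using w by (auto simp: converges_along_def)
  have y0: "y k \<noteq> 0" for k using w0 v by (simp add: y_def)
  have sy: "sgn (y k) = sgn (w k) / sgn v" for k
    using v by (simp add: y_def sgn_eq norm_divide)
  have "(\<lambda>k. sgn (y k)) \<longlonglongrightarrow> sgn v / sgn v"
    unfolding sy by (intro tendsto_intros w0) (use v in \<open>simp add: sgn_zero_iff\<close>)
  then have "(\<lambda>k. sgn (y k)) \<longlonglongrightarrow> 1" using v by (simp add: sgn_zero_iff)
  then have "(\<lambda>k. Ln (sgn (y k))) \<longlonglongrightarrow> Ln 1"
    by (intro tendsto_Ln) simp_all
  then have "(\<lambda>k. of_nat N * Im (Ln (sgn (y k)))) \<longlonglongrightarrow> of_nat N * Im (Ln 1)"
    by (intro tendsto_mult_left tendsto_Im)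
  then have "\<forall>\<^sub>F k in sequentially. \<bar>of_nat N * Im (Ln (sgn (y k))) - 0\<bar> < pi / 2"
    by (auto dest!: tendstoD[of _ _ _ "pi / 2"] simp: dist_real_def)
  moreover have "y \<longlonglongrightarrow> 0"
    unfolding y_def using w0(1) v by (auto intro: tendsto_eq_intros)
  then have "(\<lambda>k. norm (y k) ^ N) \<longlonglongrightarrow> norm (0::complex) ^ N"
    by (intro tendsto_intros)
  then have "\<forall>\<^sub>F k in sequentially. norm (y k) ^ N < 1 / R"
    by (rule order_tendstoD(2)) (use N R in \<open>simp add: power_0_left\<close>)
  ultimately show ?thesis
  proof eventually_elim
    case (elim k)
    define l where "l = - of_nat N * Ln (y k)"
    have "Im (Ln (sgn (y k))) = Im (Ln (y k))"
    proof -
      have "Ln (sgn (y k)) = Ln (y k) - of_real (ln (norm (y k)))"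
        using Ln_divide_of_real[of "norm (y k)" "y k"] y0[of k] by (simp add: sgn_eq Ln_of_real)
      then show ?thesis by simp
    qed
    then have im: "\<bar>Im l\<bar> < pi / 2" using elim by (simp add: l_def abs_mult)
    have wl: "w k = v * exp (- l / of_nat N)"
      using N y0[of k] v by (simp add: l_def y_def)
    have "norm (exp l) = 1 / norm (y k) ^ N"
    proof -
      have "exp l = inverse (y k ^ N)"
        using y0[of k] by (simp add: l_def exp_minus exp_of_nat_mult)
      then show ?thesis by (simp add: norm_divide norm_inverse norm_power divide_inverse)
    qed
    moreover have "norm (y k) ^ N > 0" using y0[of k] by simp
    ultimately have "norm (exp l) > R"
      using elim R by (simp add: field_simps)
    moreover have "Re (exp l) \<ge> 0" using im by (simp add: Re_exp cos_ge_zero)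
    ultimately have "exp l \<in> far_right R" by (intro far_rightI)
    then show "w k \<in> petal_set N v R"
      using im pi_gt_zero by (intro petal_setI[OF N v wl]) auto
  qed
qed

text \<open>In the coordinate \<open>w\<close> an orbit in the petal goes to infinity, because \<open>Re w + \<bar>Im w\<bar>\<close> grows by \<open>1/2\<close> at each
  step. Hence its steps tend to 1, so \<open>w\<^sub>k / k\<close> tends to 1 and the argument of \<open>w\<^sub>k\<close> to 0.\<close>

lemma petal_orbit_converges:
  fixes F :: "complex \<Rightarrow> complex"
  assumes lim: "(\<lambda>z. (F z - z) / z ^ (N + 1)) \<midarrow>0\<rightarrow> c" and N: "N > 0"
    and v: "of_nat N * c * v ^ N = -1" and R: "R > 0"
    and step: "\<And>z. z \<in> petal_set N v R \<Longrightarrow> F z \<in> petal_set N v R \<and>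
       Re ((v / F z) ^ N) + \<bar>Im ((v / F z) ^ N)\<bar> \<ge> Re ((v / z) ^ N) + \<bar>Im ((v / z) ^ N)\<bar> + 1/2"
    and y: "\<And>k. y k \<in> petal_set N v R" "\<And>k. y (Suc k) = F (y k)"
  shows "y \<longlonglongrightarrow> 0" "(\<lambda>k. sgn (y k)) \<longlonglongrightarrow> sgn v"
proof -
  have v0: "v \<noteq> 0" using v N by (auto simp: power_0_left)
  define w where "w = (\<lambda>k. (v / y k) ^ N)"
  have yw: "y k = petal_map N v (w k)" and w: "w k \<in> far_right R" for k
  proof -
    obtain u where u: "u \<in> far_right R" "y k = petal_map N v u"
      using y(1)[of k] by (auto simp: petal_set_def)
    have "w k = u" unfolding w_def u(2)
      using far_right_not_nonpos_Reals[OF u(1)] R by (intro petal_coordinate[OF N v0]) auto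
    then show "y k = petal_map N v (w k)" "w k \<in> far_right R" using u by auto
  qed
  have w0: "w k \<noteq> 0" and wnn: "w k \<notin> \<real>\<^sub>\<le>\<^sub>0" for k
    using far_right_not_nonpos_Reals[OF w] R by auto
  have y0: "y k \<noteq> 0" for k using yw[of k] v0 by simp
  have grow: "Re (w k) + \<bar>Im (w k)\<bar> \<ge> real k / 2" for k
  proof (induction k)
    case 0 show ?case using w[of 0] R by (simp add: far_right_def)
  next
    case (Suc k)
    have "Re (w (Suc k)) + \<bar>Im (w (Suc k))\<bar> \<ge> Re (w k) + \<bar>Im (w k)\<bar> + 1/2"
      using step[OF y(1)[of k]] by (simp add: w_def y(2))
    then show ?case using Suc by simp
  qed
  \<comment> \<open>The linear growth of \<open>Re w + \<bar>Im w\<bar>\<close> is lost by at most a factor 2 in the modulus.\<close>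
  have wge: "norm (w k) \<ge> real k / 4" for k
    using grow[of k] abs_Re_le_cmod[of "w k"] abs_Im_le_cmod[of "w k"] by linarith
  have winf: "filterlim (\<lambda>k. norm (w k)) at_top sequentially"
  proof (rule filterlim_at_top_mono)
    show "filterlim (\<lambda>k. real k / 4) at_top sequentially"
      using filterlim_tendsto_pos_mult_at_top[OF tendsto_const[of "1/4"] _ filterlim_real_sequentially] by simp
  qed (use wge in auto)
  have ny: "norm (y k) = norm v * exp (- (ln (norm (w k)) / of_nat N))" for k
    by (subst yw) (simp add: norm_mult w0)
  have "(\<lambda>k. norm (y k)) \<longlonglongrightarrow> 0"
  proof -
    have "filterlim (\<lambda>k. ln (norm (w k)) / of_nat N) at_top sequentially"
      using filterlim_tendsto_pos_mult_at_top[OF tendsto_const[of "1 / real N"] _ filterlim_compose[OF ln_at_top winf]] N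
      by simp
    then have "filterlim (\<lambda>k. - (ln (norm (w k)) / of_nat N)) at_bot sequentially"
      by (simp add: filterlim_uminus_at_top)
    then have "(\<lambda>k. exp (- (ln (norm (w k)) / of_nat N))) \<longlonglongrightarrow> 0"
      using filterlim_compose[OF exp_at_bot] by blast
    then show ?thesis unfolding ny using tendsto_mult_right_zero by blast
  qed
  then show y_lim: "y \<longlonglongrightarrow> 0" by (rule tendsto_norm_zero_cancel)
  have "filterlim y (at 0) sequentially"
    using y_lim y0 by (intro filterlim_atI) auto
  then have "(\<lambda>k. (v / F (y k)) ^ N - (v / y k) ^ N) \<longlonglongrightarrow> 1"
    by (rule filterlim_compose[OF coordinate_shift_limit[OF lim N v]])
  then have "(\<lambda>k. w (Suc k) - w k) \<longlonglongrightarrow> 1" by (simp add: w_def y(2))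
  then have "(\<lambda>k. w k / of_nat k) \<longlonglongrightarrow> 1"
    by (rule increments_tendsto_imp_average_tendsto)
  then have "(\<lambda>k. Ln (w k / of_nat k)) \<longlonglongrightarrow> Ln 1" by (intro tendsto_Ln) auto
  then have "(\<lambda>k. Im (Ln (w k / of_nat k))) \<longlonglongrightarrow> Im (Ln 1)" by (rule tendsto_Im)
  moreover have "\<forall>\<^sub>F k in sequentially. Im (Ln (w k / of_nat k)) = Im (Ln (w k))"
    using eventually_gt_at_top[of 0]
  proof eventually_elim
    case (elim k)
    then show ?case using Ln_divide_of_real[of "real k" "w k"] w0 by simp
  qed
  ultimately have "(\<lambda>k. Im (Ln (w k))) \<longlonglongrightarrow> 0"
    using Lim_transform_eventually by fastforce
  then have "(\<lambda>k. sgn v * cis (- Im (Ln (w k)) / of_nat N)) \<longlonglongrightarrow> sgn v * cis (- 0 / of_nat N)"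
    using N by (intro tendsto_intros) auto
  moreover have "sgn v * cis (- Im (Ln (w k)) / of_nat N) = sgn (y k)" for k
  proof -
    have "sgn (exp (- Ln (w k) / of_nat N)) = cis (- Im (Ln (w k)) / of_nat N)"
      by (simp add: sgn_eq exp_eq_polar norm_mult)
    then show ?thesis using yw[of k] by (metis sgn_mult)
  qed
  ultimately show "(\<lambda>k. sgn (y k)) \<longlonglongrightarrow> sgn v" by simp
qed

text \<open>A large \<open>R\<close> confines the petal to a disc where the estimates of \<open>petal_step\<close> hold. Being a petal
  quantifies over all orbits of \<open>F\<close>, also those that start outside: an orbit that is eventually in
  the petal cannot have met 0 before, since 0 is fixed and not in the petal.\<close>

lemma eventually_petal:
  fixes F :: "complex \<Rightarrow> complex"
  assumes lim: "(\<lambda>z. (F z - z) / z ^ (N + 1)) \<midarrow>0\<rightarrow> c" and N: "N > 0"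
    and v: "of_nat N * c * v ^ N = -1" and U: "open U" "0 \<in> U" and F0: "F 0 = 0"
  shows "\<forall>\<^sub>F R in at_top. petal U F v (petal_set N v R)"
proof -
  have v0: "v \<noteq> 0" using v N by (auto simp: power_0_left)
  note u = tangent_to_identity(1)[OF lim N] coordinate_shift_limit[OF lim N v]
  have "\<forall>\<^sub>F z in at 0. norm ((v / F z) ^ N - (v / z) ^ N - 1) < 1/4"
    using tendstoD[OF u(2), of "1/4"] by (simp add: dist_norm)
  moreover have "(\<lambda>z. of_nat N * \<bar>Im (Ln (F z / z))\<bar>) \<midarrow>0\<rightarrow> of_nat N * \<bar>Im (Ln 1)\<bar>"
    using u(1) by (intro tendsto_intros) auto
  then have "\<forall>\<^sub>F z in at 0. of_nat N * \<bar>Im (Ln (F z / z))\<bar> < pi / 4"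
    by (rule order_tendstoD(2)) simp
  moreover have "\<forall>\<^sub>F z in at 0. F z / z \<noteq> 0"
    using tendsto_imp_eventually_ne[OF u(1) zero_neq_one[symmetric]] .
  moreover have "\<forall>\<^sub>F z in at 0. z \<in> U"
    using U by (simp add: eventually_at_in_open')
  ultimately have "\<forall>\<^sub>F z in at 0. F z \<noteq> 0 \<and> norm ((v / F z) ^ N - (v / z) ^ N - 1) < 1/4 \<and>
      of_nat N * \<bar>Im (Ln (F z / z))\<bar> < pi / 4 \<and> z \<in> U"
    by eventually_elim auto
  then obtain d where d: "d > 0" and D: "\<And>z. z \<noteq> 0 \<Longrightarrow> norm z < d \<Longrightarrow> F z \<noteq> 0 \<and>
      norm ((v / F z) ^ N - (v / z) ^ N - 1) < 1/4 \<and> of_nat N * \<bar>Im (Ln (F z / z))\<bar> < pi / 4 \<and> z \<in> U"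
    unfolding eventually_at by auto
  show ?thesis
    using eventually_gt_at_top[of 0] eventually_gt_at_top[of "2 * (norm v / d) ^ N"]
  proof eventually_elim
    case (elim R)
    have small: "z \<noteq> 0" "norm z < d" if "z \<in> petal_set N v R" for z
      using norm_petal_set_less[OF N v0 that elim d] that v0 by (auto simp: petal_set_def)
    have step: "F z \<in> petal_set N v R \<and>
       Re ((v / F z) ^ N) + \<bar>Im ((v / F z) ^ N)\<bar> \<ge> Re ((v / z) ^ N) + \<bar>Im ((v / z) ^ N)\<bar> + 1/2"
      if "z \<in> petal_set N v R" for z
      using petal_step[OF N v0 less_imp_le[OF elim(1)] that] D[OF small[OF that]] by blast
    have conv: "converges_along w v"
      if w: "orbit_in U F w" and ev: "\<forall>\<^sub>F k in sequentially. w k \<in> petal_set N v R" for w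
    proof -
      obtain K where K: "\<And>k. k \<ge> K \<Longrightarrow> w k \<in> petal_set N v R"
        using ev unfolding eventually_sequentially by blast
      have wF: "w (Suc k) = F (w k)" for k using w by (simp add: orbit_in_def)
      have "(\<lambda>k. w (k + K)) \<longlonglongrightarrow> 0" "(\<lambda>k. sgn (w (k + K))) \<longlonglongrightarrow> sgn v"
        using petal_orbit_converges[OF lim N v elim(1) step, of "\<lambda>k. w (k + K)"] K wF by auto
      moreover have "w k \<noteq> 0" for k
      proof
        assume k: "w k = 0"
        have "w (k + j) = 0" for j by (induction j) (auto simp: k wF F0)
        then have "w (k + K) = 0" .
        then show False using small(1)[OF K[of "k + K"]] by simp
      qed
      ultimately show ?thesis
        using LIMSEQ_offset[of w K] LIMSEQ_offset[of "\<lambda>k. sgn (w k)" K]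
        by (auto simp: converges_along_def)
    qed
    show "petal U F v (petal_set N v R)"
      unfolding petal_def
      using open_petal_set[OF N v0 less_imp_le[OF elim(1)]] step D small conv
        converges_along_imp_eventually_petal[OF N v0 elim(1)]
      by blast
  qed
qed


section \<open>The Leau--Fatou flower\<close>

text \<open>In the coordinate of an attracting petal this is the overlap with the repelling petal on one side.\<close>

lemma convex_overlap: "convex {w::complex. - Im w - \<bar>Re w\<bar> > R}"
proof (rule convexI)
  fix x y :: complex and u t :: real
  assume xy: "x \<in> {w. - Im w - \<bar>Re w\<bar> > R}" "y \<in> {w. - Im w - \<bar>Re w\<bar> > R}" and ut: "0 \<le> u" "0 \<le> t" "u + t = 1"
  have "R = u * R + t * R" using ut by (metis distrib_right mult_1)
  also have "\<dots> < u * (- Im x - \<bar>Re x\<bar>) + t * (- Im y - \<bar>Re y\<bar>)"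
  proof (cases "u = 0")
    case True then show ?thesis using xy ut by simp
  next
    case False
    then have "u * R < u * (- Im x - \<bar>Re x\<bar>)" using xy ut by simp
    moreover have "t * R \<le> t * (- Im y - \<bar>Re y\<bar>)" using xy ut by (intro mult_left_mono) auto
    ultimately show ?thesis by linarith
  qed
  also have "\<dots> \<le> - Im (u *\<^sub>R x + t *\<^sub>R y) - \<bar>Re (u *\<^sub>R x + t *\<^sub>R y)\<bar>"
    using abs_triangle_ineq[of "u * Re x" "t * Re y"] ut by (simp add: abs_mult algebra_simps)
  finally show "u *\<^sub>R x + t *\<^sub>R y \<in> {w. - Im w - \<bar>Re w\<bar> > R}" by simp
qed

definition direction :: "complex \<Rightarrow> nat \<Rightarrow> nat \<Rightarrow> complex" where
  "direction v0 N j = v0 * cis (pi * real j / real N)"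

lemma direction_power: "N > 0 \<Longrightarrow> direction v0 N j ^ N = v0 ^ N * (-1) ^ j"
proof -
  assume N: "N > 0"
  have "cis (pi * real j / real N) ^ N = cis (real j * pi)"
    using N by (simp add: Complex.DeMoivre mult.commute)
  also have "\<dots> = (-1) ^ j"
    by (simp add: complex_eq_iff sin_npi cos_npi)
  finally show ?thesis by (simp add: direction_def power_mult_distrib)
qed

lemma cis_two_pi_of_int: "cis (2 * pi * of_int m) = 1"
  by (simp add: complex_eq_iff cos_int_2pin sin_int_2pin)

text \<open>Passing from the \<open>i\<close>-th to the \<open>j\<close>-th direction shifts the logarithmic coordinate by \<open>i\<pi> (j - i)\<close>, with an
  ambiguity of \<open>2\<pi>iN\<close>.\<close>

lemma direction_times_exp:
  assumes "N > 0"
  shows "direction v0 N j * exp (- (l + \<i> * pi * of_int (int j - int i + 2 * int N * m)) / of_nat N)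
       = direction v0 N i * exp (- l / of_nat N)"
proof -
  have "cis (pi * real j / real N) * exp (- (l + \<i> * pi * of_int (int j - int i + 2 * int N * m)) / of_nat N)
    = exp (\<i> * pi * of_nat i / of_nat N + - l / of_nat N + - (2 * of_int m * pi) * \<i>)"
    unfolding cis_conv_exp exp_add[symmetric] using assms
    by (intro arg_cong[of _ _ exp]) (simp add: field_simps)
  also have "\<dots> = cis (pi * real i / real N) * exp (- l / of_nat N)"
    using cis_two_pi_of_int[of "- m"] unfolding exp_add cis_conv_exp by (simp add: mult_ac)
  finally show ?thesis by (simp add: direction_def mult.assoc)
qed

text \<open>Both logarithmic coordinates of a common point have imaginary part below \<open>3\<pi>/4\<close> in modulus, so their
  difference, a multiple of \<open>\<pi>\<close>, is \<open>0\<close> or \<open>\<plusminus> \<pi>\<close>.\<close>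

lemma petal_sets_overlap:
  assumes N: "N > 0" and v: "v0 \<noteq> 0" and R: "R \<ge> 0"
    and z: "z \<in> petal_set N (direction v0 N i) R" "z \<in> petal_set N (direction v0 N j) R"
  obtains l m where "z = direction v0 N i * exp (- l / of_nat N)" "exp l \<in> far_right R" "l = Ln (exp l)"
    "exp (l + \<i> * pi * of_int (int j - int i + 2 * int N * m)) \<in> far_right R"
    "\<bar>Im l\<bar> < 3 * pi / 4" "\<bar>Im l + pi * of_int (int j - int i + 2 * int N * m)\<bar> < 3 * pi / 4"
    "\<bar>int j - int i + 2 * int N * m\<bar> \<le> 1"
proof -
  have d0: "direction v0 N k \<noteq> 0" for k using v by (simp add: direction_def)
  obtain l where l: "z = direction v0 N i * exp (- l / of_nat N)" "\<bar>Im l\<bar> < 3 * pi / 4" "exp l \<in> far_right R" "l = Ln (exp l)"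
    using petal_setE[OF N d0 z(1) R] by metis
  obtain l' where l': "z = direction v0 N j * exp (- l' / of_nat N)" "\<bar>Im l'\<bar> < 3 * pi / 4" "exp l' \<in> far_right R"
    using petal_setE[OF N d0 z(2) R] by metis
  have "exp (\<i> * pi * of_nat i / of_nat N + - l / of_nat N) = exp (\<i> * pi * of_nat j / of_nat N + - l' / of_nat N)"
    using l(1) l'(1) v unfolding exp_add by (simp add: direction_def cis_conv_exp mult_ac)
  then obtain m where m: "\<i> * pi * of_nat i / of_nat N + - l / of_nat N
      = \<i> * pi * of_nat j / of_nat N + - l' / of_nat N + 2 * of_int m * pi * \<i>"
    unfolding exp_eq by (auto simp: mult_ac)
  have L: "l' = l + \<i> * pi * of_int (int j - int i + 2 * int N * m)"
    using m N by (simp add: field_simps)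
  have im: "\<bar>Im l + pi * of_int (int j - int i + 2 * int N * m)\<bar> < 3 * pi / 4"
    using l'(2) unfolding L by simp
  define d where "d = int j - int i + 2 * int N * m"
  have "\<bar>pi * of_int d\<bar> < 3 * pi / 2" using im l(2) unfolding d_def[symmetric] by linarith
  then have "\<bar>real_of_int d\<bar> * pi < 3/2 * pi" by (simp add: abs_mult mult.commute)
  then have "\<bar>real_of_int d\<bar> < 3/2" using mult_less_cancel_right_pos[OF pi_gt_zero] by blast
  then have "\<bar>d\<bar> \<le> 1" by linarith
  then show ?thesis using that[of l m] l l'(3) L im by (auto simp: d_def)
qed

text \<open>The coordinate in the next petal is \<open>- w\<close> with argument increased by \<open>\<pi>\<close>, so \<open>w\<close> lies in the lower half
  plane and both \<open>w\<close> and \<open>- w\<close> are in the region. For \<open>N = 1\<close> the shift by \<open>- \<pi>\<close> gives a second component.\<close>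

lemma cyclic_neighbours_overlap:
  assumes "N > 1" and v: "v0 \<noteq> 0" and R: "R \<ge> 0" and i: "i < 2 * N" and j: "j = (i + 1) mod (2 * N)"
  shows "petal_set N (direction v0 N i) R \<inter> petal_set N (direction v0 N j) R
       = petal_map N (direction v0 N i) ` {w. - Im w - \<bar>Re w\<bar> > R}" (is "_ = ?f ` ?S")
proof (intro equalityI subsetI)
  have N: "N > 0" using assms by simp
  have d0: "direction v0 N k \<noteq> 0" for k using v by (simp add: direction_def)
  obtain k where k: "int j - int i + 2 * int N * k = 1"
  proof (cases "i + 1 = 2 * N")
    case True
    then show ?thesis using that[of 1] j by auto
  next
    case False
    then show ?thesis using that[of 0] i j by auto
  qed
  { fix z assume "z \<in> petal_set N (direction v0 N i) R \<inter> petal_set N (direction v0 N j) R"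
    then obtain l m where l: "z = direction v0 N i * exp (- l / of_nat N)" "exp l \<in> far_right R" "l = Ln (exp l)"
      "exp (l + \<i> * pi * of_int (int j - int i + 2 * int N * m)) \<in> far_right R"
      "\<bar>Im l\<bar> < 3 * pi / 4" "\<bar>Im l + pi * of_int (int j - int i + 2 * int N * m)\<bar> < 3 * pi / 4"
      and m: "\<bar>int j - int i + 2 * int N * m\<bar> \<le> 1"
      using petal_sets_overlap[OF N v R] by (metis IntE)
    have "int j - int i + 2 * int N * m = 1 + 2 * int N * (m - k)" using k by (simp add: algebra_simps)
    with m have "\<bar>1 + 2 * int N * (m - k)\<bar> \<le> 1" by simp
    \<comment> \<open>This excludes the shift by \<open>- \<pi>\<close> and is where \<open>N > 1\<close> enters.\<close>
    moreover have "\<bar>1 + 2 * int N * (m - k)\<bar> > 1" if "m \<noteq> k"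
    proof -
      have "\<bar>2 * int N * (m - k)\<bar> \<ge> 4 * 1"
        unfolding abs_mult using that \<open>N > 1\<close> by (intro mult_mono) auto
      then show ?thesis by linarith
    qed
    ultimately have "m = k" by force
    then have e: "int j - int i + 2 * int N * m = 1" using k by simp
    have w: "exp (l + \<i> * pi) \<in> far_right R" "\<bar>Im l + pi\<bar> < 3 * pi / 4"
      using l(4,6) unfolding e by simp_all
    have "sin (- Im l) > 0" using w(2) l(5) pi_gt_zero by (intro sin_gt_zero) linarith+
    then have "Im (exp l) < 0" by (simp add: Im_exp mult_pos_neg)
    moreover have "exp (l + \<i> * pi) = - exp l" by (simp add: exp_add)
    ultimately have "exp l \<in> ?S" using w(1) l(2) by (auto simp: far_right_def)
    then show "z \<in> ?f ` ?S" using l(1,3) by (intro image_eqI[of _ _ "exp l"]) auto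
  }
  { fix z assume "z \<in> ?f ` ?S"
    then obtain w where w: "- Im w - \<bar>Re w\<bar> > R" and z: "z = ?f w" by auto
    have w': "w \<in> far_right R" using w by (auto simp: far_right_def)
    have w0: "w \<noteq> 0" using far_right_not_nonpos_Reals[OF w' R] by simp
    have "Im w < 0" using w R by linarith
    then have im: "- pi < Im (Ln w)" "Im (Ln w) < 0"
      using mpi_less_Im_Ln[OF w0] Im_Ln_pos_lt_imp[of w] Im_Ln_pos_le[OF w0] Im_Ln_le_pi[OF w0] by (auto simp: not_le)
    have "z = direction v0 N j * exp (- (Ln w + \<i> * pi) / of_nat N)"
      using direction_times_exp[OF N, of v0 j "Ln w" i k] unfolding k z by simp
    moreover have "exp (Ln w + \<i> * pi) = - w" using w0 by (simp add: exp_add)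
    then have "exp (Ln w + \<i> * pi) \<in> far_right R" using w by (simp add: far_right_def)
    ultimately have "z \<in> petal_set N (direction v0 N j) R"
      using im by (intro petal_setI[OF N d0]) auto
    then show "z \<in> petal_set N (direction v0 N i) R \<inter> petal_set N (direction v0 N j) R"
      using w' z by (auto simp: petal_set_def)
  }
qed

lemma petal_sets_disjoint:
  assumes "N > 0" and v: "v0 \<noteq> 0" and R: "R \<ge> 0" and ij: "i < 2 * N" "j < 2 * N" "i \<noteq> j"
    and "\<not> cyclic_neighbours (2 * N) i j"
  shows "petal_set N (direction v0 N i) R \<inter> petal_set N (direction v0 N j) R = {}"
proof (rule ccontr)
  assume "\<not> ?thesis"
  then obtain z where "z \<in> petal_set N (direction v0 N i) R" "z \<in> petal_set N (direction v0 N j) R"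
    by auto
  then obtain m where m: "\<bar>int j - int i + 2 * int N * m\<bar> \<le> 1"
    using petal_sets_overlap[OF assms(1-3)] by metis
  define d where "d = int j - int i + 2 * int N * m"
  have "int i + d = int j + int (2 * N) * m" "int j - d = int i + int (2 * N) * (- m)"
    by (simp_all add: d_def)
  then have j': "int j = (int i + d) mod int (2 * N)" and i': "int i = (int j - d) mod int (2 * N)"
    using ij by (simp_all only: mod_mult_self2) auto
  consider "d = 0" | "d = 1" | "d = -1" using m unfolding d_def[symmetric] by linarith
  then show False
  proof cases
    case 1
    then show ?thesis using ij j' by simp
  next
    case 2
    then have "int j = int ((i + 1) mod (2 * N))" using j' by (simp add: zmod_int add.commute)
    then show ?thesis using assms by (simp only: cyclic_neighbours_def of_nat_eq_iff) auto
  next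
    case 3
    then have "int i = int ((j + 1) mod (2 * N))" using i' by (simp add: zmod_int add.commute)
    then show ?thesis using assms by (simp only: cyclic_neighbours_def of_nat_eq_iff) auto
  qed
qed

text \<open>Some multiple of \<open>\<pi>\<close> moves the imaginary part of the logarithmic coordinate into \<open>[- \<pi>/2, \<pi>/2]\<close>, where
  \<open>Re w + \<bar>Im w\<bar>\<close> is at least the modulus of \<open>w\<close>.\<close>

lemma petal_sets_cover:
  assumes N: "N > 0" and v: "v0 \<noteq> 0" and R: "R > 0" and z: "z \<noteq> 0" "norm (v0 / z) ^ N > R"
  shows "\<exists>j<2 * N. z \<in> petal_set N (direction v0 N j) R"
proof -
  have d0: "direction v0 N k \<noteq> 0" for k using v by (simp add: direction_def)
  define l where "l = - of_nat N * Ln (z / v0)"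
  define k where "k = round (- Im l / pi)"
  define j where "j = nat (k mod int (2 * N))"
  have j: "j < 2 * N" "int j = k mod int (2 * N)" using N by (auto simp: j_def nat_less_iff)
  have zl: "z = direction v0 N 0 * exp (- l / of_nat N)"
    using N z v by (simp add: l_def direction_def)
  have "int j = k - 2 * int N * (k div int (2 * N))"
    using j(2) minus_div_mult_eq_mod[of k "int (2 * N)"] by (simp add: mult_ac)
  then have e: "int j - int 0 + 2 * int N * (k div int (2 * N)) = k" by simp
  have zj: "z = direction v0 N j * exp (- (l + \<i> * pi * of_int k) / of_nat N)"
    using direction_times_exp[OF N, of v0 j l 0 "k div int (2 * N)"] unfolding e zl[symmetric] by simp
  have "\<bar>of_int k - (- Im l / pi)\<bar> \<le> 1 / 2"
    unfolding k_def by (rule of_int_round_abs_le)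
  then have "pi * \<bar>of_int k - (- Im l / pi)\<bar> \<le> pi * (1 / 2)" by (intro mult_left_mono) auto
  moreover have "\<bar>Im (l + \<i> * pi * of_int k)\<bar> = pi * \<bar>of_int k - (- Im l / pi)\<bar>"
  proof -
    have "Im (l + \<i> * pi * of_int k) = pi * (of_int k - (- Im l / pi))" by (simp add: field_simps)
    then show ?thesis by (simp only: abs_mult) simp
  qed
  ultimately have im: "\<bar>Im (l + \<i> * pi * of_int k)\<bar> \<le> pi / 2" by linarith
  have "norm (exp l) = norm (v0 / z) ^ N"
  proof -
    have "exp l = inverse ((z / v0) ^ N)"
      using z v by (simp add: l_def exp_minus exp_of_nat_mult)
    also have "\<dots> = (v0 / z) ^ N" using z v by (simp add: field_simps)
    finally show ?thesis by (simp add: norm_power)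
  qed
  then have "norm (exp (l + \<i> * pi * of_int k)) > R"
    using z by (simp add: exp_add norm_mult)
  moreover have "Re (exp (l + \<i> * pi * of_int k)) \<ge> 0"
    unfolding Re_exp using im by (intro mult_nonneg_nonneg cos_ge_zero exp_ge_zero) linarith+
  ultimately have "exp (l + \<i> * pi * of_int k) \<in> far_right R" by (intro far_rightI)
  then have "z \<in> petal_set N (direction v0 N j) R"
    using im pi_gt_zero by (intro petal_setI[OF N d0 zj]) linarith+
  then show ?thesis using j by blast
qed

text \<open>One radius \<open>R\<close> serves all \<open>2 N\<close> directions. The odd directions are attracting for the inverse germ,
  whose coefficient is \<open>- c\<close>.\<close>

lemma exists_petals:
  fixes F :: "complex \<Rightarrow> complex"
  assumes lim: "(\<lambda>z. (F z - z) / z ^ (N + 1)) \<midarrow>0\<rightarrow> c" and N: "N > 0" and c: "c \<noteq> 0"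
    and U: "open U" "0 \<in> U" "F holomorphic_on U" "inj_on F U" and F0: "F 0 = 0"
    and V: "open V" "0 \<in> V"
  shows "\<exists>P. petals_in U F N c V P"
proof -
  obtain v0 where v0: "- 1 / (of_nat N * c) = v0 ^ N"
    using exists_complex_root N by blast
  then have v0N: "of_nat N * c * v0 ^ N = - 1" using N c by (simp flip: v0)
  have v00: "v0 \<noteq> 0" using v0N N by (auto simp: power_0_left)
  have dN: "of_nat N * c * direction v0 N j ^ N = - ((-1) ^ j)" for j
    unfolding direction_power[OF N] mult.assoc[symmetric] v0N by simp
  have d0: "direction v0 N j \<noteq> 0" for j using v00 by (simp add: direction_def)
  have petals: "\<forall>\<^sub>F R in at_top. if even j then petal U F (direction v0 N j) (petal_set N (direction v0 N j) R)
      else petal (F ` U) (inv_into U F) (direction v0 N j) (petal_set N (direction v0 N j) R)" for j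
  proof (cases "even j")
    case True
    then show ?thesis using eventually_petal[OF lim N _ U(1,2) F0, of "direction v0 N j"] dN[of j] by simp
  next
    case False
    note inv = inverse_germ_limit[OF lim N U F0]
    show ?thesis using eventually_petal[OF inv(1) N _ inv(2,3,4), of "direction v0 N j"] dN[of j] False by simp
  qed
  obtain d where d: "d > 0" "ball 0 d \<subseteq> V" using V open_contains_ball by blast
  have small: "\<forall>\<^sub>F R in at_top. petal_set N (direction v0 N j) R \<subseteq> V" for j
    using eventually_gt_at_top[of 0] eventually_gt_at_top[of "2 * (norm (direction v0 N j) / d) ^ N"]
  proof eventually_elim
    case (elim R)
    then show ?case using norm_petal_set_less[OF N d0 _ elim d(1)] d(2) by (force simp: subset_iff)
  qed
  have "\<forall>\<^sub>F R in at_top. (\<forall>j\<in>{..<2*N}. (if even j then petal U F (direction v0 N j) (petal_set N (direction v0 N j) R)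
      else petal (F ` U) (inv_into U F) (direction v0 N j) (petal_set N (direction v0 N j) R)) \<and>
      petal_set N (direction v0 N j) R \<subseteq> V) \<and> R > 0"
    by (intro eventually_conj eventually_ball_finite ballI petals small eventually_gt_at_top) auto
  then obtain R where R: "R > 0"
    and P: "\<And>j. j < 2 * N \<Longrightarrow> if even j then petal U F (direction v0 N j) (petal_set N (direction v0 N j) R)
      else petal (F ` U) (inv_into U F) (direction v0 N j) (petal_set N (direction v0 N j) R)"
    and sub: "\<And>j. j < 2 * N \<Longrightarrow> petal_set N (direction v0 N j) R \<subseteq> V"
    using eventually_happens'[OF trivial_limit_at_top_linorder] by (metis (no_types, lifting) lessThan_iff)
  define P where "P = (\<lambda>j. petal_set N (direction v0 N j) R)"
  have R': "R \<ge> 0" using R by simp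
  have overlap: "P i \<inter> P j \<noteq> {} \<and> simply_connected (P i \<inter> P j)"
    if "N > 1" "i < 2 * N" "j = (i + 1) mod (2 * N)" for i j
  proof -
    let ?S = "{w::complex. - Im w - \<bar>Re w\<bar> > R}"
    have e: "P i \<inter> P j = petal_map N (direction v0 N i) ` ?S"
      unfolding P_def by (rule cyclic_neighbours_overlap[OF that(1) v00 R' that(2,3)])
    have "Complex 0 (- R - 1) \<in> ?S" by simp
    then have "P i \<inter> P j \<noteq> {}" unfolding e by blast
    moreover have "simply_connected (P i \<inter> P j)"
      unfolding e
      by (rule simply_connected_petal_image[OF N d0 convex_imp_simply_connected[OF convex_overlap] _ R'])
         (auto simp: far_right_def)
    ultimately show ?thesis by simp
  qed
  have opP: "open (\<Union>j<2 * N. P j)"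
    unfolding P_def by (intro open_UN ballI open_petal_set[OF N d0 R'])
  obtain e where e: "e > 0" "\<And>z. z \<noteq> 0 \<Longrightarrow> norm z < e \<Longrightarrow> norm (v0 / z) ^ N > R"
  proof -
    have "(\<lambda>z. norm (z / v0) ^ N) \<midarrow>0\<rightarrow> norm (0 / v0) ^ N"
      using v00 by (intro tendsto_intros) auto
    then have "\<forall>\<^sub>F z in at 0. norm (z / v0) ^ N < 1 / R"
      by (rule order_tendstoD(2)) (use R N in \<open>simp add: power_0_left\<close>)
    then obtain e where e: "e > 0" "\<And>z. z \<noteq> 0 \<Longrightarrow> norm z < e \<Longrightarrow> norm (z / v0) ^ N < 1 / R"
      unfolding eventually_at by auto
    show ?thesis
    proof (rule that[OF e(1)])
      fix z :: complex assume z: "z \<noteq> 0" "norm z < e"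
      have "norm (z / v0) ^ N > 0" using z v00 by simp
      then have "R < 1 / norm (z / v0) ^ N" using e(2)[OF z] R by (simp add: field_simps)
      also have "\<dots> = norm (v0 / z) ^ N" by (simp add: norm_divide power_divide)
      finally show "norm (v0 / z) ^ N > R" .
    qed
  qed
  have "insert 0 (\<Union>j<2 * N. P j) = (\<Union>j<2 * N. P j) \<union> ball 0 e"
  proof -
    have "z \<in> insert 0 (\<Union>j<2 * N. P j)" if "z \<in> ball 0 e" for z
      using petal_sets_cover[OF N v00 R _ e(2), of z] that by (cases "z = 0") (auto simp: P_def)
    then have "ball 0 e \<subseteq> insert 0 (\<Union>j<2 * N. P j)" by blast
    moreover have "0 \<in> ball (0::complex) e" using e(1) by simp
    ultimately show ?thesis by blast
  qed
  then have op: "open (insert 0 (\<Union>j<2 * N. P j))" using open_Un[OF opP open_ball] by metis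
  have "petals_in U F N c V P"
    unfolding petals_in_def
  proof (intro conjI allI impI exI[of _ v0])
    fix j assume j: "j < 2 * N"
    show "if even j then attracting_petal U F N c (v0 * cis (pi * real j / real N)) (P j)
         else repelling_petal U F N c (v0 * cis (pi * real j / real N)) (P j)"
      using P[OF j] dN[of j] unfolding direction_def[symmetric]
      by (auto simp: attracting_petal_def repelling_petal_def attracting_direction_def repelling_direction_def P_def)
    show "P j \<subseteq> V" using sub[OF j] by (simp add: P_def)
    show "simply_connected (P j)" unfolding P_def petal_set_def
      by (rule simply_connected_petal_image[OF N d0 starlike_imp_simply_connected[OF starlike_far_right[OF R']] order_refl R'])
  next
    fix i j assume ij: "N > 1" "i < 2 * N" "j < 2 * N" "i \<noteq> j"
    show "if cyclic_neighbours (2 * N) i j then P i \<inter> P j \<noteq> {} \<and> simply_connected (P i \<inter> P j) else P i \<inter> P j = {}"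
    proof (cases "cyclic_neighbours (2 * N) i j")
      case True
      then consider "j = (i + 1) mod (2 * N)" | "i = (j + 1) mod (2 * N)" by (auto simp: cyclic_neighbours_def)
      then show ?thesis
      proof cases
        case 1
        then show ?thesis using overlap[OF ij(1,2)] True by simp
      next
        case 2
        then show ?thesis using overlap[OF ij(1,3)] True by (simp add: Int_commute)
      qed
    next
      case False
      then show ?thesis using petal_sets_disjoint[OF N v00 R' ij(2-4) False] by (simp add: P_def)
    qed
  qed (use op in auto)
  then show ?thesis by blast
qed

text \<open>The flower theorem in the form used below: the germ enters only through its multiplier and the
  leading term of its \<open>q\<close>-th iterate.\<close>

theorem leau_fatou_flowerI:
  fixes f :: "complex \<Rightarrow> complex"
  assumes f: "f analytic_on {0}" "f 0 = 0" and q: "primitive_root q (deriv f 0)"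
    and lim: "(\<lambda>z. ((f ^^ q) z - z) / z ^ (N + 1)) \<midarrow>0\<rightarrow> c" and N: "N > 0" and c: "c \<noteq> 0"
  shows "leau_fatou_flower f N"
proof -
  note F = funpow_analytic[OF f, of q]
  have par: "parabolic_expansion (f ^^ q) N c" using parabolic_expansionI[OF lim N c] F by blast
  have iter: "\<not> (\<forall>\<^sub>F z in nhds 0. (f ^^ m) z = z)" if m: "m > 0" for m
  proof
    assume "\<forall>\<^sub>F z in nhds 0. (f ^^ m) z = z"
    then have "\<forall>\<^sub>F z in at 0. (f ^^ m) z = z" by (simp add: eventually_at_filter eventually_mono)
    then have "\<forall>\<^sub>F z in at 0. (((f ^^ q) ^^ m) z - z) / z ^ (N + 1) = 0"
    proof eventually_elim
      case (elim z)
      \<comment> \<open>If \<open>f\<^sup>m\<close> were the identity, so would be the \<open>m\<close>-th iterate of \<open>f\<^sup>q\<close>.\<close>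
      have "((f ^^ m) ^^ q) z = z" by (induction q) (auto simp: elim)
      then show ?case by (simp add: funpow_mult mult.commute)
    qed
    moreover have "\<forall>\<^sub>F z in at 0. (((f ^^ q) ^^ m) z - z) / z ^ (N + 1) \<noteq> 0"
      using tendsto_imp_eventually_ne[OF iterate_tangent_to_identity[OF lim N, of m], of 0] m c by simp
    ultimately have "\<forall>\<^sub>F z in at (0::complex). False" by eventually_elim simp
    then show False by simp
  qed
  obtain A where A: "open A" "0 \<in> A" "(f ^^ q) holomorphic_on A"
    using F unfolding analytic_at by auto
  have "(\<lambda>z. (f ^^ q) z / z) \<midarrow>0\<rightarrow> 1" using tangent_to_identity(1)[OF lim N] .
  then have "((f ^^ q) has_field_derivative 1) (at 0)"
    using F by (simp add: has_field_derivative_iff)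
  then have "deriv (f ^^ q) 0 \<noteq> 0" by (simp add: DERIV_imp_deriv)
  then obtain r where r: "r > 0" "ball 0 r \<subseteq> A" "inj_on (f ^^ q) (ball 0 r)"
    using has_complex_derivative_locally_injective[OF A(3,2,1)] by blast
  have hol: "(f ^^ q) holomorphic_on ball 0 r" using A r holomorphic_on_subset by blast
  have "\<exists>P. petals_in (ball 0 r) (f ^^ q) N c V P" if "open V \<and> 0 \<in> V" for V
    using exists_petals[OF lim N c open_ball _ hol r(3) _ , of V] F that r(1) by simp
  then have "\<exists>U. open U \<and> 0 \<in> U \<and> (f ^^ q) holomorphic_on U \<and> inj_on (f ^^ q) U \<and>
      (\<forall>V. open V \<and> 0 \<in> V \<longrightarrow> (\<exists>P. petals_in U (f ^^ q) N c V P))"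
    using r hol by (intro exI[of _ "ball 0 r"]) auto
  then show ?thesis unfolding leau_fatou_flower_def using f q par iter by blast
qed


section \<open>The line field of the foliation\<close>

definition leaf_field :: "nat \<Rightarrow> complex \<times> complex \<Rightarrow> complex \<times> complex" where
  "leaf_field n z = (of_nat n * fst z + snd z ^ n, snd z)"

definition cscale :: "complex \<Rightarrow> complex \<times> complex \<Rightarrow> complex \<times> complex" where
  "cscale c z = (c * fst z, c * snd z)"

text \<open>The Hermitian product of the position with \<open>X\<close>. A complex multiple \<open>c X\<close> is tangent to the sphere iff
  \<open>c\<close> times this number is imaginary.\<close>

definition radial :: "nat \<Rightarrow> complex \<times> complex \<Rightarrow> complex" where
  "radial n z = cnj (fst z) * fst (leaf_field n z) + cnj (snd z) * snd (leaf_field n z)"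

definition cdet :: "complex \<times> complex \<Rightarrow> complex \<times> complex \<Rightarrow> complex" where
  "cdet u w = fst u * snd w - snd u * fst w"

lemma omega_eq_cdet: "omega n z v = cdet (leaf_field n z) v"
  by (simp add: omega_def cdet_def leaf_field_def algebra_simps)

lemma inner_cscale_leaf_field: "inner z (cscale c (leaf_field n z)) = Re (c * radial n z)"
  by (simp add: inner_prod_def inner_complex_def cscale_def radial_def algebra_simps)

lemma sum_over_permutations_4:
  fixes g :: "(4 \<Rightarrow> 4) \<Rightarrow> 'a::comm_ring_1"
  shows "sum g {p. p permutes (UNIV::4 set)} = (\<Sum>b\<in>{1,2,3,4}. \<Sum>c\<in>{2,3,4}. \<Sum>d\<in>{3,4}.
    g (Transposition.transpose 1 b \<circ> (Transposition.transpose 2 c \<circ> Transposition.transpose 3 d)))"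
proof -
  have f: "finite {2::4, 3, 4}" "1 \<notin> {2::4, 3, 4}" "finite {3::4, 4}" "2 \<notin> {3::4, 4}" "finite {4::4}" "3 \<notin> {4::4}"
    by auto
  show ?thesis
    unfolding UNIV_4 sum_over_permutations_insert[OF f(1,2)]
      sum_over_permutations_insert[OF f(3,4)] sum_over_permutations_insert[OF f(5,6)] permutes_sing
    by simp
qed

lemma sign_transpositions_4:
  "sign (Transposition.transpose (1::4) b \<circ> (Transposition.transpose 2 c \<circ> Transposition.transpose 3 d))
  = (if b = 1 then 1 else -1) * (if c = 2 then 1 else -1) * (if d = 3 then 1 else -1)"
  by (auto simp: sign_compose permutation_swap_id permutation_compose sign_swap_id)

lemma det_4:
  fixes A :: "'a::comm_ring_1 ^ 4 ^ 4"
  defines "m \<equiv> \<lambda>i j. vec_nth (vec_nth A i) j"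
  shows "det A =
     m 1 1 * (m 2 2 * m 3 3 * m 4 4 + m 2 3 * m 3 4 * m 4 2 + m 2 4 * m 3 2 * m 4 3
            - m 2 2 * m 3 4 * m 4 3 - m 2 3 * m 3 2 * m 4 4 - m 2 4 * m 3 3 * m 4 2)
   - m 1 2 * (m 2 1 * m 3 3 * m 4 4 + m 2 3 * m 3 4 * m 4 1 + m 2 4 * m 3 1 * m 4 3
            - m 2 1 * m 3 4 * m 4 3 - m 2 3 * m 3 1 * m 4 4 - m 2 4 * m 3 3 * m 4 1)
   + m 1 3 * (m 2 1 * m 3 2 * m 4 4 + m 2 2 * m 3 4 * m 4 1 + m 2 4 * m 3 1 * m 4 2
            - m 2 1 * m 3 4 * m 4 2 - m 2 2 * m 3 1 * m 4 4 - m 2 4 * m 3 2 * m 4 1)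
   - m 1 4 * (m 2 1 * m 3 2 * m 4 3 + m 2 2 * m 3 3 * m 4 1 + m 2 3 * m 3 1 * m 4 2
            - m 2 1 * m 3 3 * m 4 2 - m 2 2 * m 3 1 * m 4 3 - m 2 3 * m 3 2 * m 4 1)"
proof -
  have ne: "(1::4) \<noteq> 2" "(1::4) \<noteq> 3" "(1::4) \<noteq> 4" "(2::4) \<noteq> 3" "(2::4) \<noteq> 4" "(3::4) \<noteq> 4"
    by auto
  have pr: "(\<Prod>i\<in>UNIV. f (i::4)) = f 1 * f 2 * f 3 * (f 4 :: 'a)" for f
    unfolding UNIV_4 by (simp add: mult_ac)
  show ?thesis
    unfolding m_def det_def sum_over_permutations_4 sign_transpositions_4 pr
    by (simp add: ne ne[symmetric] transpose_def o_def) (simp only: algebra_simps)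
qed

lemma vector_4_component:
  "vec_nth (vector [a, b, c, d] :: 'a::zero ^ 4) 1 = a" "vec_nth (vector [a, b, c, d] :: 'a ^ 4) 2 = b"
  "vec_nth (vector [a, b, c, d] :: 'a ^ 4) 3 = c" "vec_nth (vector [a, b, c, d] :: 'a ^ 4) 4 = d"
  by (simp_all add: vector_def)

lemma to_R4_component:
  "vec_nth (to_R4 z) 1 = Re (fst z)" "vec_nth (to_R4 z) 2 = Im (fst z)" "vec_nth (to_R4 z) 3 = Re (snd z)" "vec_nth (to_R4 z) 4 = Im (snd z)"
  by (simp_all add: to_R4_def vector_4_component)

definition frame_det ::
    "complex \<times> complex \<Rightarrow> complex \<times> complex \<Rightarrow> complex \<times> complex \<Rightarrow> complex \<times> complex \<Rightarrow> real" where
  "frame_det a b c d = det (vector [to_R4 a, to_R4 b, to_R4 c, to_R4 d] :: real ^ 4 ^ 4)"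

lemmas frame_det_expand = frame_det_def det_4 vector_4_component to_R4_component

text \<open>Projecting along the complex line of \<open>y\<close> by \<open>p \<mapsto> cdet y p\<close> identifies the quotient with \<open>\<complex>\<close>.\<close>

lemma frame_det_complex_line: "frame_det y (cscale \<i> y) u w = Im (cnj (cdet y u) * cdet y w)"
  by (simp add: frame_det_expand cscale_def cdet_def algebra_simps)

lemma frame_det_linear:
  "frame_det (r *\<^sub>R a + b) v u w = r * frame_det a v u w + frame_det b v u w"
  "frame_det a (r *\<^sub>R v) u w = r * frame_det a v u w"
  by (simp_all add: frame_det_expand algebra_simps)

lemma frame_det_orthogonal:
  assumes "z \<noteq> 0" "inner z a = 0" "inner z b = 0" "inner z c = 0" "inner z d = 0"
  shows "frame_det a b c d = 0"
proof -
  let ?A = "vector [to_R4 a, to_R4 b, to_R4 c, to_R4 d] :: real ^ 4 ^ 4"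
  have ip: "inner (to_R4 x) (to_R4 z) = inner z x" for x
    by (simp add: inner_vec_def sum_4 to_R4_component inner_prod_def inner_complex_def algebra_simps)
  have "?A *v to_R4 z = 0"
    using assms unfolding vec_eq_iff forall_4
    by (simp add: matrix_vector_mul_component vector_4_component ip)
  moreover have "to_R4 z \<noteq> 0"
    using \<open>z \<noteq> 0\<close> by (auto simp: vec_eq_iff forall_4 to_R4_component prod_eq_iff complex_eq_iff)
  ultimately show ?thesis
    unfolding frame_det_def
    by (metis det_identical_rows invertible_det_nz invertible_left_inverse matrix_left_invertible_ker)
qed

text \<open>The vector \<open>y = cnj h X\<close>, where \<open>h = radial n z\<close>, is \<open>\<bar>h\<bar>\<^sup>2 z\<close> plus a tangent vector. Tangent
  vectors contribute nothing to a determinant whose other three vectors are tangent, so \<open>z\<close> may be replaced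
  by \<open>y / \<bar>h\<bar>\<^sup>2\<close>; the determinant with the vectors \<open>y\<close> and \<open>i y\<close> is then computed on the complex quotient.\<close>

lemma frame_det_leaf_vector:
  assumes z: "z \<in> S3" and h: "radial n z \<noteq> 0" and uw: "u \<in> tangent_S3 z" "w \<in> tangent_S3 z"
  shows "frame_det z (cscale (of_real r * \<i> * cnj (radial n z)) (leaf_field n z)) u w = r * coorientation n z u w"
proof -
  define h where "h = radial n z"
  define y where "y = cscale (cnj h) (leaf_field n z)"
  define N where "N = (norm h)\<^sup>2"
  have N: "N > 0" using h by (simp add: N_def h_def)
  have hh: "cnj h * h = of_real N" by (simp add: N_def complex_norm_square mult.commute del: of_real_power)
  define t where "t = y - N *\<^sub>R z"
  have zz: "inner z z = 1" using z by (simp add: dot_square_norm)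
  then have z0: "z \<noteq> 0" by auto
  have "inner z y = Re (cnj h * h)" by (simp only: y_def h_def inner_cscale_leaf_field)
  then have iy: "inner z y = N" unfolding hh by simp
  then have it: "inner z t = 0" by (simp add: t_def inner_diff_right zz)
  have v: "cscale (of_real r * \<i> * cnj h) (leaf_field n z) = r *\<^sub>R cscale \<i> y"
    by (simp add: y_def cscale_def prod_eq_iff scaleR_conv_of_real)
  have iiy: "inner z (cscale \<i> y) = 0"
  proof -
    have "cscale \<i> y = cscale (\<i> * cnj h) (leaf_field n z)" by (simp add: y_def cscale_def)
    then have "inner z (cscale \<i> y) = Re (\<i> * (cnj h * h))"
      using inner_cscale_leaf_field[of z "\<i> * cnj h" n] by (simp only: h_def mult.assoc)
    then show ?thesis unfolding hh by simp
  qed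
  have u: "inner z u = 0" "inner z w = 0" using uw by (simp_all add: tangent_S3_def)
  have "frame_det y (cscale \<i> y) u w = N * frame_det z (cscale \<i> y) u w + frame_det t (cscale \<i> y) u w"
    using frame_det_linear(1)[of N z t "cscale \<i> y" u w] by (simp add: t_def)
  also have "frame_det t (cscale \<i> y) u w = 0"
    by (rule frame_det_orthogonal[OF z0 it iiy u])
  also have "frame_det y (cscale \<i> y) u w = N * coorientation n z u w"
  proof -
    have "cdet y x = cnj h * omega n z x" for x
      by (simp add: omega_eq_cdet y_def cdet_def cscale_def algebra_simps)
    then have "frame_det y (cscale \<i> y) u w = Im ((cnj h * h) * (cnj (omega n z u) * omega n z w))"
      unfolding frame_det_complex_line by (simp only: complex_cnj_mult complex_cnj_cnj mult_ac)
    also have "\<dots> = N * coorientation n z u w"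
      unfolding hh coorientation_def by (simp add: algebra_simps)
    finally show ?thesis .
  qed
  finally have "frame_det z (cscale \<i> y) u w = coorientation n z u w" using N by simp
  then show ?thesis unfolding h_def[symmetric] v frame_det_linear by simp
qed

text \<open>Any vector on which \<open>\<omega>\<^sub>n\<close> has the prescribed value becomes tangent after adding a multiple of \<open>X\<close>,
  which \<open>\<omega>\<^sub>n\<close> does not see.\<close>

lemma exists_tangent_with_omega:
  assumes h: "radial n z \<noteq> 0"
  shows "\<exists>u\<in>tangent_S3 z. omega n z u = c"
proof -
  define X where "X = leaf_field n z"
  have X0: "X \<noteq> 0" using h by (auto simp: X_def radial_def prod_eq_iff)
  define S where "S = fst X * cnj (fst X) + snd X * cnj (snd X)"
  have "S = of_real ((norm (fst X))\<^sup>2 + (norm (snd X))\<^sup>2)"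
    by (simp only: S_def complex_norm_square of_real_add)
  moreover have "(norm (fst X))\<^sup>2 + (norm (snd X))\<^sup>2 \<noteq> 0"
    using X0 by (auto simp: sum_power2_eq_zero_iff prod_eq_iff)
  ultimately have S0: "S \<noteq> 0" by (metis of_real_eq_0_iff)
  define u0 where "u0 = cscale (c / S) (- cnj (snd X), cnj (fst X))"
  have "cdet X u0 = (c / S) * S"
    by (simp add: u0_def cdet_def cscale_def S_def algebra_simps add_divide_distrib)
  then have u0: "cdet X u0 = c" using S0 by simp
  define u where "u = u0 + cscale (- of_real (inner z u0) / radial n z) X"
  have "omega n z u = c"
    using u0 unfolding omega_eq_cdet X_def[symmetric] by (simp add: u_def cdet_def cscale_def algebra_simps)
  moreover have "inner z u = 0"
    using h unfolding u_def inner_add_right X_def inner_cscale_leaf_field by simp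
  ultimately show ?thesis by (intro bexI[of _ u]) (simp_all add: tangent_S3_def)
qed

text \<open>The kernel of \<open>\<omega>\<^sub>n\<close> is the complex line of \<open>X\<close>, tangency leaves the real multiples of \<open>i cnj h X\<close>, and
  \<open>frame_det_leaf_vector\<close> identifies the sign.\<close>

lemma positive_leaf_vector_iff:
  assumes z: "z \<in> S3" and h: "radial n z \<noteq> 0"
  shows "positive_leaf_vector n z v \<longleftrightarrow>
    (\<exists>r>0. v = cscale (of_real r * \<i> * cnj (radial n z)) (leaf_field n z))"
proof
  define X where "X = leaf_field n z"
  have X0: "X \<noteq> 0" using h by (auto simp: X_def radial_def prod_eq_iff)
  have hh: "cnj (radial n z) * radial n z = of_real ((norm (radial n z))\<^sup>2)"
    by (simp add: complex_norm_square mult.commute del: of_real_power)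
  { assume v: "positive_leaf_vector n z v"
    have "cdet X v = 0" using v by (simp add: positive_leaf_vector_def omega_eq_cdet X_def)
    then have e: "fst X * snd v = snd X * fst v" by (simp add: cdet_def)
    have "\<exists>c. v = cscale c X"
    proof (cases "fst X = 0")
      case True
      then have "snd X \<noteq> 0" using X0 by (auto simp: prod_eq_iff)
      then show ?thesis using e True by (intro exI[of _ "snd v / snd X"]) (simp add: cscale_def prod_eq_iff)
    next
      case False
      then show ?thesis
        using e by (intro exI[of _ "fst v / fst X"]) (simp add: cscale_def prod_eq_iff field_simps)
    qed
    then obtain c where c: "v = cscale c X" by blast
    define r where "r = Im (c * radial n z) / (norm (radial n z))\<^sup>2"
    have "Re (c * radial n z) = 0"
      using v inner_cscale_leaf_field[of z c n] by (simp add: positive_leaf_vector_def tangent_S3_def c X_def)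
    then have "c * radial n z = \<i> * of_real (Im (c * radial n z))" by (simp add: complex_eq_iff)
    also have "\<dots> = \<i> * of_real (r * (norm (radial n z))\<^sup>2)" using h by (simp add: r_def)
    also have "\<dots> = of_real r * \<i> * cnj (radial n z) * radial n z"
      unfolding of_real_mult hh[symmetric] by (simp add: mult_ac)
    finally have cr: "c = of_real r * \<i> * cnj (radial n z)" using h by simp
    obtain u w where uw: "u \<in> tangent_S3 z" "w \<in> tangent_S3 z" "omega n z u = 1" "omega n z w = \<i>"
      using exists_tangent_with_omega[OF h] by metis
    have co: "coorientation n z u w = 1" by (simp add: coorientation_def uw)
    then have "positive_triple z v u w" using v uw by (auto simp: positive_leaf_vector_def)
    then have "frame_det z v u w > 0" by (simp add: positive_triple_def frame_det_def)
    then have "r > 0" using frame_det_leaf_vector[OF z h uw(1,2), of r] co by (simp add: c cr X_def)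
    then show "\<exists>r>0. v = cscale (of_real r * \<i> * cnj (radial n z)) (leaf_field n z)"
      using c cr X_def by blast
  }
  { assume "\<exists>r>0. v = cscale (of_real r * \<i> * cnj (radial n z)) (leaf_field n z)"
    then obtain r where r: "r > 0" and v: "v = cscale (of_real r * \<i> * cnj (radial n z)) (leaf_field n z)"
      by blast
    have "of_real r * \<i> * cnj (radial n z) * radial n z = of_real r * \<i> * of_real ((norm (radial n z))\<^sup>2)"
      by (simp only: hh mult.assoc)
    then have "inner z v = 0" unfolding v inner_cscale_leaf_field by (simp del: of_real_power)
    moreover have "v \<noteq> 0" using X0 r h unfolding v X_def by (auto simp: cscale_def prod_eq_iff)
    moreover have "omega n z v = 0" unfolding v omega_eq_cdet by (simp add: cdet_def cscale_def)
    moreover have "positive_triple z v u w"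
      if "u \<in> tangent_S3 z" "w \<in> tangent_S3 z" "coorientation n z u w > 0" for u w
      using frame_det_leaf_vector[OF z h that(1,2), of r] r that(3)
      unfolding v[symmetric] by (simp add: positive_triple_def frame_det_def)
    ultimately show "positive_leaf_vector n z v"
      by (auto simp: positive_leaf_vector_def tangent_S3_def)
  }
qed

lemma norm_pair_sq: "(norm z)\<^sup>2 = (norm (fst z))\<^sup>2 + (norm (snd z))\<^sup>2" for z :: "complex \<times> complex"
  by (simp add: norm_prod_def)

text \<open>With \<open>k = n + z\<^sub>2\<^sup>n / z\<^sub>1\<close> one has \<open>radial n z = \<bar>z\<^sub>1\<bar>\<^sup>2 k + \<bar>z\<^sub>2\<bar>\<^sup>2\<close>. The constant \<open>1/8\<close> keeps \<open>k\<close> within \<open>1/4\<close>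
  of \<open>n\<close>, and the other constants follow from this.\<close>

lemma near_circle:
  assumes n: "n \<ge> 1" and z: "z \<in> S3" and small: "norm (snd z) < 1/8"
  shows "fst z \<noteq> 0" "radial n z \<noteq> 0" "Re (radial n z) \<ge> 3/4 * norm (radial n z)"
    "norm (radial n z) \<le> 4 * Re (cnj (radial n z) * (of_nat n + snd z ^ n / fst z))"
proof -
  define k where "k = of_nat n + snd z ^ n / fst z"
  have e: "(norm (fst z))\<^sup>2 = 1 - (norm (snd z))\<^sup>2" using z norm_pair_sq[of z] by simp
  have "(norm (snd z))\<^sup>2 \<le> (1/8)\<^sup>2" using small by (intro power_mono) auto
  then have "(norm (fst z))\<^sup>2 \<ge> (1/2)\<^sup>2" unfolding e by (simp add: power2_eq_square)
  then have f: "norm (fst z) \<ge> 1/2" by (rule power2_le_imp_le) simp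
  show f0: "fst z \<noteq> 0" using f by auto
  have "norm (snd z) ^ n \<le> norm (snd z) ^ 1" using n small by (intro power_decreasing) auto
  then have "norm (snd z ^ n / fst z) \<le> (1/8) / (1/2)"
    unfolding norm_divide norm_power using f small by (intro frac_le) auto
  then have q: "norm (snd z ^ n / fst z) \<le> 1/4" by simp
  have rk: "Re k \<ge> 3/4" and ik: "\<bar>Im k\<bar> \<le> 1/4"
    using q n abs_Re_le_cmod[of "snd z ^ n / fst z"] abs_Im_le_cmod[of "snd z ^ n / fst z"]
    by (auto simp: k_def)
  have h: "radial n z = of_real ((norm (fst z))\<^sup>2) * k + of_real ((norm (snd z))\<^sup>2)"
    using f0 unfolding complex_norm_square
    by (simp add: radial_def leaf_field_def k_def field_simps)
  define a b where "a = (norm (fst z))\<^sup>2" and "b = (norm (snd z))\<^sup>2"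
  have ab: "a \<ge> 1/4" "b \<ge> 0"
    using \<open>(norm (fst z))\<^sup>2 \<ge> (1/2)\<^sup>2\<close> by (simp_all add: a_def b_def power2_eq_square)
  have reh: "Re (radial n z) = a * Re k + b" and imh: "Im (radial n z) = a * Im k"
    unfolding h a_def b_def by (simp_all del: of_real_power)
  have "a * Re k \<ge> 1/4 * (3/4)" using ab rk by (intro mult_mono) auto
  then have "Re (radial n z) > 0" unfolding reh using ab by linarith
  then show "radial n z \<noteq> 0" by auto
  have "3 * \<bar>a * Im k\<bar> \<le> a * Re k"
  proof -
    have "a * (3 * \<bar>Im k\<bar>) \<le> a * Re k" using ab rk ik by (intro mult_left_mono) auto
    then show ?thesis using ab by (simp add: abs_mult)
  qed
  then have "3 * \<bar>Im (radial n z)\<bar> \<le> Re (radial n z)" unfolding reh imh using ab by linarith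
  then show "Re (radial n z) \<ge> 3/4 * norm (radial n z)"
    using cmod_le[of "radial n z"] \<open>Re (radial n z) > 0\<close> by linarith
  have k1: "norm k \<ge> 3/4" using rk complex_Re_le_cmod[of k] by linarith
  have "(norm k)\<^sup>2 = Re k * Re k + Im k * Im k" by (metis cmod_power2 power2_eq_square)
  then have ek: "Re (cnj (radial n z) * k) = a * (norm k)\<^sup>2 + b * Re k"
    unfolding h a_def[symmetric] b_def[symmetric] by (simp add: algebra_simps)
  have "norm (radial n z) \<le> a * norm k + b"
    unfolding h a_def[symmetric] b_def[symmetric] using ab norm_triangle_ineq[of "of_real a * k" "of_real b"]
    by (simp add: norm_mult)
  also have "\<dots> \<le> a * (4 * (norm k)\<^sup>2) + b * (4 * Re k)"
  proof (intro add_mono mult_left_mono)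
    have "norm k * 1 \<le> norm k * (4 * norm k)" using k1 by (intro mult_left_mono) auto
    then show "norm k \<le> 4 * (norm k)\<^sup>2" by (simp add: power2_eq_square)
    have "b * 1 \<le> b * (4 * Re k)" using ab rk by (intro mult_left_mono) auto
    then show "b \<le> b * (4 * Re k)" by simp
  qed (use ab in auto)
  finally show "norm (radial n z) \<le> 4 * Re (cnj (radial n z) * (of_nat n + snd z ^ n / fst z))"
    unfolding k_def[symmetric] ek by simp
qed

text \<open>The quotient \<open>Im (v\<^sub>1 / z\<^sub>1)\<close> is the angular velocity of \<open>z\<^sub>1\<close>. It controls the whole speed in complex
  time, so near the Hopf circle the argument of \<open>z\<^sub>1\<close> can be used as a clock on every leaf curve, whatever
  its parametrisation.\<close>

lemma leaf_vector_near_circle: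
  assumes n: "n \<ge> 1" and z: "z \<in> S3" and small: "norm (snd z) < 1/8" and v: "positive_leaf_vector n z v"
  obtains m where "v = cscale m (leaf_field n z)" "m \<noteq> 0" "norm m \<le> 4 * Im (fst v / fst z)" "Im m \<ge> 3/4 * norm m"
proof -
  note nc = near_circle[OF n z small]
  obtain r where r: "r > 0" and v: "v = cscale (of_real r * \<i> * cnj (radial n z)) (leaf_field n z)"
    using positive_leaf_vector_iff[OF z nc(2)] v by blast
  define m where "m = of_real r * \<i> * cnj (radial n z)"
  have "norm m = r * norm (radial n z)" using r by (simp add: m_def norm_mult)
  moreover have "Im m = r * Re (radial n z)" by (simp add: m_def)
  moreover have "Im (fst v / fst z) = r * Re (cnj (radial n z) * (of_nat n + snd z ^ n / fst z))"
  proof -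
    have "fst v / fst z = of_real r * (\<i> * (cnj (radial n z) * (of_nat n + snd z ^ n / fst z)))"
      using nc(1) by (simp add: v cscale_def leaf_field_def field_simps)
    then show ?thesis by (simp only: Im_complex_of_real Re_complex_of_real times_complex.sel) simp
  qed
  ultimately show ?thesis
    using that[of m] v nc r mult_left_mono[OF nc(3), of r] mult_left_mono[OF nc(4), of r]
    by (auto simp: m_def)
qed


section \<open>Leaves in complex time\<close>

text \<open>The flow of \<open>leaf_field\<close> for complex time \<open>\<tau>\<close>.\<close>

definition flow :: "nat \<Rightarrow> complex \<Rightarrow> complex \<times> complex \<Rightarrow> complex \<times> complex" where
  "flow n \<tau> z = (exp (of_nat n * \<tau>) * (fst z + snd z ^ n * \<tau>), exp \<tau> * snd z)"

lemma flow_0 [simp]: "flow n 0 z = z"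
  by (simp add: flow_def)

lemma flow_add: "flow n (\<sigma> + \<tau>) z = flow n \<sigma> (flow n \<tau> z)"
proof -
  have "(exp \<tau> * snd z) ^ n = exp (of_nat n * \<tau>) * snd z ^ n"
    by (simp add: power_mult_distrib exp_of_nat_mult)
  then show ?thesis by (simp add: flow_def exp_add exp_of_nat_mult exp_of_nat2_mult algebra_simps)
qed

lemma flow_has_vector_derivative:
  assumes "(\<tau> has_vector_derivative d) (at t within S)"
  shows "((\<lambda>t. flow n (\<tau> t) z) has_vector_derivative cscale d (leaf_field n (flow n (\<tau> t) z))) (at t within S)"
proof -
  have pw: "(exp (\<tau> t) * snd z) ^ n = exp (of_nat n * \<tau> t) * snd z ^ n"
    by (simp add: power_mult_distrib exp_of_nat_mult)
  have "((\<lambda>x. exp (of_nat n * x) * (fst z + snd z ^ n * x)) has_field_derivative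
      fst (leaf_field n (flow n (\<tau> t) z))) (at (\<tau> t) within \<tau> ` S)"
  proof -
    have "((\<lambda>x. exp (of_nat n * x) * (fst z + snd z ^ n * x)) has_field_derivative
        exp (of_nat n * \<tau> t) * of_nat n * (fst z + snd z ^ n * \<tau> t) + exp (of_nat n * \<tau> t) * snd z ^ n)
        (at (\<tau> t) within \<tau> ` S)"
      by (rule derivative_eq_intros refl | simp)+
    also have "exp (of_nat n * \<tau> t) * of_nat n * (fst z + snd z ^ n * \<tau> t) + exp (of_nat n * \<tau> t) * snd z ^ n
        = fst (leaf_field n (flow n (\<tau> t) z))"
    proof -
      define E where "E = exp (of_nat n * \<tau> t)"
      have "fst (leaf_field n (flow n (\<tau> t) z)) = of_nat n * (E * (fst z + snd z ^ n * \<tau> t)) + E * snd z ^ n"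
        by (simp only: leaf_field_def flow_def fst_conv snd_conv pw E_def)
      then show ?thesis unfolding E_def[symmetric] by (simp add: algebra_simps)
    qed
    finally show ?thesis .
  qed
  from field_vector_diff_chain_within[OF assms this]
  have 1: "((\<lambda>t. fst (flow n (\<tau> t) z)) has_vector_derivative d * fst (leaf_field n (flow n (\<tau> t) z))) (at t within S)"
    by (simp add: o_def flow_def)
  have "((\<lambda>x. exp x * snd z) has_field_derivative snd (leaf_field n (flow n (\<tau> t) z))) (at (\<tau> t) within \<tau> ` S)"
    by (auto intro!: derivative_eq_intros simp: leaf_field_def flow_def)
  from field_vector_diff_chain_within[OF assms this]
  have 2: "((\<lambda>t. snd (flow n (\<tau> t) z)) has_vector_derivative d * snd (leaf_field n (flow n (\<tau> t) z))) (at t within S)"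
    by (simp add: o_def flow_def)
  show ?thesis using has_vector_derivative_Pair[OF 1 2] by (simp add: cscale_def)
qed

text \<open>The modulus of the first coordinate at the point of the disc with second coordinate \<open>s\<close>.\<close>

definition rho :: "complex \<Rightarrow> real" where
  "rho s = sqrt (1 - (norm s)\<^sup>2)"

definition disc_pt :: "real \<Rightarrow> complex \<Rightarrow> complex \<times> complex" where
  "disc_pt \<theta> s = (of_real (rho s) * cis \<theta>, s)"

lemma rho_pos: "norm s < 1 \<Longrightarrow> rho s > 0" "norm s < 1 \<Longrightarrow> (rho s)\<^sup>2 = 1 - (norm s)\<^sup>2"
proof -
  assume "norm s < 1"
  then have "(norm s)\<^sup>2 < 1" by (simp add: power_less_one_iff abs_square_less_1)
  then show "rho s > 0" "(rho s)\<^sup>2 = 1 - (norm s)\<^sup>2" by (simp_all add: rho_def)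
qed

lemma disc_pt_in_disc: "norm s < 1 \<Longrightarrow> disc_pt \<theta> s \<in> disc \<theta>"
  using rho_pos[of s] norm_pair_sq[of "disc_pt \<theta> s"]
  by (simp add: disc_def disc_pt_def norm_mult) (metis norm_ge_zero one_power2 power2_eq_imp_eq zero_le_one)

lemma in_discD:
  assumes "p \<in> disc \<theta>" shows "norm (snd p) < 1" "p = disc_pt \<theta> (snd p)"
proof -
  show "norm (snd p) < 1" using assms by (simp add: disc_def)
  have "norm p = 1" and e: "fst p = of_real (norm (fst p)) * cis \<theta>" using assms by (auto simp: disc_def)
  then have "(norm (fst p))\<^sup>2 = 1 - (norm (snd p))\<^sup>2" using norm_pair_sq[of p] by simp
  then have "norm (fst p) = rho (snd p)" unfolding rho_def by (metis norm_ge_zero real_sqrt_unique)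
  then show "p = disc_pt \<theta> (snd p)" using e by (simp add: disc_pt_def prod_eq_iff)
qed

text \<open>The first coordinate of \<open>flow n \<tau> (disc_pt \<theta> s)\<close> divided by \<open>e\<^sup>i\<^sup>\<theta> e\<^sup>n\<^sup>\<tau>\<close>; it is close to 1 for small \<open>s\<close>, so
  that its principal logarithm is available.\<close>

definition drift :: "nat \<Rightarrow> real \<Rightarrow> complex \<Rightarrow> complex \<Rightarrow> complex" where
  "drift n \<theta> s \<tau> = of_real (rho s) + cis (- \<theta>) * s ^ n * \<tau>"

text \<open>The squared modulus of the ratio of the second to the first coordinate of \<open>flow n \<tau> (disc_pt \<theta> s)\<close>.\<close>

definition ratio_sq :: "nat \<Rightarrow> real \<Rightarrow> complex \<Rightarrow> complex \<Rightarrow> real" where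
  "ratio_sq n \<theta> s \<tau> = (norm s)\<^sup>2 * exp (- 2 * Re ((of_nat n - 1) * \<tau> + Ln (drift n \<theta> s \<tau>)))"

text \<open>A coordinate on the complex leaf through \<open>disc_pt \<theta> s\<close> adapted to both the sphere and the disc: at the
  point \<open>p\<close> reached at time \<open>\<tau>\<close> its real part is \<open>(1/n) log \<bar>p\<bar>\<close> and its imaginary part is \<open>1/n\<close> times the
  argument of \<open>p\<^sub>1\<close> relative to \<open>\<theta>\<close>, continued along the leaf. So the leaf of the sphere is the imaginary
  axis, and the first return to the disc happens at \<open>2\<pi>i/n\<close>.\<close>

definition log_polar :: "nat \<Rightarrow> real \<Rightarrow> complex \<Rightarrow> complex \<Rightarrow> complex" where
  "log_polar n \<theta> s \<tau> = \<tau> + (Ln (drift n \<theta> s \<tau>) / of_nat n + of_real (ln (1 + ratio_sq n \<theta> s \<tau>) / (2 * real n)))"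

lemma ratio_sq_nonneg: "ratio_sq n \<theta> s \<tau> \<ge> 0"
  by (simp add: ratio_sq_def)

lemma log_polar_0:
  assumes "norm s < 1"
  shows "log_polar n \<theta> s 0 = 0"
proof -
  have r: "rho s > 0" "(rho s)\<^sup>2 = 1 - (norm s)\<^sup>2" using rho_pos assms by auto
  have d: "drift n \<theta> s 0 = of_real (rho s)" by (simp add: drift_def)
  have "ratio_sq n \<theta> s 0 = (norm s)\<^sup>2 * exp (- (2 * ln (rho s)))"
    using r by (simp add: ratio_sq_def d Ln_of_real)
  also have "exp (- (2 * ln (rho s))) = inverse ((rho s)\<^sup>2)"
    using r by (simp add: exp_minus exp_of_nat_mult[of 2, simplified])
  also have "(norm s)\<^sup>2 = 1 - (rho s)\<^sup>2" using r by simp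
  finally have "1 + ratio_sq n \<theta> s 0 = inverse ((rho s)\<^sup>2)"
    using r(1) by (simp add: field_simps)
  then have "ln (1 + ratio_sq n \<theta> s 0) = - (2 * ln (rho s))"
    using r(1) by (simp add: ln_inverse ln_realpow)
  then show ?thesis using r by (simp add: log_polar_def d Ln_of_real)
qed

lemma flow_disc_pt:
  "flow n \<tau> (disc_pt \<theta> s) = (cis \<theta> * (exp (of_nat n * \<tau>) * drift n \<theta> s \<tau>), exp \<tau> * s)"
proof -
  have "cis \<theta> * cis (- \<theta>) = 1" by (simp add: cis_mult)
  have "of_real (rho s) * cis \<theta> + s ^ n * \<tau> = cis \<theta> * (of_real (rho s) + cis (- \<theta>) * s ^ n * \<tau>)"
  proof -
    have "cis \<theta> * (of_real (rho s) + cis (- \<theta>) * s ^ n * \<tau>)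
        = of_real (rho s) * cis \<theta> + (cis \<theta> * cis (- \<theta>)) * (s ^ n * \<tau>)"
      by (simp only: distrib_left mult_ac)
    then show ?thesis using \<open>cis \<theta> * cis (- \<theta>) = 1\<close> by simp
  qed
  then show ?thesis by (simp add: flow_def disc_pt_def drift_def mult_ac)
qed

lemma log_polar_flow:
  assumes n: "n \<ge> 1" and d: "drift n \<theta> s \<tau> \<noteq> 0"
  defines "L \<equiv> flow n \<tau> (disc_pt \<theta> s)"
  shows "fst L \<noteq> 0" "(norm L)\<^sup>2 = exp (2 * real n * Re (log_polar n \<theta> s \<tau>))"
    "fst L = of_real (norm (fst L)) * cis (\<theta> + real n * Im (log_polar n \<theta> s \<tau>))"
proof -
  define A where "A = Ln (drift n \<theta> s \<tau>)"
  define x where "x = of_nat n * \<tau> + A"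
  have dA: "drift n \<theta> s \<tau> = exp A" using d by (simp add: A_def)
  have L: "fst L = cis \<theta> * exp x" "snd L = exp \<tau> * s"
    unfolding L_def flow_disc_pt dA by (simp_all add: x_def exp_add)
  show "fst L \<noteq> 0" using L by simp
  have nk: "of_nat n * log_polar n \<theta> s \<tau> = x + of_real (ln (1 + ratio_sq n \<theta> s \<tau>) / 2)"
    using n by (simp add: log_polar_def x_def A_def field_simps)
  have "real n * Re (log_polar n \<theta> s \<tau>) = Re (of_nat n * log_polar n \<theta> s \<tau>)"
    "real n * Im (log_polar n \<theta> s \<tau>) = Im (of_nat n * log_polar n \<theta> s \<tau>)" by simp_all
  then have re: "real n * Re (log_polar n \<theta> s \<tau>) = Re x + ln (1 + ratio_sq n \<theta> s \<tau>) / 2"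
    and im: "real n * Im (log_polar n \<theta> s \<tau>) = Im x"
    unfolding nk by simp_all
  have hx: "ratio_sq n \<theta> s \<tau> = (norm s)\<^sup>2 * exp (2 * Re \<tau> - 2 * Re x)"
    unfolding ratio_sq_def A_def[symmetric] x_def by (simp add: algebra_simps)
  have "(norm L)\<^sup>2 = (exp (Re x))\<^sup>2 + (exp (Re \<tau>) * norm s)\<^sup>2"
    unfolding norm_pair_sq L by (simp add: norm_mult)
  also have "\<dots> = exp (2 * Re x) * (1 + ratio_sq n \<theta> s \<tau>)"
  proof -
    have "exp (2 * Re x) * exp (2 * Re \<tau> - 2 * Re x) = exp (2 * Re \<tau>)" by (simp flip: exp_add)
    moreover have "exp (2 * Re x) * (1 + ratio_sq n \<theta> s \<tau>)
        = exp (2 * Re x) + (norm s)\<^sup>2 * (exp (2 * Re x) * exp (2 * Re \<tau> - 2 * Re x))"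
      unfolding hx by (simp add: algebra_simps)
    ultimately have "exp (2 * Re x) * (1 + ratio_sq n \<theta> s \<tau>) = exp (2 * Re x) + (norm s)\<^sup>2 * exp (2 * Re \<tau>)"
      by simp
    also have "\<dots> = (exp (Re x))\<^sup>2 + (norm s)\<^sup>2 * (exp (Re \<tau>))\<^sup>2"
      unfolding exp_double ..
    finally show ?thesis by (simp add: power_mult_distrib mult.commute)
  qed
  also have "\<dots> = exp (2 * Re x + ln (1 + ratio_sq n \<theta> s \<tau>))"
    using ratio_sq_nonneg[of n \<theta> s \<tau>] by (simp add: exp_add)
  also have "2 * Re x + ln (1 + ratio_sq n \<theta> s \<tau>) = 2 * real n * Re (log_polar n \<theta> s \<tau>)"
    using re by simp
  finally show "(norm L)\<^sup>2 = exp (2 * real n * Re (log_polar n \<theta> s \<tau>))" .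
  show "fst L = of_real (norm (fst L)) * cis (\<theta> + real n * Im (log_polar n \<theta> s \<tau>))"
    unfolding im L by (simp add: norm_mult cis_mult[symmetric] exp_eq_polar[of x] mult_ac)
qed

lemma flow_in_S3_iff:
  assumes "n \<ge> 1" "drift n \<theta> s \<tau> \<noteq> 0"
  shows "flow n \<tau> (disc_pt \<theta> s) \<in> S3 \<longleftrightarrow> Re (log_polar n \<theta> s \<tau>) = 0"
proof -
  have "flow n \<tau> (disc_pt \<theta> s) \<in> S3 \<longleftrightarrow> (norm (flow n \<tau> (disc_pt \<theta> s)))\<^sup>2 = 1"
    by (simp add: power2_eq_1_iff) (smt (verit) norm_ge_zero)
  then show ?thesis using log_polar_flow(2)[OF assms] assms(1) by simp
qed

text \<open>On the sphere, being in the disc means that the argument of the first coordinate is \<open>\<theta>\<close> modulo \<open>2\<pi>\<close>.\<close>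

lemma flow_in_disc_iff:
  assumes n: "n \<ge> 1" and d: "drift n \<theta> s \<tau> \<noteq> 0"
  shows "flow n \<tau> (disc_pt \<theta> s) \<in> disc \<theta> \<longleftrightarrow>
    Re (log_polar n \<theta> s \<tau>) = 0 \<and> (\<exists>k::int. real n * Im (log_polar n \<theta> s \<tau>) = 2 * pi * k)"
proof -
  define L where "L = flow n \<tau> (disc_pt \<theta> s)"
  define y where "y = real n * Im (log_polar n \<theta> s \<tau>)"
  note k = log_polar_flow[OF n d, folded L_def y_def]
  have sm: "norm (snd L) < 1" if "L \<in> S3"
  proof -
    have "(norm (fst L))\<^sup>2 > 0" using k(1) by simp
    moreover have "(norm (fst L))\<^sup>2 + (norm (snd L))\<^sup>2 = 1" using norm_pair_sq[of L] that by simp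
    ultimately have "(norm (snd L))\<^sup>2 < 1\<^sup>2" unfolding one_power2 by linarith
    then show ?thesis by (rule power2_less_imp_less) simp
  qed
  have "L \<in> disc \<theta> \<longleftrightarrow> L \<in> S3 \<and> fst L = of_real (norm (fst L)) * cis \<theta>"
    using sm by (auto simp: disc_def)
  also have "fst L = of_real (norm (fst L)) * cis \<theta> \<longleftrightarrow>
      of_real (norm (fst L)) * (cis \<theta> * cis y) = of_real (norm (fst L)) * (cis \<theta> * 1)"
    by (subst k(3)) (simp add: cis_mult)
  also have "\<dots> \<longleftrightarrow> cis y = 1" using k(1) by simp
  also have "\<dots> \<longleftrightarrow> (\<exists>k::int. y = 2 * pi * k)"
    unfolding cis_conv_exp exp_eq_1 by (auto simp: mult_ac)
  finally show ?thesis using flow_in_S3_iff[OF n d] by (simp add: L_def y_def)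
qed

text \<open>On the disc of radius \<open>M\<close> in complex time, \<open>log_polar\<close> differs from the identity by a map with Lipschitz
  constant \<open>e\<close>.\<close>

definition tame :: "nat \<Rightarrow> real \<Rightarrow> complex \<Rightarrow> real \<Rightarrow> real \<Rightarrow> bool" where
  "tame n \<theta> s M e \<longleftrightarrow> norm s < 1 \<and> (\<forall>\<tau>\<in>cball 0 M. Re (drift n \<theta> s \<tau>) > 0 \<and>
     (\<exists>D. ((\<lambda>x. log_polar n \<theta> s x - x) has_derivative D) (at \<tau>) \<and> (\<forall>d. norm (D d) \<le> e * norm d)))"

text \<open>The number \<open>b\<close> is the logarithmic derivative of \<open>drift\<close>, and both \<open>b\<close> and \<open>ratio_sq\<close> are small with \<open>s\<close>.\<close>

lemma log_polar_derivative:
  assumes n: "n \<ge> 1" and d: "Re (drift n \<theta> s \<tau>) > 0"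
  defines "b \<equiv> cis (- \<theta>) * s ^ n / drift n \<theta> s \<tau>"
  obtains D where "((\<lambda>x. log_polar n \<theta> s x - x) has_derivative D) (at \<tau>)"
    "\<And>x. norm (D x) \<le> (norm b + ratio_sq n \<theta> s \<tau> * (1 + norm b)) * norm x"
proof -
  have nn: "drift n \<theta> s \<tau> \<notin> \<real>\<^sub>\<le>\<^sub>0"
    using d by (auto simp: complex_nonpos_Reals_iff)
  have "((\<lambda>x. Ln (drift n \<theta> s x)) has_field_derivative b) (at \<tau>)"
    using nn unfolding drift_def b_def by (auto intro!: derivative_eq_intros simp: field_simps)
  then have A: "((\<lambda>x. Ln (drift n \<theta> s x)) has_derivative (\<lambda>x. b * x)) (at \<tau>)"
    by (simp add: has_field_derivative_def)
  define q where "q = ratio_sq n \<theta> s \<tau>"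
  have q0: "q \<ge> 0" by (simp add: q_def ratio_sq_nonneg)
  have "((\<lambda>x. ratio_sq n \<theta> s x) has_derivative (\<lambda>x. q * (- 2 * Re ((of_nat n - 1) * x + b * x)))) (at \<tau>)"
    unfolding ratio_sq_def q_def by (rule derivative_eq_intros A refl | simp add: mult_ac)+
  then have L: "((\<lambda>x. ln (1 + ratio_sq n \<theta> s x)) has_derivative
      (\<lambda>x. q * (- 2 * Re ((of_nat n - 1) * x + b * x)) / (1 + q))) (at \<tau>)"
    using q0 unfolding q_def by (auto intro!: derivative_eq_intros simp: divide_inverse mult_ac)
  define D where "D = (\<lambda>x. b * x / of_nat n + of_real (q * (- 2 * Re ((of_nat n - 1) * x + b * x)) / (1 + q) / (2 * real n)))"
  have "((\<lambda>x. Ln (drift n \<theta> s x) / of_nat n + of_real (ln (1 + ratio_sq n \<theta> s x) / (2 * real n))) has_derivative D) (at \<tau>)"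
    unfolding D_def using n by (intro has_derivative_add has_derivative_of_real bounded_linear.has_derivative[OF bounded_linear_divide] A L)
  then have 1: "((\<lambda>x. log_polar n \<theta> s x - x) has_derivative D) (at \<tau>)"
    by (simp add: log_polar_def)
  have 2: "norm (D x) \<le> (norm b + q * (1 + norm b)) * norm x" for x
  proof -
    have "norm (b * x / of_nat n) = norm b * norm x / n" by (simp add: norm_mult norm_divide)
    also have "\<dots> \<le> norm b * norm x / 1" using n by (intro divide_left_mono) auto
    finally have i: "norm (b * x / of_nat n) \<le> norm b * norm x" by simp
    have "norm (of_real (q * (- 2 * Re ((of_nat n - 1) * x + b * x)) / (1 + q) / (2 * real n)) :: complex)
      = q / (1 + q) * (\<bar>Re ((of_nat n - 1) * x + b * x)\<bar> / n)"
    proof -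
      have "\<bar>q * (- 2 * t) / (1 + q) / (2 * real n)\<bar> = q / (1 + q) * (\<bar>t\<bar> / n)" for t
        using q0 n by (simp add: abs_mult)
      then show ?thesis unfolding norm_of_real .
    qed
    also have "\<dots> \<le> q * ((1 + norm b) * norm x)"
    proof (intro mult_mono)
      show "q / (1 + q) \<le> q" using q0 divide_left_mono[of 1 "1 + q" q] by simp
      have "\<bar>Re ((of_nat n - 1) * x + b * x)\<bar> \<le> norm ((of_nat n - 1) * x + b * x)"
        by (rule abs_Re_le_cmod)
      also have "\<dots> \<le> norm (of_nat n - 1 :: complex) * norm x + norm b * norm x"
        by (metis norm_mult norm_triangle_ineq)
      also have "norm (of_nat n - 1 :: complex) = real n - 1"
        using n by (metis norm_of_nat of_nat_1 of_nat_diff)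
      also have "(real n - 1) * norm x + norm b * norm x \<le> real n * norm x + real n * (norm b * norm x)"
        using n mult_right_mono[of 1 "real n" "norm b * norm x"] by (intro add_mono mult_right_mono) auto
      finally show "\<bar>Re ((of_nat n - 1) * x + b * x)\<bar> / real n \<le> (1 + norm b) * norm x"
        using n by (simp add: field_simps)
    qed (use q0 in auto)
    finally have ii: "norm (of_real (q * (- 2 * Re ((of_nat n - 1) * x + b * x)) / (1 + q) / (2 * real n)) :: complex)
      \<le> q * ((1 + norm b) * norm x)" .
    show ?thesis unfolding D_def using norm_triangle_mono[OF i ii] by (simp add: algebra_simps)
  qed
  show ?thesis using that[OF 1] 2 by (simp add: q_def)
qed

text \<open>On a bounded region of complex time, \<open>b\<close> and \<open>ratio_sq\<close> are bounded by constants times \<open>\<bar>s\<bar>\<close>, whence an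
  explicit radius.\<close>

lemma eventually_tame:
  assumes n: "n \<ge> 1" and M: "M > 0" and e: "e > 0"
  shows "\<forall>\<^sub>F s in nhds 0. tame n \<theta> s M e"
proof -
  \<comment> \<open>The summand \<open>2 ln 2\<close> accounts for the lower bound \<open>1/2\<close> of the modulus of \<open>drift\<close>.\<close>
  define C where "C = exp (2 * (real n * M) + 2 * ln 2)"
  define r where "r = min (1/2) (min (1 / (4 * M)) (e / (2 + 2 * C)))"
  have C: "C > 0" by (simp add: C_def)
  have r: "r > 0" using M e C by (auto simp: r_def intro!: divide_pos_pos add_pos_pos)
  have "tame n \<theta> s M e" if s: "norm s < r" for s
    unfolding tame_def
  proof (intro conjI ballI)
    have s1: "norm s \<le> 1/2" "norm s * M \<le> 1/4" "norm s * (2 + 2 * C) \<le> e"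
      using s M C by (auto simp: r_def field_simps)
    then show n1: "norm s < 1" by simp
    fix \<tau> :: complex assume \<tau>: "\<tau> \<in> cball 0 M"
    have "(norm s)\<^sup>2 \<le> (1/2)\<^sup>2" using s1 by (intro power_mono) auto
    then have "(rho s)\<^sup>2 \<ge> (3/4)\<^sup>2" using rho_pos(2)[OF n1] by (simp add: power2_eq_square)
    then have rho: "rho s \<ge> 3/4" using power2_le_imp_le rho_pos(1)[OF n1] less_imp_le by blast
    have sn: "norm s ^ n \<le> norm s" using power_decreasing[of 1 n "norm s"] n s1 by simp
    have "norm (cis (- \<theta>) * s ^ n * \<tau>) \<le> norm s * M"
      using sn \<tau> unfolding norm_mult norm_power by (auto intro!: mult_mono)
    then have "Re (cis (- \<theta>) * s ^ n * \<tau>) \<ge> - 1/4"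
      using abs_Re_le_cmod[of "cis (- \<theta>) * s ^ n * \<tau>"] s1 by linarith
    then have Re: "Re (drift n \<theta> s \<tau>) \<ge> 1/2" using rho by (simp add: drift_def)
    then show "Re (drift n \<theta> s \<tau>) > 0" by simp
    have nd: "norm (drift n \<theta> s \<tau>) \<ge> 1/2" using Re complex_Re_le_cmod order_trans by blast
    define b where "b = cis (- \<theta>) * s ^ n / drift n \<theta> s \<tau>"
    have "norm b \<le> norm s / (1/2)"
      unfolding b_def norm_divide norm_mult norm_power using sn nd by (intro frac_le) auto
    then have b: "norm b \<le> 2 * norm s" by simp
    have q: "ratio_sq n \<theta> s \<tau> \<le> norm s * C"
      unfolding ratio_sq_def
    proof (intro mult_mono)
      show "(norm s)\<^sup>2 \<le> norm s" using s1 by (simp add: power2_eq_square mult_left_le_one_le)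
      have "\<bar>Re ((of_nat n - 1) * \<tau>)\<bar> \<le> norm ((of_nat n - 1) * \<tau>)"
        by (rule abs_Re_le_cmod)
      also have "\<dots> = (real n - 1) * norm \<tau>" unfolding norm_mult
        using n by (metis norm_of_nat of_nat_1 of_nat_diff)
      also have "\<dots> \<le> real n * M" using \<tau> n M by (intro mult_mono) auto
      finally have i: "\<bar>Re ((of_nat n - 1) * \<tau>)\<bar> \<le> real n * M" .
      have "ln (1/2) \<le> ln (norm (drift n \<theta> s \<tau>))" using nd by (subst ln_le_cancel_iff) auto
      moreover have "Re (Ln (drift n \<theta> s \<tau>)) = ln (norm (drift n \<theta> s \<tau>))"
        using nd by (intro Re_Ln) auto
      ultimately have c: "Re (Ln (drift n \<theta> s \<tau>)) \<ge> - ln 2" by (simp add: ln_div)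
      have lin: "- 2 * (a + b) \<le> 2 * d + 2 * k" if "\<bar>a\<bar> \<le> d" "b \<ge> - k" for a b d k :: real
        using abs_le_D2[OF that(1)] that(2) by (simp add: algebra_simps)
      show "exp (- 2 * Re ((of_nat n - 1) * \<tau> + Ln (drift n \<theta> s \<tau>))) \<le> C"
        unfolding C_def exp_le_cancel_iff plus_complex.sel by (rule lin[OF i c])
    qed auto
    obtain D where D: "((\<lambda>x. log_polar n \<theta> s x - x) has_derivative D) (at \<tau>)"
      "\<And>x. norm (D x) \<le> (norm b + ratio_sq n \<theta> s \<tau> * (1 + norm b)) * norm x"
      using log_polar_derivative[OF n, of \<theta> s \<tau>] \<open>Re (drift n \<theta> s \<tau>) > 0\<close> unfolding b_def[symmetric] by metis
    have "norm b + ratio_sq n \<theta> s \<tau> * (1 + norm b) \<le> 2 * norm s + (norm s * C) * 2"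
      using b q s1 C ratio_sq_nonneg by (intro add_mono mult_mono) auto
    also have "\<dots> \<le> e" using s1(3) by (simp add: algebra_simps)
    finally have "norm b + ratio_sq n \<theta> s \<tau> * (1 + norm b) \<le> e" .
    then show "\<exists>D. ((\<lambda>x. log_polar n \<theta> s x - x) has_derivative D) (at \<tau>) \<and> (\<forall>d. norm (D d) \<le> e * norm d)"
      using D(1) order_trans[OF D(2) mult_right_mono[OF _ norm_ge_zero]] by blast
  qed
  then show ?thesis using r unfolding eventually_nhds_metric by (auto simp: dist_norm)
qed

context
  fixes n \<theta> s M e
  assumes n: "n \<ge> 1" and tame: "tame n \<theta> s M e" and e: "e \<le> 1/4"
begin

lemma tame_drift: "\<tau> \<in> cball 0 M \<Longrightarrow> drift n \<theta> s \<tau> \<noteq> 0"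
  using tame unfolding tame_def by fastforce

lemma tame_norm: "norm s < 1"
  using tame by (simp add: tame_def)

lemma tame_derivative:
  assumes "\<tau> \<in> cball 0 M"
  obtains D where "(log_polar n \<theta> s has_derivative (\<lambda>d. d + D d)) (at \<tau>)" "\<And>d. norm (D d) \<le> e * norm d"
proof -
  obtain D where D: "((\<lambda>x. log_polar n \<theta> s x - x) has_derivative D) (at \<tau>)" "\<And>d. norm (D d) \<le> e * norm d"
    using tame assms unfolding tame_def by blast
  have "((\<lambda>x. x + (log_polar n \<theta> s x - x)) has_derivative (\<lambda>d. d + D d)) (at \<tau>)"
    by (intro has_derivative_add has_derivative_ident D)
  then show ?thesis using that D(2) by simp
qed

lemma log_polar_almost_isometric:
  assumes "x \<in> cball 0 M" "y \<in> cball 0 M"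
  shows "norm (log_polar n \<theta> s x - log_polar n \<theta> s y - (x - y)) \<le> e * norm (x - y)"
proof -
  obtain D where D: "\<And>\<tau>. \<tau> \<in> cball 0 M \<Longrightarrow> ((\<lambda>x. log_polar n \<theta> s x - x) has_derivative D \<tau>) (at \<tau>) \<and> (\<forall>d. norm (D \<tau> d) \<le> e * norm d)"
    using tame unfolding tame_def by metis
  have "norm ((log_polar n \<theta> s x - x) - (log_polar n \<theta> s y - y)) \<le> e * norm (x - y)"
  proof (rule differentiable_bound[of "cball 0 M" _ D])
    show "onorm (D \<tau>) \<le> e" if "\<tau> \<in> cball 0 M" for \<tau>
      using D[OF that] by (intro onorm_le) auto
    show "((\<lambda>x. log_polar n \<theta> s x - x) has_derivative D \<tau>) (at \<tau> within cball 0 M)"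
      if "\<tau> \<in> cball 0 M" for \<tau>
      using D[OF that] has_derivative_at_withinI by blast
  qed (use assms in auto)
  then show ?thesis by (simp add: algebra_simps)
qed

lemma log_polar_almost_identity: "x \<in> cball 0 M \<Longrightarrow> norm (log_polar n \<theta> s x - x) \<le> e * norm x"
  using log_polar_almost_isometric[of x 0] log_polar_0[OF tame_norm] order_trans[OF norm_ge_zero, of x M] by simp

lemma log_polar_inj: "inj_on (log_polar n \<theta> s) (cball 0 M)"
proof (rule inj_onI)
  fix x y assume xy: "x \<in> cball 0 M" "y \<in> cball 0 M" "log_polar n \<theta> s x = log_polar n \<theta> s y"
  have "norm (x - y) \<le> e * norm (x - y)"
    using log_polar_almost_isometric[OF xy(1,2)] xy(3) by (simp add: norm_minus_commute)
  also have "\<dots> \<le> 1/4 * norm (x - y)" using e by (intro mult_right_mono) auto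
  finally show "x = y" by simp
qed

lemma log_polar_cont: "continuous_on (cball 0 M) (log_polar n \<theta> s)"
  by (intro continuous_at_imp_continuous_on ballI) (metis tame_derivative has_derivative_continuous)

text \<open>The equation is a fixed point problem for \<open>y \<mapsto> w - (log_polar y - y)\<close>, which maps the disc of radius \<open>2 \<bar>w\<bar>\<close>
  into itself.\<close>

lemma log_polar_solve:
  assumes w: "2 * norm w \<le> M"
  shows "\<exists>\<tau>\<in>cball 0 (2 * norm w). log_polar n \<theta> s \<tau> = w"
proof (rule brouwer_surjective[of _ _ "{w}"])
  show "continuous_on (cball 0 (2 * norm w)) (log_polar n \<theta> s)"
    using log_polar_cont w by (rule_tac continuous_on_subset) auto
  show "x + (y - log_polar n \<theta> s y) \<in> cball 0 (2 * norm w)"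
    if "x \<in> {w}" "y \<in> cball 0 (2 * norm w)" for x y
  proof -
    have "norm (log_polar n \<theta> s y - y) \<le> e * norm y" using log_polar_almost_identity that w by auto
    also have "\<dots> \<le> 1/4 * (2 * norm w)" using e that by (intro mult_mono) auto
    finally have "norm (w - (log_polar n \<theta> s y - y)) \<le> 2 * norm w"
      using norm_triangle_ineq4[of w "log_polar n \<theta> s y - y"] norm_ge_zero[of w] by linarith
    then show ?thesis using that by (simp add: algebra_simps)
  qed
qed auto

definition log_polar_inv :: "complex \<Rightarrow> complex" where
  "log_polar_inv = inv_into (ball 0 M) (log_polar n \<theta> s)"

lemma log_polar_inv_solves:
  assumes w: "2 * norm w < M"
  shows "log_polar_inv w \<in> ball 0 M" "log_polar n \<theta> s (log_polar_inv w) = w" "norm (log_polar_inv w) \<le> 2 * norm w"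
proof -
  obtain \<tau> where \<tau>: "\<tau> \<in> cball 0 (2 * norm w)" "log_polar n \<theta> s \<tau> = w"
    using log_polar_solve w by force
  then have t: "\<tau> \<in> ball 0 M" using w by auto
  have "log_polar_inv w = \<tau>"
    unfolding log_polar_inv_def \<tau>(2)[symmetric] using t
    by (intro inv_into_f_f inj_on_subset[OF log_polar_inj]) auto
  then show "log_polar_inv w \<in> ball 0 M" "log_polar n \<theta> s (log_polar_inv w) = w" "norm (log_polar_inv w) \<le> 2 * norm w"
    using \<tau> t by auto
qed

text \<open>The inequality says that the derivative of the inverse moves \<open>d\<close> only a little.\<close>

lemma log_polar_inv_derivative:
  assumes w: "2 * norm w < M"
  obtains g where "(log_polar_inv has_derivative g) (at w)" "\<And>d. norm (g d - d) \<le> e * norm (g d)"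
proof -
  define \<tau> where "\<tau> = log_polar_inv w"
  have \<tau>: "\<tau> \<in> ball 0 M" "log_polar n \<theta> s \<tau> = w"
    using log_polar_inv_solves[OF w] by (auto simp: \<tau>_def)
  obtain D where D: "(log_polar n \<theta> s has_derivative (\<lambda>d. d + D d)) (at \<tau>)" "\<And>d. norm (D d) \<le> e * norm d"
    using tame_derivative[of \<tau>] \<tau> by auto
  have lin: "linear (\<lambda>d. d + D d)" using D(1) has_derivative_linear by blast
  have z: "d = 0" if "d + D d = 0" for d
  proof -
    from that
    have "norm d = norm (D d)" by (metis add_eq_0_iff norm_minus_cancel)
    also have "\<dots> \<le> 1/4 * norm d" using D(2)[of d] mult_right_mono[OF e norm_ge_zero[of d]] by linarith
    finally show "d = 0" by simp
  qed
  have "inj (\<lambda>d. d + D d)" using linear_injective_0[OF lin] z by blast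
  then obtain g where g: "linear g" "\<And>x. g x + D (g x) = x"
    using linear_injective_isomorphism[OF lin] by metis
  have "(log_polar_inv has_derivative g) (at (log_polar n \<theta> s \<tau>))"
  proof (rule has_derivative_inverse_strong[where S = "ball 0 M" and f = "log_polar n \<theta> s" and f' = "\<lambda>d. d + D d"])
    show "continuous_on (ball 0 M) (log_polar n \<theta> s)"
      using log_polar_cont by (rule continuous_on_subset) auto
    show "log_polar_inv (log_polar n \<theta> s x) = x" if "x \<in> ball 0 M" for x
      unfolding log_polar_inv_def using that by (intro inv_into_f_f inj_on_subset[OF log_polar_inj]) auto
    show "(\<lambda>d. d + D d) \<circ> g = id" using g(2) by (auto simp: fun_eq_iff)
  qed (use \<tau> D in auto)
  moreover have "norm (g d - d) \<le> e * norm (g d)" for d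
  proof -
    have "g d - d = - D (g d)" using g(2)[of d] by (simp add: algebra_simps eq_neg_iff_add_eq_0)
    then show ?thesis using D(2)[of "g d"] by simp
  qed
  ultimately show ?thesis using that \<tau>(2) by blast
qed

end


section \<open>The first return to the disc\<close>

definition return_time :: "nat \<Rightarrow> complex" where
  "return_time n = \<i> * of_real (2 * pi / real n)"

lemma norm_return_time: "n \<ge> 1 \<Longrightarrow> 2 * norm (return_time n) \<le> 4 * pi"
  using divide_left_mono[of 1 "real n" "2 * pi"] by (simp add: return_time_def norm_mult norm_divide)

text \<open>Since \<open>radial n z\<close> has positive real part near the circle, the sign of the real factor in
  \<open>positive_leaf_vector_iff\<close> is that of \<open>Im d\<close>.\<close>

lemma positive_leaf_vectorI:
  assumes n: "n \<ge> 1" and z: "z \<in> S3" and small: "norm (snd z) < 1/8"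
    and d: "Re (d * radial n z) = 0" "Im d > 0"
  shows "positive_leaf_vector n z (cscale d (leaf_field n z))"
proof -
  note nc = near_circle[OF n z small]
  define h where "h = radial n z"
  have h0: "h \<noteq> 0" using nc(2) by (simp add: h_def)
  have "norm h > 0" using h0 by simp
  then have "Re h > 0" using nc(3) unfolding h_def[symmetric] by linarith
  have hh: "cnj h * h = of_real ((norm h)\<^sup>2)"
    by (simp add: complex_norm_square mult.commute del: of_real_power)
  define r where "r = Im (d * h) / (norm h)\<^sup>2"
  have "d * h = \<i> * of_real (Im (d * h))" using d(1) by (simp add: complex_eq_iff h_def)
  also have "\<dots> = \<i> * of_real (r * (norm h)\<^sup>2)" using h0 by (simp add: r_def)
  also have "\<dots> = of_real r * \<i> * cnj h * h" unfolding of_real_mult hh[symmetric] by (simp add: mult_ac)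
  finally have e: "d = of_real r * \<i> * cnj h" using h0 by simp
  then have "Im d = r * Re h" by simp
  then have "r > 0" using d(2) \<open>Re h > 0\<close> by (simp add: zero_less_mult_iff)
  then show ?thesis
    using positive_leaf_vector_iff[OF z nc(2)] e unfolding h_def by blast
qed

text \<open>The imaginary axis, pulled back to complex time, moves upwards.\<close>

lemma log_polar_inv_curve_derivative:
  assumes n: "n \<ge> 1" and tame: "tame n \<theta> s M e" and e: "e \<le> 1/4" and t: "2 * \<bar>t\<bar> < M"
  obtains d where "((\<lambda>t. log_polar_inv n \<theta> s M (\<i> * of_real t)) has_vector_derivative d) (at t)" "Im d > 0"
proof -
  have "2 * norm (\<i> * of_real t) < M" using t by (simp add: norm_mult)
  then obtain g where g: "(log_polar_inv n \<theta> s M has_derivative g) (at (\<i> * of_real t))"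
    "\<And>d. norm (g d - d) \<le> e * norm (g d)"
    using log_polar_inv_derivative[OF n tame e] by blast
  have "((\<lambda>t. \<i> * of_real t) has_derivative (\<lambda>x. \<i> * of_real x)) (at t)"
    by (auto intro!: derivative_eq_intros)
  from has_derivative_compose[OF this g(1)]
  have "((\<lambda>t. log_polar_inv n \<theta> s M (\<i> * of_real t)) has_derivative (\<lambda>x. g (\<i> * of_real x))) (at t)" .
  moreover have "g (\<i> * of_real x) = x *\<^sub>R g \<i>" for x
  proof -
    have "\<i> * of_real x = x *\<^sub>R \<i>" by (simp add: scaleR_conv_of_real)
    then show ?thesis using linear_scale[OF has_derivative_linear[OF g(1)]] by simp
  qed
  ultimately have "((\<lambda>t. log_polar_inv n \<theta> s M (\<i> * of_real t)) has_vector_derivative g \<i>) (at t)"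
    by (simp add: has_vector_derivative_def)
  moreover have "Im (g \<i>) > 0"
  proof -
    have "norm (g \<i> - \<i>) \<le> 1/4 * norm (g \<i>)"
      using g(2)[of \<i>] mult_right_mono[OF e norm_ge_zero[of "g \<i>"]] by linarith
    moreover have "norm (g \<i>) \<le> norm (g \<i> - \<i>) + 1"
      using norm_triangle_sub[of "g \<i>" \<i>] by simp
    moreover have "\<bar>Im (g \<i> - \<i>)\<bar> \<le> norm (g \<i> - \<i>)" by (rule abs_Im_le_cmod)
    ultimately show ?thesis by simp
  qed
  ultimately show ?thesis using that by blast
qed

text \<open>The pulled back imaginary axis, moved by the flow, is a curve on the sphere, and its argument \<open>\<theta> + n t\<close>
  shows that it first returns to the disc at \<open>t = 2\<pi>/n\<close>.\<close>

lemma first_return_exists: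
  assumes n: "n \<ge> 1" and tame: "tame n \<theta> s M e" and e: "e \<le> 1/4"
    and M: "M > 4 * pi" and small: "norm s * exp M < 1/8"
  shows "first_return n \<theta> (disc_pt \<theta> s) (flow n (log_polar_inv n \<theta> s M (return_time n)) (disc_pt \<theta> s))"
proof -
  define \<tau> where "\<tau> = (\<lambda>t. log_polar_inv n \<theta> s M (\<i> * of_real t))"
  define \<gamma> where "\<gamma> = (\<lambda>t. flow n (\<tau> t) (disc_pt \<theta> s))"
  define T where "T = 2 * pi / n"
  note K = log_polar_inv_solves[OF n tame e]
  have s1: "norm s < 1" using tame_norm[OF n tame e] .
  have "2 * pi / n \<le> 2 * pi / 1" using n by (intro divide_left_mono) auto
  then have T: "T > 0" "2 * T < M" using n M by (auto simp: T_def)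
  have \<tau>: "\<tau> t \<in> ball 0 M" "log_polar n \<theta> s (\<tau> t) = \<i> * of_real t"
    if "2 * \<bar>t\<bar> < M" for t
    using K[of "\<i> * of_real t"] that by (auto simp: \<tau>_def norm_mult)
  have dr: "drift n \<theta> s (\<tau> t) \<noteq> 0" if "2 * \<bar>t\<bar> < M" for t
    using \<tau>(1)[OF that] by (intro tame_drift[OF n tame e]) auto
  have S: "\<gamma> t \<in> S3" if "2 * \<bar>t\<bar> < M" for t
    unfolding \<gamma>_def flow_in_S3_iff[OF n dr[OF that]] \<tau>(2)[OF that] by simp
  have disc_iff: "\<gamma> t \<in> disc \<theta> \<longleftrightarrow> (\<exists>k::int. real n * t = 2 * pi * k)"
    if "2 * \<bar>t\<bar> < M" for t
    unfolding \<gamma>_def flow_in_disc_iff[OF n dr[OF that]] \<tau>(2)[OF that] by simp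
  have snd_small: "norm (snd (\<gamma> t)) < 1/8" if "2 * \<bar>t\<bar> < M" for t
  proof -
    have "Re (\<tau> t) \<le> M" using \<tau>(1)[OF that] complex_Re_le_cmod[of "\<tau> t"] by simp
    then have "norm (snd (\<gamma> t)) \<le> exp M * norm s"
      unfolding \<gamma>_def flow_disc_pt by (simp add: norm_mult mult_right_mono)
    then show ?thesis using small by (simp add: mult.commute)
  qed
  have vec: "\<exists>v. (\<gamma> has_vector_derivative v) (at t) \<and> positive_leaf_vector n (\<gamma> t) v"
    if t: "2 * \<bar>t\<bar> < M" for t
  proof -
    obtain d where d: "(\<tau> has_vector_derivative d) (at t)" "Im d > 0"
      using log_polar_inv_curve_derivative[OF n tame e t] unfolding \<tau>_def by blast
    define v where "v = cscale d (leaf_field n (\<gamma> t))"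
    have v: "(\<gamma> has_vector_derivative v) (at t)"
      using flow_has_vector_derivative[OF d(1)] unfolding v_def \<gamma>_def .
    \<comment> \<open>Tangency to the sphere comes for free: the norm is constant along the curve.\<close>
    have "((\<lambda>t. inner (\<gamma> t) (\<gamma> t)) has_derivative (\<lambda>h. inner (\<gamma> t) (h *\<^sub>R v) + inner (h *\<^sub>R v) (\<gamma> t))) (at t)"
      using v unfolding has_vector_derivative_def by (intro has_derivative_inner)
    then have "((\<lambda>t. inner (\<gamma> t) (\<gamma> t)) has_real_derivative 2 * inner (\<gamma> t) v) (at t)"
      unfolding has_field_derivative_def by (rule has_derivative_eq_rhs) (simp add: fun_eq_iff inner_commute)
    moreover have "((\<lambda>t. inner (\<gamma> t) (\<gamma> t)) has_real_derivative 0) (at t)"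
    proof (rule has_field_derivative_transform_within_open[of "\<lambda>_. 1"])
      show "open {-M/2<..<M/2}" "t \<in> {-M/2<..<M/2}" using t by auto
      show "1 = inner (\<gamma> x) (\<gamma> x)" if "x \<in> {-M/2<..<M/2}" for x
        using S[of x] that by (auto simp: dot_square_norm)
    qed auto
    ultimately have "inner (\<gamma> t) v = 0" using DERIV_unique by fastforce
    then have "Re (d * radial n (\<gamma> t)) = 0" unfolding v_def inner_cscale_leaf_field .
    then have "positive_leaf_vector n (\<gamma> t) v"
      unfolding v_def by (intro positive_leaf_vectorI[OF n S[OF t] snd_small[OF t]] d)
    then show ?thesis using v by blast
  qed
  have "leaf_curve n T \<gamma>"
    unfolding leaf_curve_def
  proof (intro ballI conjI)
    fix t assume "t \<in> {0..T}"
    then have t: "2 * \<bar>t\<bar> < M" using T by auto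
    show "\<gamma> t \<in> S3" by (rule S[OF t])
    show "\<exists>v. (\<gamma> has_vector_derivative v) (at t within {0..T}) \<and> positive_leaf_vector n (\<gamma> t) v"
      using vec[OF t] has_vector_derivative_at_within by blast
  qed
  moreover have "\<gamma> 0 = disc_pt \<theta> s"
    using K(3)[of 0] M pi_gt_zero by (simp add: \<gamma>_def \<tau>_def)
  moreover have "\<gamma> T \<in> disc \<theta>"
    using T n disc_iff[of T] by (auto simp: T_def intro!: exI[of _ 1])
  moreover have "\<gamma> t \<notin> disc \<theta>" if t: "t \<in> {0<..<T}" for t
  proof
    assume "\<gamma> t \<in> disc \<theta>"
    then obtain k :: int where k: "real n * t = 2 * pi * k" using disc_iff[of t] t T by auto
    have "0 < real n * t" "real n * t < 2 * pi" using t n by (auto simp: T_def field_simps)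
    then have "0 < real_of_int k" "real_of_int k < 1" unfolding k by (simp_all add: zero_less_mult_iff)
    then show False by simp
  qed
  ultimately show ?thesis
    using T disc_pt_in_disc[OF s1, of \<theta>]
    unfolding first_return_def by (auto simp: \<gamma>_def \<tau>_def T_def return_time_def intro!: exI[of _ T] exI[of _ \<gamma>])
qed

lemma bound_on_closed_interval:
  fixes f :: "real \<Rightarrow> real"
  assumes "continuous_on {a..b} f" "a < b" "t \<in> {a..b}"
  shows "(\<And>x. a < x \<Longrightarrow> x < b \<Longrightarrow> f x \<le> c) \<Longrightarrow> f t \<le> c" "(\<And>x. a < x \<Longrightarrow> x < b \<Longrightarrow> c \<le> f x) \<Longrightarrow> c \<le> f t"
  using continuous_le_on_closure[of "{a<..<b}" f t c] continuous_ge_on_closure[of "{a<..<b}" f t c] assms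
  by auto

text \<open>An arbitrary leaf curve from the disc back to the disc. Only differentiability is known of its
  parametrisation, so comparisons have to go through monotone quantities instead of integrals of
  the velocity.\<close>

context
  fixes n :: nat and \<theta> T :: real and s :: complex and \<gamma> :: "real \<Rightarrow> complex \<times> complex"
  assumes n: "n \<ge> 1" and T: "T > 0" and curve: "leaf_curve n T \<gamma>" and start: "\<gamma> 0 = disc_pt \<theta> s"
    and avoid: "\<And>t. 0 < t \<Longrightarrow> t < T \<Longrightarrow> \<gamma> t \<notin> disc \<theta>"
begin

lemma leaf_curve_continuous: "continuous_on {0..T} \<gamma>"
  using curve unfolding leaf_curve_def
  by (auto simp: continuous_on_eq_continuous_within intro: has_vector_derivative_continuous)

lemma leaf_curve_S3: "t \<in> {0..T} \<Longrightarrow> \<gamma> t \<in> S3"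
  using curve by (simp add: leaf_curve_def)

lemma leaf_curve_velocity:
  assumes "t \<in> {0..T}" "norm (snd (\<gamma> t)) < 1/8"
  obtains m where "(\<gamma> has_vector_derivative cscale m (leaf_field n (\<gamma> t))) (at t within {0..T})"
    "m \<noteq> 0" "norm m \<le> 4 * Im (m * fst (leaf_field n (\<gamma> t)) / fst (\<gamma> t))" "Im m \<ge> 3/4 * norm m"
proof -
  obtain v where v: "(\<gamma> has_vector_derivative v) (at t within {0..T})" "positive_leaf_vector n (\<gamma> t) v"
    using curve assms(1) unfolding leaf_curve_def by blast
  obtain m where "v = cscale m (leaf_field n (\<gamma> t))" "m \<noteq> 0" "norm m \<le> 4 * Im (fst v / fst (\<gamma> t))" "Im m \<ge> 3/4 * norm m"
    using leaf_vector_near_circle[OF n leaf_curve_S3[OF assms(1)] assms(2) v(2)] by blast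
  then show ?thesis using that v(1) by (simp add: cscale_def)
qed

text \<open>The argument of \<open>z\<^sub>1\<close> relative to \<open>\<theta> + \<pi>\<close>. The branch cut lies along the disc, which the curve avoids
  between its end points, so \<open>phase\<close> stays in \<open>(- \<pi>, \<pi>)\<close> without any lifting.\<close>

definition phase :: "real \<Rightarrow> real" where
  "phase t = Im (Ln (- fst (\<gamma> t) / cis \<theta>))"

lemma not_in_disc:
  assumes t: "0 < t" "t < T" and small: "norm (snd (\<gamma> t)) < 1/8"
  shows "- fst (\<gamma> t) / cis \<theta> \<notin> \<real>\<^sub>\<le>\<^sub>0"
proof
  assume "- fst (\<gamma> t) / cis \<theta> \<in> \<real>\<^sub>\<le>\<^sub>0"
  then obtain r where r: "- fst (\<gamma> t) / cis \<theta> = of_real r" "r \<le> 0"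
    by (meson nonpos_Reals_cases)
  then have "- fst (\<gamma> t) = of_real r * cis \<theta>" by (simp add: field_simps)
  then have e: "fst (\<gamma> t) = of_real (- r) * cis \<theta>"
    by (metis add.inverse_inverse mult_minus_left of_real_minus)
  then have "norm (fst (\<gamma> t)) = - r" using r(2) by (simp add: norm_mult)
  then have "\<gamma> t \<in> disc \<theta>" using e small leaf_curve_S3[of t] t by (simp add: disc_def)
  then show False using avoid t by blast
qed

lemma phase_bound:
  assumes t: "0 < t" "t < T" and small: "norm (snd (\<gamma> t)) < 1/8"
  shows "\<bar>phase t\<bar> < pi"
proof -
  have "- fst (\<gamma> t) / cis \<theta> \<noteq> 0"
    using not_in_disc[OF assms] by auto
  then have "- pi < phase t" "phase t \<le> pi" unfolding phase_def by (rule mpi_less_Im_Ln, rule Im_Ln_le_pi)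
  moreover have "phase t \<noteq> pi"
    using not_in_disc[OF assms] \<open>- fst (\<gamma> t) / cis \<theta> \<noteq> 0\<close> unfolding phase_def
    by (metis Im_Ln_eq_pi complex_nonpos_Reals_iff less_imp_le)
  ultimately show ?thesis by linarith
qed

lemma interior_velocity:
  assumes t: "0 < t" "t < T" and small: "norm (snd (\<gamma> t)) < 1/8"
  obtains m p where "(\<gamma> has_vector_derivative cscale m (leaf_field n (\<gamma> t))) (at t)"
    "(phase has_real_derivative p) (at t)" "norm m \<le> 4 * p" "m \<noteq> 0" "Im m \<ge> 3/4 * norm m"
proof -
  obtain m where m: "(\<gamma> has_vector_derivative cscale m (leaf_field n (\<gamma> t))) (at t within {0..T})"
    "m \<noteq> 0" "norm m \<le> 4 * Im (m * fst (leaf_field n (\<gamma> t)) / fst (\<gamma> t))" "Im m \<ge> 3/4 * norm m"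
    using leaf_curve_velocity[OF _ small] t by auto
  define f where "f = m * fst (leaf_field n (\<gamma> t))"
  have at: "at t within {0..T} = at t" using t by (simp add: at_within_Icc_at)
  have d: "(\<gamma> has_vector_derivative cscale m (leaf_field n (\<gamma> t))) (at t)"
    using m(1) unfolding at .
  have nn: "- fst (\<gamma> t) / cis \<theta> \<notin> \<real>\<^sub>\<le>\<^sub>0"
    by (rule not_in_disc[OF assms])
  have f0: "fst (\<gamma> t) \<noteq> 0" using nn by auto
  have "((\<lambda>t. fst (\<gamma> t)) has_vector_derivative f) (at t)"
    using bounded_linear.has_vector_derivative[OF bounded_linear_fst d] by (simp add: cscale_def f_def)
  moreover have "((\<lambda>x. Ln (- x / cis \<theta>)) has_field_derivative (1 / fst (\<gamma> t))) (at (fst (\<gamma> t)) within range (\<lambda>t. fst (\<gamma> t)))"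
    using nn f0 by (auto intro!: derivative_eq_intros simp: field_simps)
  ultimately have "((\<lambda>t. Ln (- fst (\<gamma> t) / cis \<theta>)) has_vector_derivative f * (1 / fst (\<gamma> t))) (at t)"
    using field_vector_diff_chain_within unfolding o_def by blast
  then have "(phase has_vector_derivative Im (f * (1 / fst (\<gamma> t)))) (at t)"
    using bounded_linear.has_vector_derivative[OF bounded_linear_Im] unfolding phase_def by blast
  then have "(phase has_real_derivative Im (f / fst (\<gamma> t))) (at t)"
    by (simp add: has_real_derivative_iff_has_vector_derivative)
  then show ?thesis using that[OF d] m(2-4) unfolding f_def by blast
qed

text \<open>The quantities \<open>\<bar>z\<^sub>2\<bar>\<^sup>2 exp (\<plusminus> 8 phase)\<close> are monotone, as the logarithmic derivative of \<open>\<bar>z\<^sub>2\<bar>\<^sup>2\<close> is at most 8 times the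
  angular velocity; and \<open>phase\<close> varies by at most \<open>2\<pi>\<close>. The lower bound serves to keep \<open>z\<^sub>2\<close> away from 0.\<close>

lemma snd_growth:
  assumes ab: "0 < a" "a \<le> b" "b < T" and small: "\<And>t. a \<le> t \<Longrightarrow> t \<le> b \<Longrightarrow> norm (snd (\<gamma> t)) < 1/8"
  shows "norm (snd (\<gamma> b)) \<le> exp (8 * pi) * norm (snd (\<gamma> a))" "norm (snd (\<gamma> a)) \<le> exp (8 * pi) * norm (snd (\<gamma> b))"
proof -
  have deriv: "\<exists>y. ((\<lambda>t. (norm (snd (\<gamma> t)))\<^sup>2 * exp (c * phase t)) has_real_derivative y) (at t) \<and> c * y \<ge> 0"
    if t: "a \<le> t" "t \<le> b" and c: "\<bar>c\<bar> = 8" for t c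
  proof -
    obtain m p where m: "(\<gamma> has_vector_derivative cscale m (leaf_field n (\<gamma> t))) (at t)"
      "(phase has_real_derivative p) (at t)" "norm m \<le> 4 * p"
      using interior_velocity[OF _ _ small[OF t]] t ab by (metis le_less_trans less_le_trans)
    define w where "w = snd (\<gamma> t)"
    have "((\<lambda>t. snd (\<gamma> t)) has_vector_derivative m * w) (at t)"
      using bounded_linear.has_vector_derivative[OF bounded_linear_snd m(1)] by (simp add: cscale_def leaf_field_def w_def)
    then have "((\<lambda>t. inner (snd (\<gamma> t)) (snd (\<gamma> t))) has_derivative (\<lambda>h. inner w (h *\<^sub>R (m * w)) + inner (h *\<^sub>R (m * w)) w)) (at t)"
      unfolding has_vector_derivative_def w_def by (intro has_derivative_inner)
    moreover have "(\<lambda>h. inner w (h *\<^sub>R (m * w)) + inner (h *\<^sub>R (m * w)) w) = (*) (2 * Re m * (norm w)\<^sup>2)"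
    proof -
      have "(norm w)\<^sup>2 = Re w * Re w + Im w * Im w" by (metis cmod_power2 power2_eq_square)
      then show ?thesis by (simp add: fun_eq_iff inner_complex_def algebra_simps)
    qed
    ultimately have "((\<lambda>t. (norm (snd (\<gamma> t)))\<^sup>2) has_real_derivative 2 * Re m * (norm w)\<^sup>2) (at t)"
      by (simp add: has_field_derivative_def dot_square_norm)
    then have d: "((\<lambda>t. (norm (snd (\<gamma> t)))\<^sup>2 * exp (c * phase t)) has_real_derivative
        (2 * Re m * (norm w)\<^sup>2) * exp (c * phase t) + (exp (c * phase t) * (c * p)) * (norm w)\<^sup>2) (at t)"
      unfolding w_def by (intro DERIV_mult DERIV_fun_exp DERIV_cmult m(2))
    have "c * (2 * Re m + c * p) \<ge> 0"
    proof -
      have "\<bar>c * (2 * Re m)\<bar> \<le> 8 * (2 * (4 * p))"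
        using m(3) abs_Re_le_cmod[of m] c by (simp add: abs_mult)
      moreover have "c * (c * p) = 64 * p"
        using c by (metis abs_mult_self_eq mult.assoc mult_numeral_1 numeral_times_numeral semiring_norm(11) semiring_norm(12) num_double)
      ultimately show ?thesis by (simp only: distrib_left)
    qed
    then have "(c * (2 * Re m + c * p)) * ((norm w)\<^sup>2 * exp (c * phase t)) \<ge> 0" by simp
    then show ?thesis using d by (intro exI conjI) (auto simp: algebra_simps)
  qed
  have ph: "\<bar>phase b - phase a\<bar> \<le> 2 * pi"
    using phase_bound[of a] phase_bound[of b] ab small by fastforce
  have sq: "(norm x)\<^sup>2 \<le> (norm y)\<^sup>2 * exp (8 * (p - q)) \<Longrightarrow> \<bar>p - q\<bar> \<le> 2 * pi \<Longrightarrow> norm x \<le> exp (8 * pi) * norm y"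
    for x y :: complex and p q
  proof -
    assume 1: "(norm x)\<^sup>2 \<le> (norm y)\<^sup>2 * exp (8 * (p - q))" and 2: "\<bar>p - q\<bar> \<le> 2 * pi"
    have "exp (8 * (p - q)) \<le> exp (2 * (8 * pi))" using 2 by simp
    then have "(norm y)\<^sup>2 * exp (8 * (p - q)) \<le> (norm y)\<^sup>2 * exp (2 * (8 * pi))"
      by (intro mult_left_mono) auto
    also have "\<dots> = (exp (8 * pi) * norm y)\<^sup>2"
      by (simp only: exp_double power_mult_distrib mult.commute)
    finally have "(norm x)\<^sup>2 \<le> (exp (8 * pi) * norm y)\<^sup>2" by (rule order_trans[OF 1])
    then show "norm x \<le> exp (8 * pi) * norm y" by (rule power2_le_imp_le) simp
  qed
  have "(norm (snd (\<gamma> b)))\<^sup>2 * exp (- 8 * phase b) \<le> (norm (snd (\<gamma> a)))\<^sup>2 * exp (- 8 * phase a)"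
    using deriv[of _ "-8"] by (intro DERIV_nonpos_imp_nonincreasing[OF ab(2)]) fastforce
  then have "(norm (snd (\<gamma> b)))\<^sup>2 \<le> (norm (snd (\<gamma> a)))\<^sup>2 * exp (8 * (phase b - phase a))"
    by (simp add: exp_minus exp_diff right_diff_distrib field_simps)
  then show "norm (snd (\<gamma> b)) \<le> exp (8 * pi) * norm (snd (\<gamma> a))" using sq ph by blast
  have "(norm (snd (\<gamma> a)))\<^sup>2 * exp (8 * phase a) \<le> (norm (snd (\<gamma> b)))\<^sup>2 * exp (8 * phase b)"
    using deriv[of _ 8] by (intro DERIV_nonneg_imp_nondecreasing[OF ab(2)]) fastforce
  then have "(norm (snd (\<gamma> a)))\<^sup>2 \<le> (norm (snd (\<gamma> b)))\<^sup>2 * exp (8 * (phase b - phase a))"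
    by (simp add: exp_diff right_diff_distrib field_simps)
  then show "norm (snd (\<gamma> a)) \<le> exp (8 * pi) * norm (snd (\<gamma> b))" using sq ph by blast
qed

lemma snd_bounds_from_start:
  assumes b: "0 < b" "b < T" and small: "\<And>t. 0 < t \<Longrightarrow> t \<le> b \<Longrightarrow> norm (snd (\<gamma> t)) < 1/8"
  shows "norm (snd (\<gamma> b)) \<le> exp (8 * pi) * norm s" "norm s \<le> exp (8 * pi) * norm (snd (\<gamma> b))"
proof -
  have s: "snd (\<gamma> 0) = s" by (simp add: start disc_pt_def)
  have cont: "continuous_on {0..b} (\<lambda>t. norm (snd (\<gamma> t)))" "0 \<in> {0..b}"
    using b by (auto intro!: continuous_intros continuous_on_subset[OF leaf_curve_continuous])
  have "norm (snd (\<gamma> 0)) \<le> exp (8 * pi) * norm (snd (\<gamma> b))"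
    using snd_growth(2)[of _ b] b small by (intro bound_on_closed_interval(1)[OF cont(1) b(1) cont(2)]) auto
  then show "norm s \<le> exp (8 * pi) * norm (snd (\<gamma> b))" by (simp add: s)
  have "norm (snd (\<gamma> b)) / exp (8 * pi) \<le> norm (snd (\<gamma> 0))"
    using snd_growth(1)[of _ b] b small
    by (intro bound_on_closed_interval(2)[OF cont(1) b(1) cont(2)]) (auto simp: field_simps)
  then show "norm (snd (\<gamma> b)) \<le> exp (8 * pi) * norm s" by (simp add: s field_simps)
qed

text \<open>At a first time with \<open>\<bar>z\<^sub>2\<bar> \<ge> 1/8\<close> the bound valid up to that time would still give a smaller value.\<close>

lemma leaf_curve_stays_near_circle:
  assumes s: "exp (8 * pi) * norm s < 1/8" and t: "t \<in> {0..T}"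
  shows "norm (snd (\<gamma> t)) \<le> exp (8 * pi) * norm s" "norm s \<le> exp (8 * pi) * norm (snd (\<gamma> t))"
proof -
  have B1: "exp (8 * pi) \<ge> 1" by simp
  have s0: "snd (\<gamma> 0) = s" by (simp add: start disc_pt_def)
  have cont: "continuous_on {0..T} (\<lambda>t. norm (snd (\<gamma> t)))"
    by (intro continuous_intros leaf_curve_continuous)
  have s_le: "norm s \<le> exp (8 * pi) * norm s" using mult_right_mono[OF B1 norm_ge_zero[of s]] by simp
  have small: "norm (snd (\<gamma> t)) < 1/8" if "t \<in> {0..T}" for t
  proof (rule ccontr)
    assume "\<not> norm (snd (\<gamma> t)) < 1/8"
    define Bad where "Bad = {0..T} \<inter> (\<lambda>t. norm (snd (\<gamma> t))) -` {1/8..}"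
    have "Bad \<noteq> {}"
      using that \<open>\<not> norm (snd (\<gamma> t)) < 1/8\<close> by (auto simp: Bad_def)
    moreover have "closed Bad" unfolding Bad_def by (rule continuous_closed_preimage[OF cont]) auto
    then have "compact Bad" unfolding compact_eq_bounded_closed
      by (auto intro: bounded_subset[of "{0..T}"] simp: Bad_def)
    ultimately obtain t1 where t1: "t1 \<in> Bad" "\<And>t. t \<in> Bad \<Longrightarrow> t1 \<le> t"
      using compact_attains_inf by meson
    have "t1 \<noteq> 0" using t1(1) s s_le by (auto simp: Bad_def s0)
    then have t1': "0 < t1" "t1 \<le> T" "norm (snd (\<gamma> t1)) \<ge> 1/8"
      using t1(1) by (auto simp: Bad_def)
    have good: "norm (snd (\<gamma> t)) < 1/8" if "0 < t" "t < t1" for t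
      using t1(2)[of t] that t1' by (force simp: Bad_def)
    have "norm (snd (\<gamma> t1)) \<le> exp (8 * pi) * norm s"
    proof (rule bound_on_closed_interval(1)[OF continuous_on_subset[OF cont] t1'(1)])
      show "norm (snd (\<gamma> x)) \<le> exp (8 * pi) * norm s" if "0 < x" "x < t1" for x
        using that t1' good by (intro snd_bounds_from_start(1)) auto
    qed (use t1' in auto)
    then show False using s t1' by simp
  qed
  show "norm (snd (\<gamma> t)) \<le> exp (8 * pi) * norm s"
    using small by (intro bound_on_closed_interval(1)[OF cont T t] snd_bounds_from_start(1)) auto
  have "norm s / exp (8 * pi) \<le> norm (snd (\<gamma> t))"
  proof (rule bound_on_closed_interval(2)[OF cont T t])
    fix x assume "0 < x" "x < T"
    then show "norm s / exp (8 * pi) \<le> norm (snd (\<gamma> x))"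
      using snd_bounds_from_start(2)[of x] small by (auto simp: field_simps)
  qed
  then show "norm s \<le> exp (8 * pi) * norm (snd (\<gamma> t))" by (simp add: field_simps)
qed

text \<open>Along the flow, \<open>z\<^sub>1 / z\<^sub>2\<^sup>n\<close> increases by exactly the elapsed complex time. So off the Hopf circle the
  complex time of an arbitrary leaf curve can be read off from this quotient, without lifting a path.\<close>

lemma leaf_curve_is_flow:
  assumes s: "exp (8 * pi) * norm s < 1/8" "s \<noteq> 0"
  obtains \<tau> where "\<tau> 0 = 0" "continuous_on {0..T} \<tau>" "\<And>t. t \<in> {0..T} \<Longrightarrow> \<gamma> t = flow n (\<tau> t) (disc_pt \<theta> s)"
    "\<And>t. t \<in> {0..T} \<Longrightarrow> norm (\<tau> t) \<le> 8 * pi"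
    "\<And>t. 0 < t \<Longrightarrow> t < T \<Longrightarrow> \<exists>m. (\<tau> has_vector_derivative m) (at t) \<and> m \<noteq> 0 \<and> Im m \<ge> 3/4 * norm m"
proof -
  note near = leaf_curve_stays_near_circle[OF s(1)]
  have small: "norm (snd (\<gamma> t)) < 1/8" if "t \<in> {0..T}" for t using near(1)[OF that] s(1) by simp
  have z20: "snd (\<gamma> t) \<noteq> 0" if "t \<in> {0..T}" for t using near(2)[OF that] s(2) by auto
  define \<tau> where "\<tau> = (\<lambda>t. fst (\<gamma> t) / snd (\<gamma> t) ^ n - of_real (rho s) * cis \<theta> / s ^ n)"
  have \<tau>0: "\<tau> 0 = 0" by (simp add: \<tau>_def start disc_pt_def)
  have deriv: "(\<tau> has_vector_derivative m) (at t within S)"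
    if m: "(\<gamma> has_vector_derivative cscale m (leaf_field n (\<gamma> t))) (at t within S)" and t: "t \<in> {0..T}" for m t S
  proof -
    define w where "w = snd (\<gamma> t)"
    define u where "u = fst (\<gamma> t)"
    have w0: "w \<noteq> 0" using z20[OF t] by (simp add: w_def)
    obtain k where k: "n = Suc k" using n by (cases n) auto
    have 2: "((\<lambda>t. snd (\<gamma> t)) has_derivative (\<lambda>x. of_real x * (m * w))) (at t within S)"
      using bounded_linear.has_vector_derivative[OF bounded_linear_snd m]
      by (simp add: cscale_def leaf_field_def w_def has_vector_derivative_def scaleR_conv_of_real)
    have 1: "((\<lambda>t. fst (\<gamma> t)) has_derivative (\<lambda>x. of_real x * (m * (of_nat n * u + w ^ n)))) (at t within S)"
      using bounded_linear.has_vector_derivative[OF bounded_linear_fst m]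
      by (simp add: cscale_def leaf_field_def w_def u_def has_vector_derivative_def scaleR_conv_of_real)
    have 3: "((\<lambda>t. snd (\<gamma> t) ^ n) has_derivative (\<lambda>x. of_nat n * (of_real x * (m * w)) * w ^ (n - 1))) (at t within S)"
      using has_derivative_power[OF 2, of n] by (simp add: w_def)
    have "(\<tau> has_derivative (\<lambda>x. (of_real x * (m * (of_nat n * u + w ^ n)) * w ^ n - u * (of_nat n * (of_real x * (m * w)) * w ^ (n - 1))) / (w ^ n * w ^ n) - 0)) (at t within S)"
      unfolding \<tau>_def w_def u_def
      by (intro has_derivative_diff has_derivative_const has_derivative_divide'[OF 1 3, unfolded w_def u_def]) (use z20[OF t] in simp)
    moreover have "(of_real x * (m * (of_nat n * u + w ^ n)) * w ^ n - u * (of_nat n * (of_real x * (m * w)) * w ^ (n - 1))) / (w ^ n * w ^ n) - 0 = x *\<^sub>R m" for x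
    proof -
      have "of_real x * (m * (of_nat n * u + w ^ n)) * w ^ n - u * (of_nat n * (of_real x * (m * w)) * w ^ (n - 1))
          = (of_real x * m) * (w ^ n * w ^ n)"
        unfolding k by (simp add: algebra_simps)
      then show ?thesis using w0 by (simp add: scaleR_conv_of_real)
    qed
    ultimately show ?thesis by (simp add: has_vector_derivative_def)
  qed
  have within: "\<exists>m. (\<tau> has_vector_derivative m) (at t within {0..T}) \<and> ((\<lambda>t. snd (\<gamma> t)) has_vector_derivative m * snd (\<gamma> t)) (at t within {0..T})"
    if t: "t \<in> {0..T}" for t
  proof -
    obtain m where m: "(\<gamma> has_vector_derivative cscale m (leaf_field n (\<gamma> t))) (at t within {0..T})"
      using leaf_curve_velocity[OF t small[OF t]] by blast
    then show ?thesis using deriv[OF m t] bounded_linear.has_vector_derivative[OF bounded_linear_snd m]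
      by (auto simp: cscale_def leaf_field_def)
  qed
  have cont: "continuous_on {0..T} \<tau>"
    unfolding continuous_on_eq_continuous_within using within has_vector_derivative_continuous by blast
  obtain c where const: "\<And>t. t \<in> {0..T} \<Longrightarrow> snd (\<gamma> t) * exp (- \<tau> t) = c"
  proof (rule has_vector_derivative_zero_constant[of "{0..T}" "\<lambda>t. snd (\<gamma> t) * exp (- \<tau> t)"])
    fix t assume t: "t \<in> {0..T}"
    obtain m where m: "(\<tau> has_vector_derivative m) (at t within {0..T})"
      "((\<lambda>t. snd (\<gamma> t)) has_vector_derivative m * snd (\<gamma> t)) (at t within {0..T})"
      using within[OF t] by blast
    have "((\<lambda>x. exp (- x)) has_field_derivative - exp (- \<tau> t)) (at (\<tau> t) within \<tau> ` {0..T})"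
      by (auto intro!: derivative_eq_intros)
    from field_vector_diff_chain_within[OF m(1) this]
    have "((\<lambda>t. exp (- \<tau> t)) has_vector_derivative m * - exp (- \<tau> t)) (at t within {0..T})"
      by (simp add: o_def)
    from has_vector_derivative_mult[OF m(2) this]
    show "((\<lambda>t. snd (\<gamma> t) * exp (- \<tau> t)) has_vector_derivative 0) (at t within {0..T})"
      by (simp add: algebra_simps)
  qed auto
  then have snd_eq: "snd (\<gamma> t) = exp (\<tau> t) * s" if "t \<in> {0..T}" for t
  proof -
    have "snd (\<gamma> t) * exp (- \<tau> t) = snd (\<gamma> 0) * exp (- \<tau> 0)"
      using const[OF that] const[of 0] T by simp
    then show ?thesis by (simp add: \<tau>0 start disc_pt_def exp_minus field_simps)
  qed
  have flow: "\<gamma> t = flow n (\<tau> t) (disc_pt \<theta> s)" if t: "t \<in> {0..T}" for t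
  proof -
    have "fst (\<gamma> t) = snd (\<gamma> t) ^ n * (\<tau> t + of_real (rho s) * cis \<theta> / s ^ n)"
      using z20[OF t] by (simp add: \<tau>_def)
    also have "\<dots> = exp (\<tau> t) ^ n * (s ^ n * (\<tau> t + of_real (rho s) * cis \<theta> / s ^ n))"
      unfolding snd_eq[OF t] by (simp add: power_mult_distrib)
    also have "s ^ n * (\<tau> t + of_real (rho s) * cis \<theta> / s ^ n) = of_real (rho s) * cis \<theta> + s ^ n * \<tau> t"
      using s(2) by (simp add: distrib_left)
    finally show ?thesis using snd_eq[OF t] by (simp add: flow_def disc_pt_def prod_eq_iff exp_of_nat_mult)
  qed
  have int: "\<exists>m p. (\<tau> has_vector_derivative m) (at t) \<and> (phase has_real_derivative p) (at t) \<and> norm m \<le> 4 * p \<and> m \<noteq> 0 \<and> Im m \<ge> 3/4 * norm m"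
    if t: "0 < t" "t < T" for t
  proof -
    have t': "t \<in> {0..T}" using t by simp
    obtain m p where "(\<gamma> has_vector_derivative cscale m (leaf_field n (\<gamma> t))) (at t)"
      "(phase has_real_derivative p) (at t)" "norm m \<le> 4 * p" "m \<noteq> 0" "Im m \<ge> 3/4 * norm m"
      using interior_velocity[OF t small[OF t']] by blast
    then show ?thesis using deriv[OF _ t', of m UNIV] by blast
  qed
  have increment: "norm (\<tau> b - \<tau> a) \<le> 8 * pi" if ab: "0 < a" "a < b" "b < T" for a b
  proof -
    obtain m p where mp: "\<And>t. 0 < t \<Longrightarrow> t < T \<Longrightarrow> (\<tau> has_vector_derivative m t) (at t) \<and> (phase has_real_derivative p t) (at t) \<and> norm (m t) \<le> 4 * p t"
      using int by metis
    have "norm (\<tau> b - \<tau> a) \<le> 4 * phase b - 4 * phase a"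
    proof (rule differentiable_bound_general[OF ab(2)])
      show "continuous_on {a..b} \<tau>" using continuous_on_subset[OF cont] ab by auto
      show "continuous_on {a..b} (\<lambda>t. 4 * phase t)"
      proof (intro continuous_on_mult_left continuous_at_imp_continuous_on ballI)
        fix x assume "x \<in> {a..b}"
        then have "0 < x" "x < T" using ab by auto
        then show "isCont phase x" using mp DERIV_isCont by blast
      qed
      show "(\<tau> has_vector_derivative m x) (at x)" if "a < x" "x < b" for x using mp[of x] that ab by simp
      show "((\<lambda>t. 4 * phase t) has_vector_derivative 4 * p x) (at x)" if "a < x" "x < b" for x
        using mp[of x] that ab DERIV_cmult unfolding has_real_derivative_iff_has_vector_derivative[symmetric] by auto
      show "norm (m x) \<le> 4 * p x" if "a < x" "x < b" for x using mp[of x] that ab by simp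
    qed
    also have "\<dots> \<le> 8 * pi"
      using phase_bound[of a, OF _ _ small] phase_bound[of b, OF _ _ small] ab by simp
    finally show ?thesis .
  qed
  have bound': "norm (\<tau> b) \<le> 8 * pi" if b: "0 < b" "b < T" for b
  proof -
    have "continuous_on {0..b} (\<lambda>a. norm (\<tau> b - \<tau> a))" "0 \<in> {0..b}"
      using b by (auto intro!: continuous_intros continuous_on_subset[OF cont])
    from bound_on_closed_interval(1)[OF this(1) b(1) this(2)]
    have "norm (\<tau> b - \<tau> 0) \<le> 8 * pi" using increment b by blast
    then show ?thesis by (simp add: \<tau>0)
  qed
  have bound: "norm (\<tau> t) \<le> 8 * pi" if t: "t \<in> {0..T}" for t
    using bound_on_closed_interval(1)[OF continuous_on_norm[OF cont] T t] bound' by blast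
  show ?thesis using that[OF \<tau>0 cont flow bound] int by blast
qed

text \<open>Off the circle, the imaginary part of \<open>log_polar\<close> increases strictly along the curve from 0, and it hits
  a multiple of \<open>2\<pi>/n\<close> exactly when the curve is in the disc; so it ends at \<open>2\<pi>/n\<close>, and injectivity of
  \<open>log_polar\<close> determines the end point. On the circle (\<open>s = 0\<close>) the curve never leaves the circle.\<close>

lemma leaf_curve_return:
  assumes tame: "tame n \<theta> s M e" and e: "e \<le> 1/4" and M: "M > 8 * pi" and small: "norm s * exp M < 1/8"
    and return: "\<gamma> T \<in> disc \<theta>"
  shows "\<gamma> T = flow n (log_polar_inv n \<theta> s M (return_time n)) (disc_pt \<theta> s)"
proof -
  define \<tau>1 where "\<tau>1 = log_polar_inv n \<theta> s M (return_time n)"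
  have "exp (8 * pi) * norm s \<le> exp M * norm s" using M by (intro mult_right_mono) auto
  then have s: "exp (8 * pi) * norm s < 1/8" using small by (simp add: mult.commute)
  have fr: "first_return n \<theta> (disc_pt \<theta> s) (flow n \<tau>1 (disc_pt \<theta> s))"
    unfolding \<tau>1_def by (rule first_return_exists[OF n tame e _ small]) (use M pi_gt_zero in linarith)
  show "\<gamma> T = flow n \<tau>1 (disc_pt \<theta> s)"
  proof (cases "s = 0")
    case True
    have "snd (\<gamma> T) = 0" using leaf_curve_stays_near_circle(1)[OF s, of T] T True by simp
    then have "\<gamma> T = disc_pt \<theta> 0" using in_discD(2)[OF return] by simp
    moreover have "flow n \<tau>1 (disc_pt \<theta> s) \<in> disc \<theta>"
      using fr by (simp add: first_return_def)
    from in_discD(2)[OF this] have "flow n \<tau>1 (disc_pt \<theta> s) = disc_pt \<theta> 0"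
      using True by (simp add: flow_disc_pt)
    ultimately show ?thesis by simp
  next
    case False
    obtain \<tau> where \<tau>: "\<tau> 0 = 0" "continuous_on {0..T} \<tau>" "\<And>t. t \<in> {0..T} \<Longrightarrow> \<gamma> t = flow n (\<tau> t) (disc_pt \<theta> s)"
      "\<And>t. t \<in> {0..T} \<Longrightarrow> norm (\<tau> t) \<le> 8 * pi"
      "\<And>t. 0 < t \<Longrightarrow> t < T \<Longrightarrow> \<exists>m. (\<tau> has_vector_derivative m) (at t) \<and> m \<noteq> 0 \<and> Im m \<ge> 3/4 * norm m"
      by (rule leaf_curve_is_flow[OF s False], rule that)
    define y where "y = (\<lambda>t. Im (log_polar n \<theta> s (\<tau> t)))"
    have \<tau>M: "\<tau> t \<in> cball 0 M" if "t \<in> {0..T}" for t using \<tau>(4)[OF that] M by auto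
    have dr: "drift n \<theta> s (\<tau> t) \<noteq> 0"
      if "t \<in> {0..T}" for t using tame_drift[OF n tame e \<tau>M[OF that]] .
    have re: "Re (log_polar n \<theta> s (\<tau> t)) = 0" if t: "t \<in> {0..T}" for t
      using leaf_curve_S3[OF t] unfolding \<tau>(3)[OF t] flow_in_S3_iff[OF n dr[OF t]] .
    have disc_iff: "\<gamma> t \<in> disc \<theta> \<longleftrightarrow> (\<exists>k::int. real n * y t = 2 * pi * k)"
      if t: "t \<in> {0..T}" for t
      unfolding \<tau>(3)[OF t] flow_in_disc_iff[OF n dr[OF t]] y_def using re[OF t] by simp
    have conty: "continuous_on {0..T} y"
      unfolding y_def using \<tau>M
      by (intro continuous_on_Im continuous_on_compose2[OF log_polar_cont[OF n tame e] \<tau>(2)]) auto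
    have y0: "y 0 = 0" using log_polar_0[OF tame_norm[OF n tame e]] by (simp add: y_def \<tau>(1))
    have "y 0 < y T"
    proof (rule DERIV_pos_imp_increasing_open[OF T _ conty])
      fix t assume t: "0 < t" "t < T"
      obtain m where m: "(\<tau> has_vector_derivative m) (at t)" "m \<noteq> 0" "Im m \<ge> 3/4 * norm m"
        using \<tau>(5)[OF t] by blast
      have tT: "t \<in> {0..T}" using t by simp
      obtain D where D: "(log_polar n \<theta> s has_derivative (\<lambda>d. d + D d)) (at (\<tau> t))" "\<And>d. norm (D d) \<le> e * norm d"
        by (rule tame_derivative[OF n tame e \<tau>M[OF tT]], rule that)
      have "((\<lambda>t. log_polar n \<theta> s (\<tau> t)) has_derivative (\<lambda>x. x *\<^sub>R m + D (x *\<^sub>R m))) (at t)"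
        using has_derivative_compose[OF m(1)[unfolded has_vector_derivative_def] D(1)] .
      moreover have "x *\<^sub>R m + D (x *\<^sub>R m) = x *\<^sub>R (m + D m)" for x
        using linear_scale[OF has_derivative_linear[OF D(1)], of x m] .
      ultimately have "((\<lambda>t. log_polar n \<theta> s (\<tau> t)) has_vector_derivative (m + D m)) (at t)"
        by (simp only: has_vector_derivative_def)
      then have "(y has_vector_derivative Im (m + D m)) (at t)"
        unfolding y_def using bounded_linear.has_vector_derivative[OF bounded_linear_Im] by blast
      then have "(y has_real_derivative Im (m + D m)) (at t)"
        by (simp add: has_real_derivative_iff_has_vector_derivative)
      moreover have "Im (m + D m) > 0"
      proof -
        have "norm (D m) \<le> 1/4 * norm m"
          using D(2)[of m] mult_right_mono[OF e norm_ge_zero[of m]] by linarith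
        moreover have "norm m > 0" using m(2) by simp
        moreover have "Im (D m) \<ge> - norm (D m)" using abs_Im_le_cmod[of "D m"] by linarith
        ultimately have "Im m + Im (D m) > 0" using m(3) by linarith
        then show ?thesis by simp
      qed
      ultimately show "\<exists>d. (y has_real_derivative d) (at t) \<and> 0 < d" by blast
    qed
    then have "real n * y T > 0" using y0 n by simp
    moreover obtain k :: int where k: "real n * y T = 2 * pi * k" using disc_iff[of T] return T by auto
    ultimately have kpos: "k \<ge> 1" by (simp add: zero_less_mult_iff)
    \<comment> \<open>For a larger multiple the intermediate value theorem yields an earlier passage through the disc.\<close>
    have "k = 1"
    proof (rule ccontr)
      assume "k \<noteq> 1"
      then have "k > 1" using kpos by linarith
      then have "2 * pi * 1 < 2 * pi * real_of_int k" by (intro mult_strict_left_mono) auto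
      then have big: "real n * y T > 2 * pi" unfolding k by linarith
      have low: "real n * y 0 \<le> 2 * pi" unfolding y0 using pi_gt_zero by simp
      have "continuous_on {0..T} (\<lambda>t. real n * y t)" by (rule continuous_on_mult_left[OF conty])
      from IVT'[where f = "\<lambda>t. real n * y t", OF low less_imp_le[OF big] less_imp_le[OF T] this]
      have "\<exists>t\<ge>0. t \<le> T \<and> real n * y t = 2 * pi" .
      then obtain t where t: "0 \<le> t" "t \<le> T" "real n * y t = 2 * pi" by blast
      have "t \<noteq> 0" "t \<noteq> T" using t(3) y0 big by auto
      then have t': "0 < t" "t < T" using t by auto
      have tT: "t \<in> {0..T}" using t by simp
      have "real n * y t = 2 * pi * real_of_int 1" using t(3) by simp
      then have "\<gamma> t \<in> disc \<theta>" unfolding disc_iff[OF tT] by blast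
      then show False using avoid[OF t'] by blast
    qed
    then have "y T = 2 * pi / n" using k n by (simp add: field_simps)
    then have k\<tau>: "log_polar n \<theta> s (\<tau> T) = return_time n"
      using re[of T] T by (simp add: complex_eq_iff y_def return_time_def)
    have "2 * norm (return_time n) < M" using norm_return_time[OF n] M pi_gt_zero by linarith
    note K = log_polar_inv_solves[OF n tame e this]
    have TT: "T \<in> {0..T}" using T by simp
    have "\<tau>1 \<in> cball 0 M" using K(1) unfolding \<tau>1_def by simp
    then have "\<tau> T = \<tau>1"
      using inj_onD[OF log_polar_inj[OF n tame e] _ \<tau>M[OF TT]] k\<tau> K(2) unfolding \<tau>1_def by metis
    then show ?thesis using \<tau>(3)[of T] T by simp
  qed
qed

end

text \<open>The elapsed complex time is close to \<open>2\<pi>i/n\<close> because \<open>log_polar\<close> is close to the identity.\<close>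

theorem first_return_near_centre:
  assumes n: "n \<ge> 1" and d: "d > 0"
  shows "\<forall>\<^sub>F s in nhds 0. norm s < 1 \<and> (\<exists>\<tau>. norm (\<tau> - return_time n) \<le> d \<and>
    first_return n \<theta> (disc_pt \<theta> s) (flow n \<tau> (disc_pt \<theta> s)) \<and>
    (\<forall>q. first_return n \<theta> (disc_pt \<theta> s) q \<longrightarrow> q = flow n \<tau> (disc_pt \<theta> s)))"
proof -
  define M where "M = 8 * pi + 1"
  define e where "e = min (1/4) (d / M)"
  have M: "M > 8 * pi" "M > 4 * pi" "M > 0" using pi_gt_zero by (auto simp: M_def intro: add_pos_pos)
  have e: "e > 0" "e \<le> 1/4" "e * M \<le> d" using d M by (auto simp: e_def min_def field_simps)
  have "((\<lambda>s::complex. norm s * exp M) \<longlongrightarrow> norm (0::complex) * exp M) (nhds 0)"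
    by (intro tendsto_intros filterlim_ident)
  then have "\<forall>\<^sub>F s::complex in nhds 0. norm s * exp M < 1/8" by (rule order_tendstoD(2)) simp
  with eventually_tame[OF n M(3) e(1), of \<theta>]
  show ?thesis
  proof eventually_elim
    case (elim s)
    define w where "w = return_time n"
    define \<tau> where "\<tau> = log_polar_inv n \<theta> s M w"
    have "2 * norm w < M" using norm_return_time[OF n] M unfolding w_def by linarith
    note K = log_polar_inv_solves[OF n elim(1) e(2) this, folded \<tau>_def]
    have "norm (log_polar n \<theta> s \<tau> - \<tau>) \<le> e * norm \<tau>"
      using K(1) by (intro log_polar_almost_identity[OF n elim(1) e(2)]) auto
    also have "\<dots> \<le> e * M" using K(1) e by (intro mult_left_mono) auto
    finally have "norm (\<tau> - w) \<le> d" using e(3) unfolding K(2) by (simp add: norm_minus_commute)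
    moreover have "first_return n \<theta> (disc_pt \<theta> s) (flow n \<tau> (disc_pt \<theta> s))"
      unfolding \<tau>_def w_def by (rule first_return_exists[OF n elim(1) e(2) M(2) elim(2)])
    moreover have "q = flow n \<tau> (disc_pt \<theta> s)"
      if q: "first_return n \<theta> (disc_pt \<theta> s) q" for q
    proof -
      obtain T \<gamma> where g: "T > 0" "leaf_curve n T \<gamma>" "\<gamma> 0 = disc_pt \<theta> s" "\<gamma> T = q" "\<And>t. 0 < t \<Longrightarrow> t < T \<Longrightarrow> \<gamma> t \<notin> disc \<theta>"
        using q unfolding first_return_def by auto
      have "\<gamma> T \<in> disc \<theta>" using q g(4) by (simp add: first_return_def)
      from leaf_curve_return[OF n g(1,2,3,5) elim(1) e(2) M(1) elim(2) this]
      show ?thesis using g(4) by (simp add: \<tau>_def w_def)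
    qed
    ultimately show ?case using tame_norm[OF n elim(1) e(2)] unfolding w_def by blast
  qed
qed

text \<open>In complex time at most \<open>1/n\<close> the argument of \<open>z\<^sub>1\<close> changes by at most \<open>5/4\<close>, which is less than \<open>2\<pi>\<close>.\<close>

lemma disc_meets_small_leaf_once:
  assumes n: "n \<ge> 1"
  shows "\<forall>\<^sub>F s in nhds 0. \<forall>\<tau>. norm \<tau> \<le> 1 / n \<and> flow n \<tau> (disc_pt \<theta> s) \<in> disc \<theta> \<longrightarrow> \<tau> = 0"
proof -
  have "\<forall>\<^sub>F s in nhds 0. tame n \<theta> s 1 (1/4)" by (rule eventually_tame[OF n]) auto
  then show ?thesis
  proof eventually_elim
    case (elim s)
    show ?case
    proof (intro allI impI, elim conjE)
      fix \<tau> assume t: "norm \<tau> \<le> 1 / n" and d: "flow n \<tau> (disc_pt \<theta> s) \<in> disc \<theta>"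
      have "1 / real n \<le> 1" using n by simp
      then have t1: "\<tau> \<in> cball 0 1" using t by simp
      note dr = tame_drift[OF n elim order_refl t1]
      have re: "Re (log_polar n \<theta> s \<tau>) = 0" and "\<exists>k::int. real n * Im (log_polar n \<theta> s \<tau>) = 2 * pi * k"
        using d unfolding flow_in_disc_iff[OF n dr] by blast+
      then obtain k :: int where k: "real n * Im (log_polar n \<theta> s \<tau>) = 2 * pi * k" by blast
      have "norm (log_polar n \<theta> s \<tau>) \<le> norm (log_polar n \<theta> s \<tau> - \<tau>) + norm \<tau>"
        using norm_triangle_ineq[of "log_polar n \<theta> s \<tau> - \<tau>" \<tau>] by simp
      also have "\<dots> \<le> 5/4 * norm \<tau>"
        using log_polar_almost_identity[OF n elim order_refl t1] by simp
      also have "\<dots> \<le> 5/4 * (1 / n)" using t by simp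
      finally have "\<bar>Im (log_polar n \<theta> s \<tau>)\<bar> \<le> 5/4 * (1 / n)"
        using abs_Im_le_cmod order_trans by blast
      then have "\<bar>real n * Im (log_polar n \<theta> s \<tau>)\<bar> \<le> 5/4"
        using n by (simp add: abs_mult field_simps)
      then have "\<bar>2 * pi * k\<bar> < 2 * pi" unfolding k using pi_gt3 by linarith
      then have "k = 0" by (simp add: abs_mult)
      then have "log_polar n \<theta> s \<tau> = log_polar n \<theta> s 0"
        using re k n log_polar_0[OF tame_norm[OF n elim order_refl]] by (simp add: complex_eq_iff)
      then show "\<tau> = 0" using inj_onD[OF log_polar_inj[OF n elim order_refl] _ t1, of 0] by simp
    qed
  qed
qed


section \<open>Conjugation of germs and the model germ\<close>

text \<open>The hypothesis is \<open>f(z) = l z (1 + b z\<^sup>n + o(z\<^sup>n))\<close> with \<open>l\<^sup>n = 1\<close>. Then \<open>n\<close>-th powers are preserved to first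
  order, so the corrections add up: the \<open>k\<close>-th iterate is \<open>l\<^sup>k z (1 + k b z\<^sup>n + o(z\<^sup>n))\<close>.\<close>

lemma iterate_rotation_limit:
  fixes f :: "complex \<Rightarrow> complex"
  assumes lim: "(\<lambda>z. (f z / (l * z) - 1) / z ^ n) \<midarrow>0\<rightarrow> b" and n: "n \<ge> 1" and l: "l ^ n = 1"
  shows "(\<lambda>z. ((f ^^ k) z / (l ^ k * z) - 1) / z ^ n) \<midarrow>0\<rightarrow> of_nat k * b"
proof (induction k)
  case 0
  have "\<forall>\<^sub>F z in at 0. (\<lambda>z. 0) z = ((f ^^ 0) z / (l ^ 0 * z) - 1) / z ^ n"
    by (intro eventually_mono[OF eventually_at_0_nonzero]) simp
  from Lim_transform_eventually[OF tendsto_const this] show ?case by simp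
next
  case (Suc k)
  have l0: "l \<noteq> 0" using l n by (auto simp: power_0_left)
  have tends: "(\<lambda>z. F z / (m * z)) \<midarrow>0\<rightarrow> 1"
    if "(\<lambda>z. (F z / (m * z) - 1) / z ^ n) \<midarrow>0\<rightarrow> c" for F :: "complex \<Rightarrow> complex" and m c
  proof -
    have "(\<lambda>z. 1 + z ^ n * ((F z / (m * z) - 1) / z ^ n)) \<midarrow>0\<rightarrow> 1 + 0 ^ n * c"
      by (intro tendsto_intros that)
    then have "(\<lambda>z. 1 + z ^ n * ((F z / (m * z) - 1) / z ^ n)) \<midarrow>0\<rightarrow> 1"
      using n by (simp add: power_0_left)
    then show ?thesis
      by (rule Lim_transform_eventually) (intro eventually_mono[OF eventually_at_0_nonzero], simp)
  qed
  define G where "G = f ^^ k"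
  define Y where "Y = (\<lambda>z. G z / (l ^ k * z))"
  have Y: "(\<lambda>z. (Y z - 1) / z ^ n) \<midarrow>0\<rightarrow> of_nat k * b"
    using Suc by (simp add: Y_def G_def)
  have Y1: "Y \<midarrow>0\<rightarrow> 1" using tends[OF Suc] by (simp add: Y_def G_def)
  have GY: "\<forall>\<^sub>F z in at 0. l ^ k * z * Y z = G z"
    by (intro eventually_mono[OF eventually_at_0_nonzero]) (simp add: Y_def l0)
  have "(\<lambda>z. l ^ k * z * Y z) \<midarrow>0\<rightarrow> l ^ k * 0 * 1" by (intro tendsto_intros Y1)
  then have "G \<midarrow>0\<rightarrow> 0" using Lim_transform_eventually[OF _ GY] by simp
  moreover have G0: "\<forall>\<^sub>F z in at 0. G z \<noteq> 0"
    using tendsto_imp_eventually_ne[OF Y1 zero_neq_one[symmetric]] by eventually_elim (auto simp: Y_def)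
  ultimately have Gat: "filterlim G (at 0) (at 0)" by (rule filterlim_atI)
  define q where "q = (\<lambda>z. f z / (l * z))"
  have q1: "(\<lambda>z. q (G z)) \<midarrow>0\<rightarrow> 1"
    using filterlim_compose[OF tends[OF lim] Gat] by (simp add: q_def)
  have qb: "(\<lambda>z. (q (G z) - 1) / G z ^ n) \<midarrow>0\<rightarrow> b"
    using filterlim_compose[OF lim Gat] by (simp add: q_def)
  have "(\<lambda>z. (Y z - 1) / z ^ n * q (G z) + (q (G z) - 1) / G z ^ n * (l ^ k * Y z) ^ n) \<midarrow>0\<rightarrow> of_nat k * b * 1 + b * (l ^ k * 1) ^ n"
    by (intro tendsto_intros Y q1 qb Y1)
  moreover have "(l ^ k * 1) ^ n = 1"
  proof -
    have "(l ^ k) ^ n = (l ^ n) ^ k" by (simp only: power_mult[symmetric] mult.commute)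
    then show ?thesis using l by simp
  qed
  moreover have "\<forall>\<^sub>F z in at 0. (Y z - 1) / z ^ n * q (G z) + (q (G z) - 1) / G z ^ n * (l ^ k * Y z) ^ n
      = ((f ^^ Suc k) z / (l ^ Suc k * z) - 1) / z ^ n"
    using eventually_at_0_nonzero G0
  proof eventually_elim
    case (elim z)
    have "l ^ k * Y z = G z / z" using elim l0 by (simp add: Y_def)
    then have "(q (G z) - 1) / G z ^ n * (l ^ k * Y z) ^ n = (q (G z) - 1) / z ^ n"
      using elim by (simp add: power_divide)
    moreover have "(f ^^ Suc k) z / (l ^ Suc k * z) = Y z * q (G z)"
      using elim l0 by (simp add: q_def Y_def G_def)
    ultimately show ?case by (simp add: algebra_simps diff_divide_distrib)
  qed
  ultimately have "(\<lambda>z. ((f ^^ Suc k) z / (l ^ Suc k * z) - 1) / z ^ n) \<midarrow>0\<rightarrow> of_nat k * b * 1 + b * 1"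
    using Lim_transform_eventually by fastforce
  then show ?case by (simp add: algebra_simps)
qed

text \<open>A holomorphic map is strictly differentiable: the mean value inequality applies to \<open>h(z) - h'(0) z\<close>,
  whose derivative is small near 0.\<close>

lemma strict_derivative:
  fixes h :: "complex \<Rightarrow> complex"
  assumes h: "h holomorphic_on A" "open A" "0 \<in> A"
    and F: "F \<midarrow>0\<rightarrow> 0" "\<forall>\<^sub>F z in at 0. F z \<noteq> z"
  shows "(\<lambda>z. (h (F z) - h z) / (F z - z)) \<midarrow>0\<rightarrow> deriv h 0"
proof (rule tendstoI)
  fix e :: real assume e: "e > 0"
  have "continuous_on A (deriv h)"
    using holomorphic_deriv[OF h(1,2)] holomorphic_on_imp_continuous_on by blast
  then have "isCont (deriv h) 0" using h continuous_on_eq_continuous_at by blast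
  then obtain d where d: "d > 0" "\<And>z. norm z < d \<Longrightarrow> norm (deriv h z - deriv h 0) < e / 2"
    using e unfolding continuous_at_eps_delta by (auto simp: dist_norm dest!: spec[of _ "e / 2"])
  obtain r where r: "r > 0" "ball 0 r \<subseteq> A" using h open_contains_ball by blast
  define s where "s = min d r"
  have bd: "norm ((h x - deriv h 0 * x) - (h y - deriv h 0 * y)) \<le> e / 2 * norm (x - y)"
    if "x \<in> ball 0 s" "y \<in> ball 0 s" for x y
  proof (rule field_differentiable_bound[of "ball 0 s"])
    show "((\<lambda>x. h x - deriv h 0 * x) has_field_derivative deriv h z - deriv h 0) (at z within ball 0 s)"
      if "z \<in> ball 0 s" for z
    proof -
      have "z \<in> A" using that r by (auto simp: s_def)
      then have "(h has_field_derivative deriv h z) (at z)" using holomorphic_derivI[OF h(1,2)] by blast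
      then have "((\<lambda>x. h x - deriv h 0 * x) has_field_derivative deriv h z - deriv h 0) (at z)"
        by (auto intro!: derivative_eq_intros)
      then show ?thesis by (rule has_field_derivative_at_within)
    qed
    show "norm (deriv h z - deriv h 0) \<le> e / 2" if "z \<in> ball 0 s" for z
      using d(2)[of z] that by (auto simp: s_def)
  qed (use that in auto)
  have s: "s > 0" using d r by (simp add: s_def)
  have "\<forall>\<^sub>F z in at 0. F z \<in> ball 0 s"
    using F(1) s unfolding tendsto_iff by (simp add: dist_commute)
  moreover have "\<forall>\<^sub>F z in at 0. z \<in> ball 0 s" by (rule eventually_at_in_open') (use s in auto)
  ultimately show "\<forall>\<^sub>F z in at 0. dist ((h (F z) - h z) / (F z - z)) (deriv h 0) < e"
    using F(2)
  proof eventually_elim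
    case (elim z)
    have "(h (F z) - h z) / (F z - z) - deriv h 0 = ((h (F z) - deriv h 0 * F z) - (h z - deriv h 0 * z)) / (F z - z)"
      using elim(3) by (simp add: field_simps)
    then have "norm ((h (F z) - h z) / (F z - z) - deriv h 0) \<le> e / 2"
      using bd[OF elim(1,2)] elim(3) by (simp add: norm_divide divide_le_eq)
    then show ?case using e by (simp add: dist_norm)
  qed
qed

text \<open>Only the leading coefficient changes, by the power \<open>h'(0)\<^sup>-\<^sup>N\<close>. Writing points as \<open>h(z)\<close>, the quotient
  for \<open>G\<close> is \<open>(h(F(z)) - h(z)) / (F(z) - z)\<close>, which tends to \<open>h'(0)\<close>, times the quotient for \<open>F\<close> times
  \<open>(z / h(z))\<^sup>N\<^sup>+\<^sup>1\<close>.\<close>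

lemma conjugate_limit:
  fixes h :: "complex \<Rightarrow> complex"
  assumes h: "h holomorphic_on A" "open A" "0 \<in> A" "h 0 = 0" "deriv h 0 \<noteq> 0" "inj_on h A"
    and FG: "\<forall>\<^sub>F z in nhds 0. G (h z) = h (F z)"
    and lim: "(\<lambda>z. (F z - z) / z ^ (N + 1)) \<midarrow>0\<rightarrow> c" and N: "N > 0" and c: "c \<noteq> 0"
  shows "(\<lambda>z. (G z - z) / z ^ (N + 1)) \<midarrow>0\<rightarrow> c / deriv h 0 ^ N"
proof -
  have hd: "(h has_field_derivative deriv h 0) (at 0)" using holomorphic_derivI[OF h(1,2,3)] .
  then have hz: "(\<lambda>z. h z / z) \<midarrow>0\<rightarrow> deriv h 0"
    using h(4) by (simp add: has_field_derivative_iff)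
  have Fne: "\<forall>\<^sub>F z in at 0. F z \<noteq> z"
    using tendsto_imp_eventually_ne[OF lim c] by eventually_elim auto
  have F0: "F \<midarrow>0\<rightarrow> 0" using tangent_to_identity(2)[OF lim N] by (simp add: filterlim_at)
  note sd = strict_derivative[OF h(1-3) F0 Fne]
  have "(\<lambda>z. (h (F z) - h z) / (F z - z) * ((F z - z) / z ^ (N + 1)) * inverse ((h z / z) ^ (N + 1))) \<midarrow>0\<rightarrow> deriv h 0 * c * inverse (deriv h 0 ^ (N + 1))"
    using h(5) by (intro tendsto_intros sd lim hz) auto
  moreover have "deriv h 0 * c * inverse (deriv h 0 ^ (N + 1)) = c / deriv h 0 ^ N"
    using h(5) by (simp add: field_simps)
  moreover have hne: "\<forall>\<^sub>F z in at 0. h z / z \<noteq> 0"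
    using tendsto_imp_eventually_ne[OF hz h(5)] .
  moreover have FG': "\<forall>\<^sub>F z in at 0. G (h z) = h (F z)"
    using FG by (simp add: eventually_at_filter eventually_mono)
  moreover have "\<forall>\<^sub>F z in at 0. (h (F z) - h z) / (F z - z) * ((F z - z) / z ^ (N + 1)) * inverse ((h z / z) ^ (N + 1))
      = (G (h z) - h z) / h z ^ (N + 1)"
    using Fne eventually_at_0_nonzero hne FG'
  proof eventually_elim
    case (elim z)
    have key: "X / b * (b / z ^ (N + 1)) * inverse ((a / z) ^ (N + 1)) = X / a ^ (N + 1)"
      if "b \<noteq> 0" for X a b :: complex
    proof -
      have "inverse ((a / z) ^ (N + 1)) = z ^ (N + 1) / a ^ (N + 1)" by (simp only: power_divide inverse_divide)
      moreover have "z ^ (N + 1) \<noteq> 0" using elim(2) by simp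
      ultimately show ?thesis using that by (simp del: power_Suc)
    qed
    show ?case unfolding elim(4) by (rule key) (use elim(1) in simp)
  qed
  ultimately have lim1: "(\<lambda>z. (G (h z) - h z) / h z ^ (N + 1)) \<midarrow>0\<rightarrow> c / deriv h 0 ^ N"
    using Lim_transform_eventually by fastforce
  obtain g where g: "g holomorphic_on (h ` A)" "\<And>z. z \<in> A \<Longrightarrow> g (h z) = z"
    using holomorphic_has_inverse[OF h(1,2,6)] by metis
  have op: "open (h ` A)" using open_mapping_thm3[OF h(1,2,6)] .
  have im: "0 \<in> h ` A" using h(3,4) by force
  have g0: "g 0 = 0" using g(2)[OF h(3)] h(4) by simp
  have "isCont g 0"
    using holomorphic_on_imp_continuous_on[OF g(1)] op im continuous_on_eq_continuous_at by blast
  then have "g \<midarrow>0\<rightarrow> 0" using g0 by (simp add: isCont_def)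
  moreover have ev: "\<forall>\<^sub>F z in at 0. z \<in> h ` A - {0}" using eventually_at_in_open[OF op im] .
  then have "\<forall>\<^sub>F z in at 0. g z \<noteq> 0"
    by eventually_elim (use g(2) h(4) in auto)
  ultimately have "filterlim g (at 0) (at 0)" by (rule filterlim_atI)
  from filterlim_compose[OF lim1 this] show ?thesis
  proof (rule Lim_transform_eventually)
    show "\<forall>\<^sub>F z in at 0. (G (h (g z)) - h (g z)) / h (g z) ^ (N + 1) = (G z - z) / z ^ (N + 1)"
      using ev by eventually_elim (use g(2) in auto)
  qed
qed

lemma conjugate_germ:
  fixes h :: "complex \<Rightarrow> complex"
  assumes h: "h holomorphic_on A" "open A" "0 \<in> A" "h 0 = 0" "deriv h 0 \<noteq> 0" "inj_on h A"
    and FG: "\<forall>\<^sub>F z in nhds 0. G (h z) = h (F z)" and F: "F analytic_on {0}" "F 0 = 0"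
  shows "G analytic_on {0}" "G 0 = 0" "deriv G 0 = deriv F 0"
    "\<forall>\<^sub>F z in nhds 0. (G ^^ k) (h z) = h ((F ^^ k) z)"
proof -
  obtain g where g: "g holomorphic_on (h ` A)" "\<And>z. z \<in> A \<Longrightarrow> g (h z) = z" "\<And>z. z \<in> A \<Longrightarrow> deriv h z * deriv g (h z) = 1"
    using holomorphic_has_inverse[OF h(1,2,6)] by metis
  have op: "open (h ` A)" using open_mapping_thm3[OF h(1,2,6)] .
  have im: "0 \<in> h ` A" using h(3,4) by force
  have g0: "g 0 = 0" using g(2)[OF h(3)] h(4) by simp
  have ga: "g analytic_on {0}" unfolding analytic_at using g(1) op im by blast
  have ha: "h analytic_on {0}" unfolding analytic_at using h by blast
  have "isCont g 0"
    using holomorphic_on_imp_continuous_on[OF g(1)] op im continuous_on_eq_continuous_at by blast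
  then have gl: "filterlim g (nhds 0) (nhds 0)"
    using g0 by (simp add: isCont_def tendsto_nhds_iff continuous_at tendsto_at_iff_tendsto_nhds)
  have "\<forall>\<^sub>F z in nhds 0. z \<in> h ` A" using op im eventually_nhds by blast
  with eventually_compose_filterlim[OF FG gl]
  have ev: "\<forall>\<^sub>F z in nhds 0. G z = (h \<circ> (F \<circ> g)) z"
    by eventually_elim (use g(2) in auto)
  have "(h \<circ> (F \<circ> g)) analytic_on {0}"
    using F ha by (intro analytic_on_compose ga) (simp_all add: g0)
  then show "G analytic_on {0}" using analytic_at_cong[OF ev refl] by blast
  show "G 0 = 0" using eventually_nhds_x_imp_x[OF ev] by (simp add: g0 F h)
  have d: "(F has_field_derivative deriv F 0) (at 0)" "(g has_field_derivative deriv g 0) (at 0)"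
    "(h has_field_derivative deriv h 0) (at 0)"
    using F(1) ga ha by (auto intro!: DERIV_deriv_iff_field_differentiable[THEN iffD2] analytic_on_imp_differentiable_at)
  have "((F \<circ> g) has_field_derivative deriv F 0 * deriv g 0) (at 0)"
    by (rule DERIV_chain) (use d g0 in auto)
  then have "((h \<circ> (F \<circ> g)) has_field_derivative deriv h 0 * (deriv F 0 * deriv g 0)) (at 0)"
    by (intro DERIV_chain) (use d g0 F in auto)
  then have "deriv (h \<circ> (F \<circ> g)) 0 = deriv h 0 * (deriv F 0 * deriv g 0)" by (rule DERIV_imp_deriv)
  moreover have "deriv h 0 * deriv g 0 = 1" using g(3)[OF h(3)] h(4) by simp
  ultimately show "deriv G 0 = deriv F 0" using deriv_cong_ev[OF ev refl] by (simp add: mult.left_commute o_def)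
  show "\<forall>\<^sub>F z in nhds 0. (G ^^ k) (h z) = h ((F ^^ k) z)"
  proof (induction k)
    case (Suc k)
    have "(F ^^ k) analytic_on {0} \<and> (F ^^ k) 0 = 0" using funpow_analytic[OF F] .
    then have "isCont (F ^^ k) 0" "(F ^^ k) 0 = 0" using analytic_at_imp_isCont by auto
    then have "filterlim (F ^^ k) (nhds 0) (nhds 0)" by (metis isCont_def tendsto_at_iff_tendsto_nhds)
    from Suc eventually_compose_filterlim[OF FG this] show ?case
      by eventually_elim simp
  qed simp
qed

text \<open>The return equation reads \<open>E(\<tau>) = z\<^sup>n e\<^sup>-\<^sup>i\<^sup>\<theta>\<close> with \<open>E(\<tau>) = (e\<^sup>-\<^sup>n\<^sup>\<tau> - 1) / \<tau>\<close>, a holomorphic function of one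
  variable that vanishes at \<open>2\<pi>i/n\<close> with nonzero derivative. So the time is a holomorphic function of
  \<open>z\<^sup>n\<close>, and the derivative of the inverse of \<open>E\<close> yields the first correction term.\<close>

lemma model_germ:
  assumes n: "n \<ge> 1"
  obtains f r where "f analytic_on {0}" "f 0 = 0" "deriv f 0 = cis (2 * pi / n)" "r > 0"
    "\<And>z \<tau>. norm (\<tau> - return_time n) < r \<Longrightarrow>
       exp (of_nat n * \<tau>) * (cis \<theta> + z ^ n * \<tau>) = cis \<theta> \<Longrightarrow> f z = z * exp \<tau>"
    "(\<lambda>z. (f z / (cis (2 * pi / n) * z) - 1) / z ^ n) \<midarrow>0\<rightarrow> - return_time n / (of_nat n * cis \<theta>)"
proof -
  define T0 where "T0 = return_time n"
  have T0: "T0 \<noteq> 0" using n by (simp add: T0_def return_time_def)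
  have eT: "exp T0 = cis (2 * pi / n)" by (simp add: T0_def return_time_def cis_conv_exp)
  have "of_nat n * T0 = 2 * of_real pi * \<i>" using n by (simp add: T0_def return_time_def)
  then have enT: "exp (- (of_nat n * T0)) = 1" by (simp add: exp_minus)
  define E where "E = (\<lambda>T::complex. (exp (- (of_nat n * T)) - 1) / T)"
  have holE: "E holomorphic_on (- {0})" unfolding E_def by (intro holomorphic_intros) auto
  have E0: "E T0 = 0" by (simp add: E_def enT)
  have dE: "(E has_field_derivative - of_nat n / T0) (at T0)"
    unfolding E_def using T0 enT by (auto intro!: derivative_eq_intros simp: field_simps)
  have "deriv E T0 \<noteq> 0" using DERIV_imp_deriv[OF dE] T0 n by simp
  then obtain r where r: "r > 0" "ball T0 r \<subseteq> - {0}" "inj_on E (ball T0 r)"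
    using has_complex_derivative_locally_injective[OF holE] T0 by (metis ComplI open_Compl closed_singleton singletonD)
  have holE': "E holomorphic_on ball T0 r" using holE r(2) holomorphic_on_subset by blast
  obtain h where h: "h holomorphic_on (E ` ball T0 r)" "\<And>z. z \<in> ball T0 r \<Longrightarrow> deriv E z * deriv h (E z) = 1"
    "\<And>z. z \<in> ball T0 r \<Longrightarrow> h (E z) = z"
    using holomorphic_has_inverse[OF holE' open_ball r(3)] by metis
  have op: "open (E ` ball T0 r)" using open_mapping_thm3[OF holE' open_ball r(3)] .
  have T0r: "T0 \<in> ball T0 r" using r by simp
  have im: "0 \<in> E ` ball T0 r" using E0 T0r by force
  have h0: "h 0 = T0" using h(3)[OF T0r] E0 by simp
  have "(- of_nat n / T0) * deriv h 0 = 1" using h(2)[OF T0r] E0 DERIV_imp_deriv[OF dE] by simp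
  then have dh: "deriv h 0 = - T0 / of_nat n" using T0 n by (simp add: field_simps) (metis add.inverse_inverse)
  have ha: "h analytic_on {0}" unfolding analytic_at using h(1) op im by blast
  have hd: "(h has_field_derivative - T0 / of_nat n) (at 0)"
    using holomorphic_derivI[OF h(1) op im] by (simp add: dh)
  define p where "p = (\<lambda>z. z ^ n / cis \<theta>)"
  have pa: "p analytic_on {0}" unfolding p_def by (intro analytic_intros) auto
  have p0: "p 0 = 0" using n by (simp add: p_def power_0_left)
  define f where "f = (\<lambda>z. z * exp (h (p z)))"
  have hp: "(\<lambda>z. h (p z)) analytic_on {0}"
    using analytic_on_compose[OF pa, of h] ha p0 by (simp add: o_def)
  have fa: "f analytic_on {0}" unfolding f_def using hp by (intro analytic_intros)
  have f0: "f 0 = 0" by (simp add: f_def)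
  have hpc: "isCont (\<lambda>z. h (p z)) 0" using hp analytic_at_imp_isCont by blast
  have df: "deriv f 0 = cis (2 * pi / n)"
  proof -
    have "(\<lambda>z. exp (h (p z))) \<midarrow>0\<rightarrow> exp (h (p 0))"
      using hpc by (intro tendsto_intros) (simp add: isCont_def)
    then have "(\<lambda>z. (f z - f 0) / (z - 0)) \<midarrow>0\<rightarrow> exp (h (p 0))"
      by (rule Lim_transform_eventually) (intro eventually_mono[OF eventually_at_0_nonzero], simp add: f_def)
    then have "(f has_field_derivative exp (h (p 0))) (at 0)" by (simp add: has_field_derivative_iff)
    then show ?thesis using DERIV_imp_deriv p0 h0 eT by metis
  qed
  have solve: "f z = z * exp \<tau>"
    if t: "norm (\<tau> - return_time n) < r" and e: "exp (of_nat n * \<tau>) * (cis \<theta> + z ^ n * \<tau>) = cis \<theta>" for z \<tau>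
  proof -
    have tr: "\<tau> \<in> ball T0 r" using t by (simp add: T0_def dist_norm norm_minus_commute)
    then have t0: "\<tau> \<noteq> 0" using r(2) by auto
    have "cis \<theta> + z ^ n * \<tau> = exp (- (of_nat n * \<tau>)) * cis \<theta>"
      using e by (simp add: exp_minus field_simps)
    then have "p z = E \<tau>" using t0 by (simp add: p_def E_def field_simps)
    then show ?thesis using h(3)[OF tr] by (simp add: f_def)
  qed
  have lim: "(\<lambda>z. (f z / (cis (2 * pi / n) * z) - 1) / z ^ n) \<midarrow>0\<rightarrow> - T0 / (of_nat n * cis \<theta>)"
  proof -
    have "((\<lambda>x. exp (h x - T0)) has_field_derivative - T0 / of_nat n) (at 0)"
      using hd h0 by (auto intro!: derivative_eq_intros)
    then have d: "(\<lambda>x. (exp (h x - T0) - 1) / x) \<midarrow>0\<rightarrow> - T0 / of_nat n"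
      by (simp add: has_field_derivative_iff h0)
    have "isCont p 0" using pa analytic_at_imp_isCont by blast
    then have "p \<midarrow>0\<rightarrow> 0" using p0 by (simp add: isCont_def)
    moreover have "\<forall>\<^sub>F z in at 0. p z \<noteq> 0"
      by (intro eventually_mono[OF eventually_at_0_nonzero]) (simp add: p_def)
    ultimately have "filterlim p (at 0) (at 0)" by (rule filterlim_atI)
    from tendsto_mult[OF filterlim_compose[OF d this] tendsto_const[of "inverse (cis \<theta>)"]]
    have "(\<lambda>z. (exp (h (p z) - T0) - 1) / p z * inverse (cis \<theta>)) \<midarrow>0\<rightarrow> - T0 / of_nat n * inverse (cis \<theta>)" .
    moreover have "\<forall>\<^sub>F z in at 0. (exp (h (p z) - T0) - 1) / p z * inverse (cis \<theta>) = (f z / (cis (2 * pi / n) * z) - 1) / z ^ n"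
      by (intro eventually_mono[OF eventually_at_0_nonzero])
         (simp add: f_def p_def exp_diff eT divide_simps)
    ultimately have "(\<lambda>z. (f z / (cis (2 * pi / n) * z) - 1) / z ^ n) \<midarrow>0\<rightarrow> - T0 / of_nat n * inverse (cis \<theta>)"
      using Lim_transform_eventually by fastforce
    then show ?thesis by (simp add: divide_inverse mult.assoc)
  qed
  show ?thesis using that[OF fa f0 df r(1)] solve lim unfolding T0_def by blast
qed

lemma conjugate_of_rotation_flower:
  fixes h :: "complex \<Rightarrow> complex"
  assumes n: "n \<ge> 1" and f: "f analytic_on {0}" "f 0 = 0" "deriv f 0 = cis (2 * pi / n)"
    and lim: "(\<lambda>z. (f z / (cis (2 * pi / n) * z) - 1) / z ^ n) \<midarrow>0\<rightarrow> b" and b: "b \<noteq> 0"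
    and h: "h holomorphic_on A" "open A" "0 \<in> A" "h 0 = 0" "deriv h 0 \<noteq> 0" "inj_on h A"
    and conj: "\<forall>\<^sub>F z in nhds 0. G (h z) = h (f z)"
  shows "leau_fatou_flower G n"
proof -
  define l where "l = cis (2 * pi / n)"
  have lk: "l ^ k = cis (2 * pi * (real k / real n))" for k
    by (simp add: l_def Complex.DeMoivre mult_ac)
  have l1: "l ^ n = 1" using n by (simp add: lk)
  note C = conjugate_germ[OF h conj f(1,2)]
  have "primitive_root n l"
    unfolding primitive_root_def
  proof (intro conjI allI impI)
    fix k assume k: "0 < k \<and> k < n"
    show "l ^ k \<noteq> 1"
    proof
      assume "l ^ k = 1"
      then obtain m :: int where "2 * pi * (real k / real n) = of_int (2 * m) * pi"
        unfolding lk cis_conv_exp exp_eq_1 by auto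
      then have "(2 * pi) * (real k / real n) = (2 * pi) * of_int m" by simp
      then have m: "real k / real n = of_int m" unfolding mult_cancel_left using pi_neq_zero by simp
      have "0 < real k / real n" "real k / real n < 1" using k by auto
      then show False unfolding m by simp
    qed
  qed (use n l1 in auto)
  then have q: "primitive_root n (deriv G 0)" using C(3) f(3) by (simp add: l_def)
  have "(\<lambda>z. ((f ^^ n) z - z) / z ^ (n + 1)) \<midarrow>0\<rightarrow> of_nat n * b"
  proof (rule Lim_transform_eventually[OF iterate_rotation_limit[OF lim n, of n]])
    show "cis (2 * pi / n) ^ n = 1" using l1 by (simp add: l_def)
    show "\<forall>\<^sub>F z in at 0. ((f ^^ n) z / (cis (2 * pi / real n) ^ n * z) - 1) / z ^ n = ((f ^^ n) z - z) / z ^ (n + 1)"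
      unfolding l_def[symmetric] l1
      by (intro eventually_mono[OF eventually_at_0_nonzero]) (simp add: field_simps)
  qed
  from conjugate_limit[OF h C(4) this]
  have limG: "(\<lambda>z. ((G ^^ n) z - z) / z ^ (n + 1)) \<midarrow>0\<rightarrow> of_nat n * b / deriv h 0 ^ n"
    using b n by simp
  then show ?thesis
    using n b h(5) by (intro leau_fatou_flowerI[OF C(1,2) q limG]) auto
qed


section \<open>Charts of the disc\<close>

text \<open>The inverse function theorem for the flow of the transversal \<open>z\<^sub>1 = e\<^sup>i\<^sup>\<theta>\<close>. The transversal coordinate of
  the inverse is constant along \<open>X\<close>, so its differential is a multiple of \<open>\<omega>\<^sub>n(v) = det (X, v)\<close>; the factor is
  the reciprocal of the determinant of the two columns of the Jacobian.\<close>

lemma flow_box: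
  assumes n: "n \<ge> 1"
  obtains U V g where "open U" "open V" "(0, 0) \<in> U"
    "homeomorphism U V (\<lambda>p. flow n (fst p) (cis \<theta>, snd p)) g"
    "\<And>y. y \<in> V \<Longrightarrow> \<exists>c. c \<noteq> 0 \<and> ((\<lambda>y. snd (g y)) has_derivative (\<lambda>v. c * omega n y v)) (at y)"
proof -
  define \<Psi> where "\<Psi> = (\<lambda>p. flow n (fst p) (cis \<theta>, snd p))"
  define Z where "Z = (\<lambda>p::complex \<times> complex. (exp (of_nat n * fst p) * (of_nat n * snd p ^ (n - 1) * fst p), exp (fst p)))"
  define L where "L = (\<lambda>p v. cscale (fst v) (leaf_field n (\<Psi> p)) + cscale (snd v) (Z p))"
  have der: "(\<Psi> has_derivative L p) (at p)" for p
  proof -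
    define t z where "t = fst p" and "z = snd p"
    have E: "((\<lambda>p. exp (of_nat n * fst p)) has_derivative (\<lambda>v. exp (of_nat n * t) * (of_nat n * fst v))) (at p)"
      by (rule has_derivative_compose[where f = "\<lambda>p. of_nat n * fst p" and g = exp and f' = "\<lambda>v. of_nat n * fst v" and g' = "\<lambda>x. exp (of_nat n * t) * x"])
         (auto intro!: derivative_eq_intros simp: t_def has_field_derivative_def[symmetric])
    have e: "((\<lambda>p. exp (fst p)) has_derivative (\<lambda>v. exp t * fst v)) (at p)"
      by (rule has_derivative_compose[where f = fst and g = exp and f' = fst and g' = "\<lambda>x. exp t * x"])
         (auto intro!: derivative_eq_intros simp: t_def has_field_derivative_def[symmetric])
    have z: "((\<lambda>p. snd p ^ n) has_derivative (\<lambda>v. of_nat n * snd v * z ^ (n - 1))) (at p)"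
      using has_derivative_power[OF has_derivative_snd[OF has_derivative_ident], of n p UNIV] by (simp add: z_def)
    have zt: "((\<lambda>p. snd p ^ n * fst p) has_derivative (\<lambda>v. z ^ n * fst v + of_nat n * snd v * z ^ (n - 1) * t)) (at p)"
      using has_derivative_mult[OF z has_derivative_fst[OF has_derivative_ident]] by (simp add: t_def z_def)
    have 1: "((\<lambda>p. exp (of_nat n * fst p) * (cis \<theta> + snd p ^ n * fst p)) has_derivative
       (\<lambda>v. exp (of_nat n * t) * (z ^ n * fst v + of_nat n * snd v * z ^ (n - 1) * t)
          + exp (of_nat n * t) * (of_nat n * fst v) * (cis \<theta> + z ^ n * t))) (at p)"
      using has_derivative_mult[OF E has_derivative_add[OF has_derivative_const[of "cis \<theta>"] zt]] by (simp add: t_def z_def)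
    have 2: "((\<lambda>p. exp (fst p) * snd p) has_derivative (\<lambda>v. exp t * snd v + exp t * fst v * z)) (at p)"
      using has_derivative_mult[OF e has_derivative_snd[OF has_derivative_ident]] by (simp add: t_def z_def)
    have pw: "(exp t * z) ^ n = exp (of_nat n * t) * z ^ n" by (simp add: power_mult_distrib exp_of_nat_mult)
    have d: "(\<Psi> has_derivative (\<lambda>v. (exp (of_nat n * t) * (z ^ n * fst v + of_nat n * snd v * z ^ (n - 1) * t)
          + exp (of_nat n * t) * (of_nat n * fst v) * (cis \<theta> + z ^ n * t), exp t * snd v + exp t * fst v * z))) (at p)"
      using has_derivative_Pair[OF 1 2] by (simp add: \<Psi>_def flow_def)
    have Leq: "L p v = (exp (of_nat n * t) * (z ^ n * fst v + of_nat n * snd v * z ^ (n - 1) * t)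
          + exp (of_nat n * t) * (of_nat n * fst v) * (cis \<theta> + z ^ n * t), exp t * snd v + exp t * fst v * z)" for v
    proof -
      define B where "B = exp (of_nat n * t)"
      have "leaf_field n (\<Psi> p) = (of_nat n * (B * (cis \<theta> + z ^ n * t)) + B * z ^ n, exp t * z)"
        by (simp add: leaf_field_def \<Psi>_def flow_def t_def[symmetric] z_def[symmetric] pw B_def)
      moreover have "Z p = (B * (of_nat n * z ^ (n - 1) * t), exp t)" by (simp add: Z_def t_def z_def B_def)
      ultimately show ?thesis unfolding L_def B_def[symmetric] cscale_def by (simp add: algebra_simps)
    qed
    show ?thesis by (rule has_derivative_eq_rhs[OF d]) (simp only: fun_eq_iff Leq simp_thms)
  qed
  have blL: "bounded_linear (L p)" for p using der has_derivative_bounded_linear by blast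
  have applyL: "blinfun_apply (Blinfun (L p)) = L p" for p by (rule bounded_linear_Blinfun_apply[OF blL])
  have contL: "continuous_on UNIV (\<lambda>p. Blinfun (L p))"
  proof (rule continuous_on_blinfun_componentwise)
    fix i :: "complex \<times> complex"
    have "continuous_on UNIV (\<lambda>p. L p i)"
      unfolding L_def cscale_def leaf_field_def \<Psi>_def flow_def Z_def fst_conv snd_conv
      by (intro continuous_intros)
    then show "continuous_on UNIV (\<lambda>p. blinfun_apply (Blinfun (L p)) i)" by (simp only: applyL)
  qed
  \<comment> \<open>The inverse of the Jacobian at the centre.\<close>
  define I where "I = (\<lambda>v::complex \<times> complex. (fst v / (of_nat n * cis \<theta>), snd v))"
  have blI: "bounded_linear I"
    unfolding I_def by (intro bounded_linear_Pair bounded_linear_fst bounded_linear_snd bounded_linear_compose[OF bounded_linear_divide bounded_linear_fst])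
  have L0: "L (0, 0) v = (fst v * (of_nat n * cis \<theta>), snd v)" for v
    using n by (simp add: L_def cscale_def leaf_field_def \<Psi>_def Z_def power_0_left)
  have inv0: "Blinfun I o\<^sub>L Blinfun (L (0, 0)) = id_blinfun"
  proof (rule blinfun_eqI)
    fix v
    have "I (L (0, 0) v) = v" using n by (simp add: L0 I_def)
    then show "blinfun_apply (Blinfun I o\<^sub>L Blinfun (L (0, 0))) v = blinfun_apply id_blinfun v"
      by (simp only: blinfun_apply_blinfun_compose applyL bounded_linear_Blinfun_apply[OF blI] blinfun_apply_id_blinfun)
  qed
  define U0 where "U0 = {p :: complex \<times> complex. norm (snd p) < 1}"
  have U0: "open U0" unfolding U0_def by (intro open_Collect_less continuous_intros)
  have der0: "(\<Psi> has_derivative blinfun_apply (Blinfun (L p))) (at p)" for p unfolding applyL by (rule der)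
  have cont0: "continuous_on U0 (\<lambda>p. Blinfun (L p))" by (rule continuous_on_subset[OF contL]) simp
  have in0: "(0, 0) \<in> U0" by (simp add: U0_def)
  obtain U V g g' where U: "open U" "U \<subseteq> U0" "(0, 0) \<in> U" "open V" "\<Psi> (0, 0) \<in> V" "homeomorphism U V \<Psi> g"
    and g': "\<And>y. y \<in> V \<Longrightarrow> (g has_derivative (g' y)) (at y)"
    "\<And>y. y \<in> V \<Longrightarrow> g' y = inv (blinfun_apply (Blinfun (L (g y))))"
    "\<And>y. y \<in> V \<Longrightarrow> bij (blinfun_apply (Blinfun (L (g y))))"
    by (rule inverse_function_theorem[OF U0 der0 cont0 in0 inv0], rule that)
  have "\<exists>c. c \<noteq> 0 \<and> ((\<lambda>y. snd (g y)) has_derivative (\<lambda>v. c * omega n y v)) (at y)"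
    if y: "y \<in> V" for y
  proof -
    define p where "p = g y"
    have py: "\<Psi> p = y" "p \<in> U" using U(6) y by (auto simp: p_def homeomorphism_def)
    have Lg: "L p (g' y v) = v" for v
      using g'(2,3)[OF y] unfolding applyL p_def[symmetric] by (simp add: bij_is_surj surj_f_inv_f)
    define D where "D = cdet (leaf_field n (\<Psi> p)) (Z p)"
    have om: "omega n y v = snd (g' y v) * D" for v
    proof -
      have "omega n y v = cdet (leaf_field n (\<Psi> p)) (L p (g' y v))" by (simp add: omega_eq_cdet py Lg)
      also have "\<dots> = snd (g' y v) * D" by (simp add: L_def D_def cdet_def cscale_def algebra_simps)
      finally show ?thesis .
    qed
    have "D = exp (of_nat n * fst p) * exp (fst p) * (of_nat n * cis \<theta> + snd p ^ n)"
    proof -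
      define t z B where "t = fst p" and "z = snd p" and "B = exp (of_nat n * t)"
      have pw: "(exp t * z) ^ n = B * z ^ n" by (simp add: B_def power_mult_distrib exp_of_nat_mult)
      obtain k where k: "n = Suc k" using n by (cases n) auto
      have "leaf_field n (\<Psi> p) = (of_nat n * (B * (cis \<theta> + z ^ n * t)) + B * z ^ n, exp t * z)"
        by (simp add: leaf_field_def \<Psi>_def flow_def t_def[symmetric] z_def[symmetric] pw B_def[symmetric])
      moreover have "Z p = (B * (of_nat n * z ^ (n - 1) * t), exp t)" by (simp add: Z_def t_def z_def B_def)
      ultimately have "D = (of_nat n * (B * (cis \<theta> + z ^ n * t)) + B * z ^ n) * exp t - exp t * z * (B * (of_nat n * z ^ (n - 1) * t))"
        by (simp add: D_def cdet_def)
      also have "\<dots> = B * exp t * (of_nat n * cis \<theta> + z ^ n)"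
        unfolding k by (simp add: algebra_simps)
      finally show ?thesis by (simp add: t_def z_def B_def)
    qed
    moreover have "of_nat n * cis \<theta> + snd p ^ n \<noteq> 0"
    proof
      assume "of_nat n * cis \<theta> + snd p ^ n = 0"
      then have "snd p ^ n = - (of_nat n * cis \<theta>)" by (simp add: eq_neg_iff_add_eq_0 add.commute)
      then have "norm (snd p ^ n) = norm (of_nat n * cis \<theta>)" by (metis norm_minus_cancel)
      then have "norm (snd p) ^ n = real n" by (simp add: norm_power norm_mult)
      moreover have "norm (snd p) ^ n < 1"
        using power_strict_mono[of "norm (snd p)" 1 n] py(2) U(2) n by (auto simp: U0_def)
      ultimately show False using n by simp
    qed
    ultimately have D: "D \<noteq> 0" by simp
    have "((\<lambda>y. snd (g y)) has_derivative (\<lambda>v. snd (g' y v))) (at y)"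
      using has_derivative_snd[OF g'(1)[OF y]] .
    moreover have "snd (g' y v) = (1 / D) * omega n y v" for v using om D by simp
    ultimately show ?thesis using D by (intro exI[of _ "1 / D"]) simp
  qed
  then show ?thesis using that[OF U(1,4,3)] U(6) unfolding \<Psi>_def by blast
qed

lemma continuous_on_disc_pt: "continuous_on UNIV (disc_pt \<theta>)"
  unfolding disc_pt_def rho_def by (intro continuous_intros)

lemma disc_pt_0: "disc_pt \<theta> 0 = centre \<theta>"
  by (simp add: disc_pt_def rho_def centre_def)

text \<open>The chart follows the leaves to the complex transversal \<open>z\<^sub>1 = e\<^sup>i\<^sup>\<theta>\<close>. It is injective on the disc since two
  points of the disc with the same value would be a small complex time apart.\<close>

lemma standard_chart:
  assumes n: "n \<ge> 1"
  obtains W \<Phi> where "disc_chart n \<theta> W \<Phi>"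
    "\<And>e. e > 0 \<Longrightarrow> \<forall>\<^sub>F s in nhds 0. \<exists>\<tau>. norm \<tau> < e \<and> disc_pt \<theta> s = flow n \<tau> (cis \<theta>, \<Phi> (disc_pt \<theta> s))"
proof -
  obtain U V g where U: "open U" "open V" "(0, 0) \<in> U"
    and hom: "homeomorphism U V (\<lambda>p. flow n (fst p) (cis \<theta>, snd p)) g"
    and der: "\<And>y. y \<in> V \<Longrightarrow> \<exists>c. c \<noteq> 0 \<and> ((\<lambda>y. snd (g y)) has_derivative (\<lambda>v. c * omega n y v)) (at y)"
    by (rule flow_box[OF n, where \<theta> = \<theta>], rule that)
  define \<Phi> where "\<Phi> = (\<lambda>y. snd (g y))"
  have fg: "flow n (fst (g y)) (cis \<theta>, \<Phi> y) = y" if "y \<in> V" for y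
    using hom that by (simp add: homeomorphism_def \<Phi>_def)
  have c: "centre \<theta> = flow n (fst (0::complex, 0::complex)) (cis \<theta>, snd (0::complex, 0::complex))"
    by (simp add: centre_def)
  have cV: "centre \<theta> \<in> V" using hom U(3) unfolding c homeomorphism_def by blast
  have gc: "g (centre \<theta>) = (0, 0)" using hom U(3) unfolding c homeomorphism_def by blast
  have contg: "continuous_on V g" using hom by (simp add: homeomorphism_def)
  obtain d where d: "d > 0" "\<And>s \<tau>. norm s < d \<Longrightarrow> norm \<tau> \<le> 1 / n \<Longrightarrow> flow n \<tau> (disc_pt \<theta> s) \<in> disc \<theta> \<Longrightarrow> \<tau> = 0"
    using disc_meets_small_leaf_once[OF n, of \<theta>] unfolding eventually_nhds_metric by (auto simp: dist_norm)
  define V' where "V' = V \<inter> ((\<lambda>y. norm (fst (g y))) -` {..<1 / (2 * real n)})"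
  have "open V'" unfolding V'_def
    using U(2) contg by (intro continuous_open_preimage continuous_intros) auto
  define O' where "O' = V' \<inter> {y. norm (snd y) < d}"
  have opO: "open O'"
    unfolding O'_def by (intro open_Int \<open>open V'\<close> open_Collect_less continuous_intros)
  define W where "W = S3 \<inter> O'"
  have cW: "centre \<theta> \<in> W"
    using cV d(1) n by (simp add: W_def O'_def V'_def gc) (simp add: centre_def norm_Pair)
  have inj: "inj_on \<Phi> (W \<inter> disc \<theta>)"
  proof (rule inj_onI)
    fix y y' assume y: "y \<in> W \<inter> disc \<theta>" and y': "y' \<in> W \<inter> disc \<theta>" and eq: "\<Phi> y = \<Phi> y'"
    have yV: "y \<in> V" "y' \<in> V" using y y' by (auto simp: W_def O'_def V'_def)
    define t where "t = fst (g y') - fst (g y)"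
    have "y' = flow n (t + fst (g y)) (cis \<theta>, \<Phi> y)" using fg[OF yV(2)] by (simp add: t_def eq)
    also have "\<dots> = flow n t y" unfolding flow_add fg[OF yV(1)] ..
    also have "y = disc_pt \<theta> (snd y)" using in_discD(2) y by blast
    finally have y'e: "y' = flow n t (disc_pt \<theta> (snd y))" .
    have "norm t \<le> norm (fst (g y')) + norm (fst (g y))" unfolding t_def by (rule norm_triangle_ineq4)
    also have "\<dots> \<le> 1 / (2 * real n) + 1 / (2 * real n)"
      using y y' by (intro add_mono) (auto simp: W_def O'_def V'_def)
    finally have "norm t \<le> 1 / n" by (simp add: field_simps)
    moreover have "norm (snd y) < d" using y by (auto simp: W_def O'_def)
    moreover have "flow n t (disc_pt \<theta> (snd y)) \<in> disc \<theta>" using y' y'e by simp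
    ultimately have "t = 0" using d(2) by blast
    then show "y = y'" using y'e \<open>y = disc_pt \<theta> (snd y)\<close> by simp
  qed
  have "disc_chart n \<theta> W \<Phi>"
    unfolding disc_chart_def transverse_chart_def
  proof (intro conjI ballI)
    show "openin (top_of_set S3) W" unfolding W_def using opO by (simp add: openin_open_Int)
    show "\<exists>c. c \<noteq> 0 \<and> (\<Phi> has_derivative (\<lambda>v. c * omega n p v)) (at p within S3)"
      if "p \<in> W" for p
      using der[of p] that has_derivative_at_withinI unfolding \<Phi>_def W_def O'_def V'_def by blast
    show "\<Phi> (centre \<theta>) = 0" by (simp add: \<Phi>_def gc)
  qed (use cW inj in auto)
  moreover have "\<forall>\<^sub>F s in nhds 0. \<exists>\<tau>. norm \<tau> < e \<and> disc_pt \<theta> s = flow n \<tau> (cis \<theta>, \<Phi> (disc_pt \<theta> s))"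
    if e: "e > 0" for e
  proof -
    define B where "B = V \<inter> ((\<lambda>y. norm (fst (g y))) -` {..<e})"
    have "open B" unfolding B_def using U(2) contg by (intro continuous_open_preimage continuous_intros) auto
    then have "open (disc_pt \<theta> -` B)" using continuous_on_disc_pt by (rule open_vimage)
    moreover have "0 \<in> disc_pt \<theta> -` B" using cV e by (simp add: B_def disc_pt_0 gc)
    ultimately have "\<forall>\<^sub>F s in nhds 0. s \<in> disc_pt \<theta> -` B"
      using eventually_nhds by blast
    then show ?thesis
    proof eventually_elim
      case (elim s)
      then show ?case
        using fg[of "disc_pt \<theta> s"] by (intro exI[of _ "fst (g (disc_pt \<theta> s))"]) (auto simp: B_def)
    qed
  qed
  ultimately show ?thesis using that by blast
qed


definition disc_tangent :: "real \<Rightarrow> complex \<Rightarrow> complex \<Rightarrow> complex \<times> complex" where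
  "disc_tangent \<theta> s d = (of_real (- (inner s d / rho s)) * cis \<theta>, d)"

text \<open>The differential of any transverse chart along the disc, up to a nonzero complex factor.\<close>

definition disc_slope :: "nat \<Rightarrow> real \<Rightarrow> complex \<Rightarrow> complex \<Rightarrow> complex" where
  "disc_slope n \<theta> s d = omega n (disc_pt \<theta> s) (disc_tangent \<theta> s d)"

lemma disc_pt_derivative:
  assumes "norm s < 1"
  shows "(disc_pt \<theta> has_derivative disc_tangent \<theta> s) (at s)"
proof -
  have r: "rho s > 0" using rho_pos(1)[OF assms] .
  have e: "rho = (\<lambda>s. sqrt (1 - inner s s))" by (simp add: rho_def fun_eq_iff dot_square_norm)
  have pos: "1 - inner s s > 0" using r unfolding e by simp
  have "((\<lambda>s. 1 - inner s s) has_derivative (\<lambda>d. 0 - (inner s d + inner d s))) (at s)"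
    by (intro has_derivative_diff has_derivative_const has_derivative_inner has_derivative_ident)
  from has_derivative_real_sqrt[OF pos this]
  have "(rho has_derivative (\<lambda>d. (0 - (inner s d + inner d s)) * (inverse (sqrt (1 - inner s s)) / 2))) (at s)"
    unfolding e .
  moreover have "(0 - (inner s d + inner d s)) * (inverse (sqrt (1 - inner s s)) / 2) = - (inner s d / rho s)" for d
    using r unfolding e by (simp add: inner_commute field_simps)
  ultimately have "(rho has_derivative (\<lambda>d. - (inner s d / rho s))) (at s)" by simp
  then have "((\<lambda>s. of_real (rho s) * cis \<theta>) has_derivative (\<lambda>d. of_real (- (inner s d / rho s)) * cis \<theta>)) (at s)"
    by (intro has_derivative_mult_left has_derivative_of_real)
  from has_derivative_Pair[OF this has_derivative_ident]
  show ?thesis by (simp add: disc_pt_def[abs_def] disc_tangent_def[abs_def])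
qed

lemma linear_disc_slope: "linear (disc_slope n \<theta> s)"
proof (rule linearI)
  show "disc_slope n \<theta> s (c *\<^sub>R d) = c *\<^sub>R disc_slope n \<theta> s d" for c d
  proof -
    have "disc_slope n \<theta> s (c *\<^sub>R d) = omega n (disc_pt \<theta> s) (of_real (- (c * inner s d / rho s)) * cis \<theta>, of_real c * d)"
      unfolding disc_slope_def disc_tangent_def inner_scaleR_right by (simp only: scaleR_conv_of_real)
    then show ?thesis
      by (simp add: disc_slope_def disc_tangent_def omega_def scaleR_conv_of_real algebra_simps)
  qed
qed (simp add: disc_slope_def disc_tangent_def omega_def inner_add_right add_divide_distrib algebra_simps)

text \<open>For small \<open>s\<close> the term \<open>n \<rho> e\<^sup>i\<^sup>\<theta> d\<close> dominates the other two.\<close>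

lemma disc_transverse:
  assumes n: "n \<ge> 1" and s: "norm s < 1/4" and d: "disc_slope n \<theta> s d = 0"
  shows "d = 0"
proof -
  have "(norm s)\<^sup>2 \<le> (1/4)\<^sup>2" using s by (intro power_mono) auto
  then have s2: "(norm s)\<^sup>2 \<le> 1/16" by (simp add: power2_eq_square)
  then have "(3/4)\<^sup>2 \<le> (rho s)\<^sup>2" using rho_pos(2)[of s] s by (simp add: power2_eq_square)
  then have r: "rho s \<ge> 3/4" using rho_pos(1)[of s] s by (intro power2_le_imp_le[of "3/4"]) auto
  define a where "a = of_nat n * of_real (rho s) * cis \<theta> * d"
  define b where "b = s ^ n * d"
  define c where "c = s * of_real (inner s d / rho s) * cis \<theta>"
  have "disc_slope n \<theta> s d = a + b + c"
    by (simp add: disc_slope_def disc_tangent_def omega_def disc_pt_def a_def b_def c_def algebra_simps)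
  then have "a + (b + c) = 0" using d by (simp add: add.assoc)
  then have "a = - (b + c)" by (rule eq_neg_iff_add_eq_0[THEN iffD2])
  then have "norm a = norm (b + c)" by (simp only: norm_minus_cancel)
  then have "norm a \<le> norm b + norm c" using norm_triangle_ineq[of b c] by simp
  moreover have "norm a \<ge> 1 * (3/4) * norm d"
  proof -
    have "1 * (3/4) \<le> real n * rho s" using n r by (intro mult_mono) auto
    from mult_right_mono[OF this norm_ge_zero[of d]] show ?thesis using r by (simp add: a_def norm_mult)
  qed
  moreover have "norm b \<le> 1/4 * norm d"
  proof -
    have "norm s ^ n \<le> norm s ^ 1" using n s by (intro power_decreasing) auto
    then show ?thesis unfolding b_def norm_mult norm_power using s by (intro mult_right_mono) auto
  qed
  moreover have "norm c \<le> 1/12 * norm d"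
  proof -
    have "\<bar>inner s d / rho s\<bar> \<le> (norm s * norm d) / (3/4)"
      unfolding abs_divide using r Cauchy_Schwarz_ineq2[of s d] by (intro frac_le) auto
    then have "norm s * \<bar>inner s d / rho s\<bar> \<le> norm s * ((norm s * norm d) / (3/4))"
      by (intro mult_left_mono) auto
    also have "\<dots> = (norm s)\<^sup>2 * (4/3 * norm d)" by (simp add: power2_eq_square)
    also have "\<dots> \<le> 1/16 * (4/3 * norm d)" using s2 by (intro mult_right_mono) auto
    finally show ?thesis unfolding c_def norm_mult norm_of_real by simp
  qed
  ultimately have "norm d \<le> 0" by linarith
  then show ?thesis by simp
qed

lemma disc_chart_pullback:
  assumes n: "n \<ge> 1" and chart: "disc_chart n \<theta> W \<Phi>"
  obtains r where "r > 0" "r \<le> 1/4" "\<And>s. norm s < r \<Longrightarrow> disc_pt \<theta> s \<in> W \<inter> disc \<theta>"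
    "inj_on (\<lambda>s. \<Phi> (disc_pt \<theta> s)) (ball 0 r)"
    "\<And>s. norm s < r \<Longrightarrow> \<exists>c. c \<noteq> 0 \<and> ((\<lambda>s. \<Phi> (disc_pt \<theta> s)) has_derivative (\<lambda>d. c * disc_slope n \<theta> s d)) (at s)"
proof -
  have W: "openin (top_of_set S3) W" "centre \<theta> \<in> W" "inj_on \<Phi> (W \<inter> disc \<theta>)"
    and der: "\<And>p. p \<in> W \<Longrightarrow> \<exists>c. c \<noteq> 0 \<and> (\<Phi> has_derivative (\<lambda>v. c * omega n p v)) (at p within S3)"
    using chart by (auto simp: disc_chart_def transverse_chart_def)
  obtain B where B: "open B" "W = S3 \<inter> B" using W(1) by (auto simp: openin_open)
  have "open (disc_pt \<theta> -` B)" using B(1) continuous_on_disc_pt by (rule open_vimage)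
  moreover have "0 \<in> disc_pt \<theta> -` B" using W(2) B(2) by (simp add: disc_pt_0)
  ultimately obtain r0 where r0: "r0 > 0" "ball 0 r0 \<subseteq> disc_pt \<theta> -` B"
    using open_contains_ball by blast
  define r where "r = min r0 (1/4)"
  have r: "r > 0" "r \<le> 1/4" using r0 by (auto simp: r_def)
  have inW: "disc_pt \<theta> s \<in> W \<inter> disc \<theta>" if "norm s < r" for s
  proof -
    have "s \<in> ball 0 r0" "norm s < 1" using that by (auto simp: r_def)
    then have "disc_pt \<theta> s \<in> B" "disc_pt \<theta> s \<in> disc \<theta>"
      using r0(2) disc_pt_in_disc by auto
    then show ?thesis by (simp add: B disc_def)
  qed
  have "inj_on (\<lambda>s. \<Phi> (disc_pt \<theta> s)) (ball 0 r)"
  proof (rule inj_onI)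
    fix s t assume st: "s \<in> ball 0 r" "t \<in> ball 0 r" "\<Phi> (disc_pt \<theta> s) = \<Phi> (disc_pt \<theta> t)"
    have "disc_pt \<theta> s = disc_pt \<theta> t" using inj_onD[OF W(3) st(3)] inW st by simp
    then show "s = t" by (simp add: disc_pt_def)
  qed
  moreover have "\<exists>c. c \<noteq> 0 \<and> ((\<lambda>s. \<Phi> (disc_pt \<theta> s)) has_derivative (\<lambda>d. c * disc_slope n \<theta> s d)) (at s)"
    if s: "norm s < r" for s
  proof -
    obtain c where c: "c \<noteq> 0" "(\<Phi> has_derivative (\<lambda>v. c * omega n (disc_pt \<theta> s) v)) (at (disc_pt \<theta> s) within S3)"
      using der inW[OF s] by blast
    have sub: "disc_pt \<theta> ` ball 0 r \<subseteq> S3" using inW B(2) by auto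
    have at: "at s within ball 0 r = at s" using s by (intro at_within_open) auto
    have "norm s < 1" using s r by simp
    then have "(disc_pt \<theta> has_derivative disc_tangent \<theta> s) (at s within ball 0 r)"
      using disc_pt_derivative has_derivative_at_withinI by blast
    from has_derivative_in_compose[OF this has_derivative_subset[OF c(2) sub]]
    show ?thesis using c(1) unfolding at disc_slope_def by blast
  qed
  ultimately show ?thesis using that[OF r inW] by blast
qed

text \<open>Along the disc both charts have the real differential \<open>disc_slope\<close> up to a complex factor. It cancels in
  the transition map, whose differential is therefore multiplication by the quotient of the factors;
  this is complex linear, so the transition map is holomorphic.\<close>

lemma chart_transition:
  assumes n: "n \<ge> 1" and charts: "disc_chart n \<theta> W1 \<Phi>1" "disc_chart n \<theta> W2 \<Phi>2"
  obtains r h where "r > 0"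
    "\<And>s. norm s < r \<Longrightarrow> disc_pt \<theta> s \<in> W1 \<inter> W2 \<inter> disc \<theta>"
    "open ((\<lambda>s. \<Phi>1 (disc_pt \<theta> s)) ` ball 0 r)"
    "h holomorphic_on (\<lambda>s. \<Phi>1 (disc_pt \<theta> s)) ` ball 0 r"
    "inj_on h ((\<lambda>s. \<Phi>1 (disc_pt \<theta> s)) ` ball 0 r)"
    "\<And>s. norm s < r \<Longrightarrow> h (\<Phi>1 (disc_pt \<theta> s)) = \<Phi>2 (disc_pt \<theta> s)"
    "h 0 = 0" "deriv h 0 \<noteq> 0" "0 \<in> (\<lambda>s. \<Phi>1 (disc_pt \<theta> s)) ` ball 0 r"
    "\<And>d. 0 < d \<Longrightarrow> d \<le> r \<Longrightarrow> open ((\<lambda>s. \<Phi>1 (disc_pt \<theta> s)) ` ball 0 d)"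
proof -
  define S1 where "S1 = (\<lambda>s. \<Phi>1 (disc_pt \<theta> s))"
  define S2 where "S2 = (\<lambda>s. \<Phi>2 (disc_pt \<theta> s))"
  obtain r1 where r1: "r1 > 0" "r1 \<le> 1/4" "\<And>s. norm s < r1 \<Longrightarrow> disc_pt \<theta> s \<in> W1 \<inter> disc \<theta>" "inj_on S1 (ball 0 r1)"
    "\<And>s. norm s < r1 \<Longrightarrow> \<exists>c. c \<noteq> 0 \<and> (S1 has_derivative (\<lambda>d. c * disc_slope n \<theta> s d)) (at s)"
    by (rule disc_chart_pullback[OF n charts(1), folded S1_def], rule that)
  obtain r2 where r2: "r2 > 0" "r2 \<le> 1/4" "\<And>s. norm s < r2 \<Longrightarrow> disc_pt \<theta> s \<in> W2 \<inter> disc \<theta>" "inj_on S2 (ball 0 r2)"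
    "\<And>s. norm s < r2 \<Longrightarrow> \<exists>c. c \<noteq> 0 \<and> (S2 has_derivative (\<lambda>d. c * disc_slope n \<theta> s d)) (at s)"
    by (rule disc_chart_pullback[OF n charts(2), folded S2_def], rule that)
  define r where "r = min r1 r2"
  have r: "r > 0" "r \<le> r1" "r \<le> r2" "r \<le> 1/4" using r1 r2 by (auto simp: r_def)
  have cont1: "continuous_on (ball 0 r) S1"
  proof (intro continuous_at_imp_continuous_on ballI)
    fix s :: complex assume "s \<in> ball 0 r"
    then have "norm s < r1" using r by simp
    then show "isCont S1 s" using r1(5) has_derivative_continuous by blast
  qed
  have inj1: "inj_on S1 (ball 0 r)" using r1(4) r by (rule_tac inj_on_subset) auto
  have inj2: "inj_on S2 (ball 0 r)" using r2(4) r by (rule_tac inj_on_subset) auto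
  have op: "open (S1 ` ball 0 d)" if "0 < d" "d \<le> r" for d
    using that by (intro invariance_of_domain continuous_on_subset[OF cont1] inj_on_subset[OF inj1]) auto
  define R where "R = inv_into (ball 0 r) S1"
  have R: "R (S1 s) = s" if "s \<in> ball 0 r" for s using that inj1 by (simp add: R_def)
  define h where "h = (\<lambda>z. S2 (R z))"
  have hS: "h (S1 s) = S2 s" if "norm s < r" for s using R that by (simp add: h_def)
  have der: "\<exists>c. c \<noteq> 0 \<and> (h has_field_derivative c) (at (S1 s))" if s: "norm s < r" for s
  proof -
    obtain c1 where c1: "c1 \<noteq> 0" "(S1 has_derivative (\<lambda>d. c1 * disc_slope n \<theta> s d)) (at s)"
      using r1(5) s r by force
    obtain c2 where c2: "c2 \<noteq> 0" "(S2 has_derivative (\<lambda>d. c2 * disc_slope n \<theta> s d)) (at s)"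
      using r2(5) s r by force
    have "norm s < 1/4" using s r by simp
    then have "inj (disc_slope n \<theta> s)"
      using linear_injective_0[OF linear_disc_slope] disc_transverse[OF n] by blast
    then obtain T where T: "\<And>x. disc_slope n \<theta> s (T x) = x"
      using linear_injective_isomorphism[OF linear_disc_slope] by metis
    have "(R has_derivative (\<lambda>x. T (x / c1))) (at (S1 s))"
    proof (rule has_derivative_inverse_strong[where S = "ball 0 r" and f = S1 and f' = "\<lambda>d. c1 * disc_slope n \<theta> s d"])
      show "(\<lambda>d. c1 * disc_slope n \<theta> s d) \<circ> (\<lambda>x. T (x / c1)) = id"
        using c1(1) by (simp add: fun_eq_iff T)
    qed (use s R cont1 c1 in auto)
    moreover have "(S2 has_derivative (\<lambda>d. c2 * disc_slope n \<theta> s d)) (at (R (S1 s)))"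
      using c2(2) R s by simp
    ultimately have "(h has_derivative (\<lambda>x. c2 * disc_slope n \<theta> s (T (x / c1)))) (at (S1 s))"
      unfolding h_def by (rule has_derivative_compose)
    moreover have "(\<lambda>x. c2 * disc_slope n \<theta> s (T (x / c1))) = (*) (c2 / c1)"
      by (simp add: T fun_eq_iff)
    ultimately have "(h has_field_derivative c2 / c1) (at (S1 s))" by (simp add: has_field_derivative_def)
    then show ?thesis using c1 c2 by (intro exI[of _ "c2 / c1"]) simp
  qed
  have S0: "S1 0 = 0" "S2 0 = 0"
    using charts by (simp_all add: S1_def S2_def disc_pt_0 disc_chart_def)
  have hol: "h holomorphic_on S1 ` ball 0 r"
    unfolding holomorphic_on_def field_differentiable_def
  proof
    fix z assume "z \<in> S1 ` ball 0 r"
    then obtain s where "norm s < r" "z = S1 s" by auto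
    then show "\<exists>c. (h has_field_derivative c) (at z within S1 ` ball 0 r)"
      using der has_field_derivative_at_within by blast
  qed
  have injh: "inj_on h (S1 ` ball 0 r)"
  proof (rule inj_onI, elim imageE)
    fix x y s t assume *: "h x = h y" "x = S1 s" "s \<in> ball 0 r" "y = S1 t" "t \<in> ball 0 r"
    then have "S2 s = S2 t" using hS by simp
    then have "s = t" using inj_onD[OF inj2 _ *(3,5)] by simp
    then show "x = y" using * by simp
  qed
  have h0: "h 0 = 0" using hS[of 0] r S0 by simp
  have "deriv h 0 \<noteq> 0" using der[of 0] r S0 DERIV_imp_deriv by fastforce
  moreover have "0 \<in> S1 ` ball 0 r" using S0(1) r(1) by force
  moreover have "disc_pt \<theta> s \<in> W1 \<inter> W2 \<inter> disc \<theta>"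
    if "norm s < r" for s using r1(3)[of s] r2(3)[of s] r that by auto
  ultimately show ?thesis
    using r(1) op[OF r(1) order_refl] hol injh hS h0 op unfolding S1_def S2_def by (intro that[of r h])
qed

lemma flow_to_transversal:
  assumes "flow n \<tau> (cis \<theta>, z) = (cis \<theta>, w)"
  shows "exp (of_nat n * \<tau>) * (cis \<theta> + z ^ n * \<tau>) = cis \<theta>" "w = z * exp \<tau>"
  using assms by (simp_all add: flow_def mult.commute)

section \<open>The return map in a chart\<close>

text \<open>A point of the disc is reached from its chart value on the transversal in small complex time. The
  return therefore carries the value \<open>z\<close> to \<open>w\<close> in the complex time \<open>- \<tau>' + \<tau>\<^sub>1 + \<tau>\<close>, which is close to \<open>2\<pi>i/n\<close>,
  and the model germ is defined by exactly this relation.\<close>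

lemma return_map_conjugate_to_model:
  assumes n: "n \<ge> 1" and r: "r > 0"
    and near: "\<And>e. e > 0 \<Longrightarrow> \<forall>\<^sub>F s in nhds 0. \<exists>\<tau>. norm \<tau> < e \<and> disc_pt \<theta> s = flow n \<tau> (cis \<theta>, \<Phi> (disc_pt \<theta> s))"
    and f: "\<And>z \<tau>. norm (\<tau> - return_time n) < r \<Longrightarrow>
       exp (of_nat n * \<tau>) * (cis \<theta> + z ^ n * \<tau>) = cis \<theta> \<Longrightarrow> f z = z * exp \<tau>"
    and d: "d > 0"
  shows "\<forall>\<^sub>F s in nhds 0. \<exists>s'. return_map n \<theta> (disc_pt \<theta> s) = disc_pt \<theta> s' \<and> norm s' < d \<and>
    \<Phi> (disc_pt \<theta> s') = f (\<Phi> (disc_pt \<theta> s))"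
proof -
  define e where "e = min (r / 4) 1"
  have e: "e > 0" "e \<le> r / 4" "e \<le> 1" using r by (auto simp: e_def)
  define T0 where "T0 = return_time n"
  obtain d1 where d1: "d1 > 0" "\<And>s. norm s < d1 \<Longrightarrow> \<exists>\<tau>. norm \<tau> < e \<and> disc_pt \<theta> s = flow n \<tau> (cis \<theta>, \<Phi> (disc_pt \<theta> s))"
    using near[OF e(1)] unfolding eventually_nhds_metric by (auto simp: dist_norm)
  define K where "K = exp (norm T0 + 1)"
  have "((\<lambda>s::complex. K * norm s) \<longlongrightarrow> K * norm (0::complex)) (nhds 0)"
    by (intro tendsto_intros filterlim_ident)
  then have small: "\<forall>\<^sub>F s::complex in nhds 0. K * norm s < min d d1"
    by (rule order_tendstoD(2)) (use d d1 in simp)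
  show ?thesis
    using first_return_near_centre[OF n e(1), of \<theta>] near[OF e(1)] small
  proof eventually_elim
    case (elim s)
    obtain \<tau>1 where \<tau>1: "norm (\<tau>1 - T0) \<le> e" "first_return n \<theta> (disc_pt \<theta> s) (flow n \<tau>1 (disc_pt \<theta> s))"
      "\<And>q. first_return n \<theta> (disc_pt \<theta> s) q \<Longrightarrow> q = flow n \<tau>1 (disc_pt \<theta> s)"
      using elim(1) by (auto simp: T0_def)
    obtain \<tau> where \<tau>: "norm \<tau> < e" "disc_pt \<theta> s = flow n \<tau> (cis \<theta>, \<Phi> (disc_pt \<theta> s))"
      using elim(2) by blast
    define s' where "s' = exp \<tau>1 * s"
    have "flow n \<tau>1 (disc_pt \<theta> s) \<in> disc \<theta>"
      using \<tau>1(2) by (simp add: first_return_def)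
    from in_discD(2)[OF this] have fl: "flow n \<tau>1 (disc_pt \<theta> s) = disc_pt \<theta> s'"
      by (simp add: flow_disc_pt s'_def)
    have ret: "return_map n \<theta> (disc_pt \<theta> s) = disc_pt \<theta> s'"
      unfolding return_map_def fl[symmetric] using \<tau>1(2,3) by (rule the_equality)
    have "norm \<tau>1 \<le> norm T0 + 1" using \<tau>1(1) e(3) norm_triangle_sub[of \<tau>1 T0] by linarith
    then have "Re \<tau>1 \<le> norm T0 + 1" using complex_Re_le_cmod[of \<tau>1] by linarith
    then have "norm s' \<le> K * norm s" by (simp add: s'_def K_def norm_mult mult_right_mono)
    then have s': "norm s' < d" "norm s' < d1" using elim(3) by auto
    obtain \<tau>' where \<tau>': "norm \<tau>' < e" "disc_pt \<theta> s' = flow n \<tau>' (cis \<theta>, \<Phi> (disc_pt \<theta> s'))"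
      using d1(2)[OF s'(2)] by blast
    define z w T where "z = \<Phi> (disc_pt \<theta> s)" and "w = \<Phi> (disc_pt \<theta> s')" and "T = - \<tau>' + (\<tau>1 + \<tau>)"
    have "flow n T (cis \<theta>, z) = flow n (- \<tau>') (flow n \<tau>1 (flow n \<tau> (cis \<theta>, z)))"
      unfolding T_def flow_add ..
    also have "\<dots> = flow n (- \<tau>') (disc_pt \<theta> s')" unfolding z_def \<tau>(2)[symmetric] fl ..
    also have "\<dots> = flow n (- \<tau>' + \<tau>') (cis \<theta>, w)"
      unfolding flow_add w_def \<tau>'(2)[symmetric] ..
    finally have "flow n T (cis \<theta>, z) = (cis \<theta>, w)" by simp
    note T = flow_to_transversal[OF this]
    have T_eq: "T - T0 = (\<tau>1 - T0) + (\<tau> - \<tau>')" by (simp add: T_def)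
    have "norm (T - T0) \<le> norm (\<tau>1 - T0) + (norm \<tau> + norm \<tau>')"
      using norm_triangle_ineq[of "\<tau>1 - T0" "\<tau> - \<tau>'"] norm_triangle_ineq4[of \<tau> \<tau>'] unfolding T_eq by linarith
    then have "norm (T - return_time n) < r" using \<tau>1(1) \<tau>(1) \<tau>'(1) e r by (simp add: T0_def)
    then have "f z = w" using f T by simp
    then show ?case using ret s' by (intro exI[of _ s']) (simp add: z_def w_def)
  qed
qed

lemma return_germ_flower:
  assumes n: "n \<ge> 1" and chart: "disc_chart n \<theta> W \<Phi>"
  shows "leau_fatou_flower (return_germ n \<theta> W \<Phi>) n"
proof -
  obtain W0 \<Phi>0 where chart0: "disc_chart n \<theta> W0 \<Phi>0"
    and near: "\<And>e. e > 0 \<Longrightarrow> \<forall>\<^sub>F s in nhds 0. \<exists>\<tau>. norm \<tau> < e \<and> disc_pt \<theta> s = flow n \<tau> (cis \<theta>, \<Phi>0 (disc_pt \<theta> s))"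
    by (rule standard_chart[OF n, where \<theta> = \<theta>], rule that)
  obtain f r0 where f: "f analytic_on {0}" "f 0 = 0" "deriv f 0 = cis (2 * pi / n)" "r0 > 0"
    "\<And>z \<tau>. norm (\<tau> - return_time n) < r0 \<Longrightarrow>
       exp (of_nat n * \<tau>) * (cis \<theta> + z ^ n * \<tau>) = cis \<theta> \<Longrightarrow> f z = z * exp \<tau>"
    "(\<lambda>z. (f z / (cis (2 * pi / n) * z) - 1) / z ^ n) \<midarrow>0\<rightarrow> - return_time n / (of_nat n * cis \<theta>)"
    by (rule model_germ[OF n, where \<theta> = \<theta>], rule that)
  define S0 where "S0 = (\<lambda>s. \<Phi>0 (disc_pt \<theta> s))"
  obtain r h where r: "r > 0" "\<And>s. norm s < r \<Longrightarrow> disc_pt \<theta> s \<in> W0 \<inter> W \<inter> disc \<theta>"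
    and h: "open (S0 ` ball 0 r)" "h holomorphic_on S0 ` ball 0 r" "inj_on h (S0 ` ball 0 r)"
    and hS': "\<And>s. norm s < r \<Longrightarrow> h (\<Phi>0 (disc_pt \<theta> s)) = \<Phi> (disc_pt \<theta> s)"
    and h0: "h 0 = 0" "deriv h 0 \<noteq> 0" "0 \<in> S0 ` ball 0 r"
    and op: "\<And>d. 0 < d \<Longrightarrow> d \<le> r \<Longrightarrow> open (S0 ` ball 0 d)"
    by (rule chart_transition[OF n chart0 chart, folded S0_def], rule that)
  have hS: "h (S0 s) = \<Phi> (disc_pt \<theta> s)"
    if "norm s < r" for s using hS'[OF that] by (simp add: S0_def)
  have "\<forall>\<^sub>F s in nhds 0. \<exists>s'. return_map n \<theta> (disc_pt \<theta> s) = disc_pt \<theta> s' \<and> norm s' < r \<and> S0 s' = f (S0 s)"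
    unfolding S0_def by (rule return_map_conjugate_to_model[OF n f(4) near f(5) r(1)])
  then obtain d where d: "d > 0" "\<And>s. norm s < d \<Longrightarrow> \<exists>s'. return_map n \<theta> (disc_pt \<theta> s) = disc_pt \<theta> s' \<and> norm s' < r \<and> S0 s' = f (S0 s)"
    unfolding eventually_nhds_metric dist_0_norm[symmetric] dist_commute[of 0] by blast
  define d' where "d' = min d r"
  have d': "0 < d'" "d' \<le> r" "d' \<le> d" using d r by (auto simp: d'_def)
  have "S0 0 = 0" using chart0 by (simp add: S0_def disc_pt_0 disc_chart_def)
  then have "0 \<in> S0 ` ball 0 d'" using d'(1) by force
  then have "\<forall>\<^sub>F z in nhds 0. z \<in> S0 ` ball 0 d'"
    using op[OF d'(1,2)] eventually_nhds by blast
  then have conj: "\<forall>\<^sub>F z in nhds 0. return_germ n \<theta> W \<Phi> (h z) = h (f z)"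
  proof eventually_elim
    case (elim z)
    then obtain s where s: "norm s < d'" "z = S0 s" by auto
    have sr: "norm s < r" "norm s < d" using s d' by auto
    obtain s' where s': "return_map n \<theta> (disc_pt \<theta> s) = disc_pt \<theta> s'" "norm s' < r" "S0 s' = f (S0 s)"
      using d(2)[OF sr(2)] by blast
    have "inj_on \<Phi> (W \<inter> disc \<theta>)" using chart by (simp add: disc_chart_def)
    then have "inv_into (W \<inter> disc \<theta>) \<Phi> (\<Phi> (disc_pt \<theta> s)) = disc_pt \<theta> s"
      using r(2)[OF sr(1)] by (intro inv_into_f_f) auto
    then have "return_germ n \<theta> W \<Phi> (h z) = \<Phi> (disc_pt \<theta> s')"
      by (simp add: return_germ_def s(2) hS[OF sr(1)] s'(1))
    also have "\<dots> = h (f z)" using hS[OF s'(2)] s'(3) s(2) by simp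
    finally show ?case .
  qed
  have "- return_time n / (of_nat n * cis \<theta>) \<noteq> 0" using n by (simp add: return_time_def)
  then show ?thesis
    using conjugate_of_rotation_flower[OF n f(1,2,3,6) _ h(2,1) h0(3,1,2) h(3) conj] by blast
qed

theorem proposition6p8:
  fixes n :: nat and \<theta> :: real
  assumes "n \<ge> 1"
  shows "(\<forall>\<^sub>F p in nhds (centre \<theta>). p \<in> disc \<theta> \<longrightarrow> (\<exists>!q. first_return n \<theta> p q)) \<and>
         (\<exists>W \<Phi>. disc_chart n \<theta> W \<Phi>) \<and>
         (\<forall>W \<Phi>. disc_chart n \<theta> W \<Phi> \<longrightarrow> leau_fatou_flower (return_germ n \<theta> W \<Phi>) n)"
proof (intro conjI allI impI)
  have "\<forall>\<^sub>F s in nhds 0. \<exists>!q. first_return n \<theta> (disc_pt \<theta> s) q"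
    using first_return_near_centre[OF assms zero_less_one, of \<theta>] by eventually_elim blast
  moreover have "filterlim (snd :: complex \<times> complex \<Rightarrow> complex) (nhds 0) (nhds (centre \<theta>))"
    using tendsto_snd[OF filterlim_ident, of "centre \<theta>"] by (simp add: centre_def)
  ultimately have "\<forall>\<^sub>F p in nhds (centre \<theta>). \<exists>!q. first_return n \<theta> (disc_pt \<theta> (snd p)) q"
    by (rule eventually_compose_filterlim)
  then show "\<forall>\<^sub>F p in nhds (centre \<theta>). p \<in> disc \<theta> \<longrightarrow> (\<exists>!q. first_return n \<theta> p q)"
    by eventually_elim (metis in_discD(2))
  show "\<exists>W \<Phi>. disc_chart n \<theta> W \<Phi>"
    by (rule standard_chart[OF assms, where \<theta> = \<theta>]) blast
  show "leau_fatou_flower (return_germ n \<theta> W \<Phi>) n" if "disc_chart n \<theta> W \<Phi>" for W \<Phi>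
    using return_germ_flower[OF assms that] .
qed


end
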